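(* Let $R\in\{0,1,2,\dots\}$, $n$ a positive integer with $n>\frac14R-\frac38$, and $u>0$ large. Then for $z\in\breve Z^{(0,3)}$ $$W_R^{(0,3)}\left(-\tfrac12u,\sqrt{2u}z\right)=(2u)^{\frac12R+1}\left\{\frac1{u^2}\sum_{s=0}^{n-1}(-1)^{s+1}\frac{\bar G_{s,R}(z)}{u^{2s}}+\tilde\varepsilon_{n,R}(u,z)\right\},$$ where $\bar G_{0,R}(z)=-z^R/(z^2+1)$, $\bar G_{s+1,R}(z)=\bar G_{s,R}''(z)/(z^2+1)$ ($s=0,1,2,\dots$), and for any admissible path $\mathcal L$ through $z$ (see context), provided $u$ is large enough that the quantity in braces with exponent $-1$ is positive, $$|\tilde\varepsilon_{n,R}(u,z)|\le\frac1{u^{2n+2}}\left\{|\bar G_{n,R}(z)|+\frac1{2|z^2+1|^{1/4}}\int_{\mathcal L}\left|\left\{(t^2+1)^{1/4}\bar G_{n,R}(t)\right\}'dt\right|\right\}$$ $$\qquad+\frac{L}{8u^{2n+3}|z^2+1|^{1/4}}\left\{1-\frac1{8u}\int_{\mathcal L}\left|\frac{2-3t^2}{(t^2+1)^{5/2}}dt\right|\right\}^{-1}\int_{\mathcal L}\left|\frac{2-3t^2}{(t^2+1)^{5/2}}dt\right|,$$ $$L=\sup_{t\in\mathcal L}\left|(t^2+1)^{1/4}\bar G_{n,R}(t)\right|+\frac12\int_{\mathcal L}\left|\left\{(t^2+1)^{1/4}\bar G_{n,R}(t)\right\}'dt\right|.$$ The domain $\breve Z^{(0,3)}$ contains the whole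 real axis.
   Context: $U(a,z)$ is the parabolic cylinder function: the solution of $y''-(\tfrac14z^2+a)y=0$ with $U(a,z)\sim z^{-a-1/2}e^{-z^2/4}$ as $z\to\infty$, $|\arg z|\le\frac34\pi-\delta$. $W_j(a,z)=U((-1)^jia,(-i)^jze^{-\pi i/4})$, and for $a>0$ $$W_R^{(0,3)}(-a,z)=ie^{-\pi a/2}\left[W_3(-a,z)\int_{e^{\pi i/4}\infty}^zt^RW_0(-a,t)dt-W_0(-a,z)\int_{e^{-\pi i/4}\infty}^zt^RW_3(-a,t)dt\right],$$ a particular solution of $y''+(\frac14z^2+a)y=z^R$. $\bar\xi=\int_0^z(t^2+1)^{1/2}dt$, real for real $z$, continued continuously along paths. An admissible path $\mathcal L$ is an $R_2$ path (twice continuously differentiable parametrization with nonvanishing derivative) running from $e^{\pi i/4}\infty$ to $e^{-\pi i/4}\infty$, passing through $z$, avoiding $\pm i$, and along which $\Im(\bar\xi)$ varies continuously and is monotonic. $\breve Z^{(0,3)}$ is the set of points $z$ for which an admissible path exists; its (excluded) boundary consists of the parts of the imaginary axis from $\pm i$ to $\pm i\infty$ and the level curves $\Im(\bar\xi)=\text{const}$ in the left half plane emanating from $z=\pm i$. *)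

theory Defs
  imports "HOL-Complex_Analysis.Complex_Analysis" "HOL-Library.Landau_Symbols"
begin

section \<open>Parabolic cylinder functions\<close>

definition is_parabolic_cylinder :: "complex \<Rightarrow> (complex \<Rightarrow> complex) \<Rightarrow> bool" where
  "is_parabolic_cylinder a y \<longleftrightarrow>
     y holomorphic_on UNIV \<and>
     (\<forall>z. deriv (deriv y) z - (z^2 / 4 + a) * y z = 0) \<and>
     (\<forall>\<delta>>0. y \<sim>[inf at_infinity (principal {z. \<bar>Arg z\<bar> \<le> 3 * pi / 4 - \<delta>})]
               (\<lambda>z. z powr (- a - 1 / 2) * exp (- (z^2) / 4)))"

definition parabolic_U :: "complex \<Rightarrow> complex \<Rightarrow> complex" where
  "parabolic_U a = (THE y. is_parabolic_cylinder a y)"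

definition weber_W :: "nat \<Rightarrow> complex \<Rightarrow> complex \<Rightarrow> complex" where
  "weber_W j a z = parabolic_U ((-1)^j * \<i> * a) ((- \<i>)^j * z * exp (- (pi * \<i> / 4)))"

text \<open>The integral of \<open>f\<close> from infinity, in the direction \<open>\<theta>\<close>, to \<open>z\<close>. It is used for entire
  \<open>f\<close> only, so that replacing the path by a segment is harmless.\<close>

definition integral_from_inf :: "real \<Rightarrow> (complex \<Rightarrow> complex) \<Rightarrow> complex \<Rightarrow> complex" where
  "integral_from_inf \<theta> f z =
     Lim at_top (\<lambda>r::real. contour_integral (linepath (of_real r * cis \<theta>) z) f)"

text \<open>\<open>weber_WR03 R b\<close> is the function written \<open>W\<^sub>R\<^sup>(\<^sup>0\<^sup>,\<^sup>3\<^sup>)(b, \<cdot>)\<close>; with \<open>b = -a\<close> the prefactor is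
  \<open>\<i> exp (- \<pi> a / 2)\<close>.\<close>

definition weber_WR03 :: "nat \<Rightarrow> real \<Rightarrow> complex \<Rightarrow> complex" where
  "weber_WR03 R b z = \<i> * exp (of_real (pi * b / 2)) *
     (weber_W 3 b z * integral_from_inf (pi / 4) (\<lambda>t. t^R * weber_W 0 b t) z
    - weber_W 0 b z * integral_from_inf (- pi / 4) (\<lambda>t. t^R * weber_W 3 b t) z)"


section \<open>Admissible paths\<close>

text \<open>Principal branch of \<open>\<integral>\<^sub>0\<^sup>z (t\<^sup>2 + 1)\<^sup>1\<^sup>/\<^sup>2 dt\<close>: real on the real axis, and holomorphic off the
  parts of the imaginary axis from \<open>\<plusminus>\<i>\<close> to \<open>\<plusminus>\<i>\<infinity>\<close>.\<close>

definition xi_bar :: "complex \<Rightarrow> complex" where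
  "xi_bar z = contour_integral (linepath 0 z) (\<lambda>t. csqrt (t^2 + 1))"

text \<open>\<open>X\<close> is the continuous continuation of \<open>xi_bar\<close> along \<open>\<gamma>\<close>, starting with the principal branch
  at the initial end of \<open>\<gamma>\<close>. Here \<open>q\<close> is the continued branch of \<open>(t\<^sup>2 + 1)\<^sup>1\<^sup>/\<^sup>2\<close>.\<close>

definition xi_bar_along :: "(real \<Rightarrow> complex) \<Rightarrow> (real \<Rightarrow> complex) \<Rightarrow> bool" where
  "xi_bar_along \<gamma> X \<longleftrightarrow>
     (\<exists>q. continuous_on UNIV q \<and> (\<forall>s. (q s)^2 = (\<gamma> s)^2 + 1) \<and>
          (\<forall>s. (X has_vector_derivative q s * vector_derivative \<gamma> (at s)) (at s))) \<and>
     (\<forall>\<^sub>F s in at_bot. X s = xi_bar (\<gamma> s))"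

definition R2_path :: "(real \<Rightarrow> complex) \<Rightarrow> bool" where
  "R2_path \<gamma> \<longleftrightarrow>
     (\<exists>\<gamma>' \<gamma>''. (\<forall>s. (\<gamma> has_vector_derivative \<gamma>' s) (at s)) \<and>
              (\<forall>s. (\<gamma>' has_vector_derivative \<gamma>'' s) (at s)) \<and>
              continuous_on UNIV \<gamma>'' \<and> (\<forall>s. \<gamma>' s \<noteq> 0))"

definition tends_to_inf_dir :: "real \<Rightarrow> (real \<Rightarrow> complex) \<Rightarrow> real filter \<Rightarrow> bool" where
  "tends_to_inf_dir \<theta> \<gamma> F \<longleftrightarrow>
     filterlim \<gamma> at_infinity F \<and> ((\<lambda>s. sgn (\<gamma> s)) \<longlongrightarrow> cis \<theta>) F"

definition admissible_path :: "(real \<Rightarrow> complex) \<Rightarrow> bool" where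
  "admissible_path \<gamma> \<longleftrightarrow>
     R2_path \<gamma> \<and>
     tends_to_inf_dir (pi / 4) \<gamma> at_bot \<and> tends_to_inf_dir (- pi / 4) \<gamma> at_top \<and>
     \<i> \<notin> range \<gamma> \<and> - \<i> \<notin> range \<gamma> \<and>
     (\<exists>X. xi_bar_along \<gamma> X \<and> (mono (\<lambda>s. Im (X s)) \<or> antimono (\<lambda>s. Im (X s))))"

definition Z03 :: "complex set" where
  "Z03 = {z. \<exists>\<gamma>. admissible_path \<gamma> \<and> z \<in> range \<gamma>}"


section \<open>Coefficients and the error bound\<close>

primrec G_bar :: "nat \<Rightarrow> nat \<Rightarrow> complex \<Rightarrow> complex" where
  "G_bar R 0 = (\<lambda>z. - (z^R) / (z^2 + 1))"
| "G_bar R (Suc s) = (\<lambda>z. deriv (deriv (G_bar R s)) z / (z^2 + 1))"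

text \<open>\<open>\<integral>\<^sub>\<gamma> |f(t) dt|\<close>, with value \<open>\<infinity>\<close> if it diverges.\<close>

definition abs_path_integral :: "(real \<Rightarrow> complex) \<Rightarrow> (complex \<Rightarrow> complex) \<Rightarrow> ennreal" where
  "abs_path_integral \<gamma> f =
     (\<integral>\<^sup>+ s. ennreal (cmod (f (\<gamma> s) * vector_derivative \<gamma> (at s))) \<partial>lborel)"

text \<open>The derivative of \<open>(t\<^sup>2 + 1)\<^sup>1\<^sup>/\<^sup>4 g(t)\<close>. The second factor below makes the fourth root
  holomorphic near every \<open>t \<noteq> \<plusminus>\<i>\<close>, also on the cut of \<open>powr\<close>; off the cut, the product of the two
  powers is the principal fourth root of \<open>w\<^sup>2 + 1\<close> for \<open>w\<close> near \<open>t\<close>. Only the modulus of the result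
  is used, and this does not depend on the branch.\<close>

definition deriv_root4 :: "(complex \<Rightarrow> complex) \<Rightarrow> complex \<Rightarrow> complex" where
  "deriv_root4 g t =
     deriv (\<lambda>w. (t^2 + 1) powr (1/4) * ((w^2 + 1) / (t^2 + 1)) powr (1/4) * g w) t"

definition var_G :: "nat \<Rightarrow> nat \<Rightarrow> (real \<Rightarrow> complex) \<Rightarrow> ennreal" where
  "var_G n R \<gamma> = abs_path_integral \<gamma> (deriv_root4 (G_bar R n))"

definition psi_integral :: "(real \<Rightarrow> complex) \<Rightarrow> ennreal" where
  "psi_integral \<gamma> = abs_path_integral \<gamma> (\<lambda>t. (2 - 3 * t^2) / (t^2 + 1) powr (5/2))"

definition L_const :: "nat \<Rightarrow> nat \<Rightarrow> (real \<Rightarrow> complex) \<Rightarrow> ennreal" where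
  "L_const n R \<gamma> =
     (SUP t\<in>range \<gamma>. ennreal (cmod ((t^2 + 1) powr (1/4) * G_bar R n t))) + var_G n R \<gamma> / 2"

text \<open>The subtraction in \<open>brace\<close> is truncated, but the bound is only claimed when its result
  is positive.\<close>

definition brace :: "real \<Rightarrow> (real \<Rightarrow> complex) \<Rightarrow> ennreal" where
  "brace u \<gamma> = 1 - psi_integral \<gamma> / ennreal (8 * u)"

definition error_bound :: "nat \<Rightarrow> nat \<Rightarrow> real \<Rightarrow> complex \<Rightarrow> (real \<Rightarrow> complex) \<Rightarrow> ennreal" where
  "error_bound n R u z \<gamma> =
     ennreal (1 / u^(2 * n + 2)) *
       (ennreal (cmod (G_bar R n z))
        + var_G n R \<gamma> / ennreal (2 * cmod (z^2 + 1) powr (1/4)))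
     + L_const n R \<gamma> / ennreal (8 * u^(2 * n + 3) * cmod (z^2 + 1) powr (1/4))
       * inverse (brace u \<gamma>) * psi_integral \<gamma>"

end

theory Submission
  imports Defs "HOL-Real_Asymp.Real_Asymp"
begin

text \<open>
  With \<open>u\<close>-scaling, \<open>W\<^sub>R\<^sup>(\<^sup>0\<^sup>,\<^sup>3\<^sup>)\<close> solves \<open>w'' + u\<^sup>2 (z\<^sup>2 + 1) w = (2u)\<^sup>R\<^sup>/\<^sup>2\<^sup>+\<^sup>1 z\<^sup>R\<close>, and the partial
  sum of the formal solution leaves the residual \<open>(-1)\<^sup>n\<^sup>+\<^sup>1 (z\<^sup>2 + 1) G\<^sub>n / u\<^sup>2\<^sup>n\<close>. Along an admissible path
  the Liouville transformation \<open>V = (z\<^sup>2 + 1)\<^sup>1\<^sup>/\<^sup>4 \<epsilon>\<close>, \<open>d\<xi> = (z\<^sup>2 + 1)\<^sup>1\<^sup>/\<^sup>2 dz\<close> turns the equation of the error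
  into \<open>V'' + u\<^sup>2 V = \<psi> V + F\<close>, which is solved by variation of parameters from the two ends of the path.
  The kernels have modulus at most 1 because \<open>Im \<xi>\<close> is monotonic; one integration by parts of the
  \<open>F\<close>-terms and absorption of \<open>sup \<bar>V\<bar>\<close> give the bound. No boundary terms appear provided \<open>V\<close> is bounded and
  its derivative grows polynomially at both ends. This follows by integrating by parts against a partial
  sum with a large number of terms, for which the residual decays.

  The function \<open>U(a, z)\<close> is obtained for \<open>Re a > -1/2\<close> from
  \<open>exp (-z\<^sup>2/4) / \<Gamma>(a + 1/2) \<integral> t\<^sup>a\<^sup>-\<^sup>1\<^sup>/\<^sup>2 exp (-t\<^sup>2/2 - z t) dt\<close> over a ray of argument less than \<open>\<pi>/4\<close> in modulus.
  Every ray gives a solution of the differential equation that is recessive on the positive real axis;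
  as the recessive solution is unique, all rays give the same function, and together they cover the
  sector \<open>\<bar>arg z\<bar> < 3\<pi>/4\<close>.
\<close>

section \<open>The integral representation\<close>

text \<open>The obstacle lies at the two ends of a path. There one of the two Weber functions is
  exponentially large, and \<open>weber_WR03\<close> multiplies it by a primitive of
  \<open>t^R\<close> times the small one. Estimated directly, such a product is only seen to be
  bounded by a power of |z| that grows with \<open>R\<close>, whereas a bounded \<open>V\<close>
  needs a remainder of order |z|^(-1/2). After the passage to the partial sum of \<open>N\<close>
  terms the products are O(1/|z|). The terms with index s from \<open>n\<close> to
  \<open>N - 1\<close> must then be given back; they are O(|z|^(R - 2 - 4 s)), and R - 2 - 4 n <=
  -1/2 is the origin of the threshold R/4 - 3/8. The two halves of the argument are independent: the
  estimate along a path holds for every solution of the error equation with suitable growth in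
  sectors around the arguments pi/4 and -pi/4, and the Weber functions only serve to verify that
  growth. Integrals that may diverge live in \<open>ennreal\<close>; an infinite variation makes the
  bound trivial, and a positive \<open>brace\<close> forces the other integral to be finite.\<close>

lemma set_integrable_powr_exp:
  fixes x c :: real
  assumes "x > 0" "c > 0"
  shows "set_integrable lborel {0<..} (\<lambda>v. v powr (x - 1) * exp (- (c * v)))"
proof -
  have "(\<lambda>t. complex_of_real t powr (of_real x - 1) / of_real (exp (c * t)))
             absolutely_integrable_on {0<..}"
    using absolutely_integrable_Gamma_integral[of "of_real x" c] assms by simp
  from absolutely_integrable_norm[OF this]
  have "(\<lambda>v. v powr (x - 1) * exp (- (c * v))) absolutely_integrable_on {0<..}"
    by (rule set_integrable_cong[THEN iffD1, rotated -1])
       (auto simp: norm_divide norm_powr_real_powr exp_minus field_simps)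
  then show ?thesis
    unfolding set_integrable_def
    by (subst (asm) integrable_completion) auto
qed

text \<open>On the ray t = l v the integrand t^(s-1) exp(-t^2/2 - z t) dt becomes l^s times this
  kernel with k = l^2 and w = l z. Keeping \<open>k\<close> and \<open>w\<close> independent
  includes k = 0, the Gamma integral, as the comparison case.\<close>

definition weber_kernel :: "complex \<Rightarrow> complex \<Rightarrow> complex \<Rightarrow> real \<Rightarrow> complex" where
  "weber_kernel s k w v = of_real v powr (s - 1) * exp (- (k * of_real v ^ 2 / 2) - w * of_real v)"

definition weber_int :: "complex \<Rightarrow> complex \<Rightarrow> complex \<Rightarrow> complex" where
  "weber_int s k w = (LBINT v:{0<..}. weber_kernel s k w v)"

text \<open>One hypothesis for the two regimes in which the integral converges at infinity:
  \<open>Re k > 0\<close> with arbitrary \<open>w\<close>, and \<open>Re w > 0\<close> with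
  \<open>Re k\<close> nonnegative.\<close>

definition exp_decay :: "complex \<Rightarrow> complex \<Rightarrow> real \<Rightarrow> real \<Rightarrow> bool" where
  "exp_decay k w c C \<longleftrightarrow> c > 0 \<and> (\<forall>v\<ge>0. - (Re k * v^2 / 2) - Re w * v \<le> C - c * v)"

lemma exp_decay_Re_pos:
  assumes "Re w > 0" "Re k \<ge> 0"
  shows "exp_decay k w (Re w) 0"
  using assms by (auto simp: exp_decay_def)

lemma exp_decay_quadratic:
  assumes "Re k > 0"
  shows "exp_decay k w 1 ((1 - Re w)^2 / (2 * Re k))"
  unfolding exp_decay_def
proof (intro conjI allI impI)
  fix v :: real
  have "0 \<le> (Re k * v - (1 - Re w))^2 / (2 * Re k)" using assms by simp
  also have "\<dots> = Re k * v^2 / 2 - (1 - Re w) * v + (1 - Re w)^2 / (2 * Re k)"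
    using assms by (simp add: field_simps power2_eq_square)
  finally show "- (Re k * v^2 / 2) - Re w * v \<le> (1 - Re w)^2 / (2 * Re k) - 1 * v"
    by (simp add: algebra_simps)
qed simp

lemma norm_weber_kernel:
  "v > 0 \<Longrightarrow> cmod (weber_kernel s k w v) = v powr (Re s - 1) * exp (- (Re k * v^2 / 2) - Re w * v)"
  by (simp add: weber_kernel_def norm_mult norm_powr_real_powr flip: of_real_power)

lemma weber_kernel_Suc:
  "v > 0 \<Longrightarrow> weber_kernel (s + 1) k w v = of_real v * weber_kernel s k w v"
  by (simp add: weber_kernel_def powr_diff powr_add)

lemma isCont_weber_kernel: "v > 0 \<Longrightarrow> isCont (weber_kernel s k w) v"
  unfolding weber_kernel_def by (intro continuous_intros) (auto simp: complex_nonpos_Reals_iff)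

lemma weber_kernel_measurable [measurable]:
  "set_borel_measurable lborel {0<..} (weber_kernel s k w)"
  unfolding set_borel_measurable_def
  using borel_measurable_continuous_on_indicator[of "{0<..}" "weber_kernel s k w"]
  by (simp add: continuous_at_imp_continuous_on isCont_weber_kernel)

lemma norm_weber_kernel_le:
  assumes "exp_decay k w c C" "v > 0"
  shows "cmod (weber_kernel s k w v) \<le> exp C * (v powr (Re s - 1) * exp (- (c * v)))"
proof -
  have "exp (- (Re k * v^2 / 2) - Re w * v) \<le> exp (C - c * v)"
    using assms by (auto simp: exp_decay_def)
  also have "\<dots> = exp C * exp (- (c * v))" by (simp flip: exp_add)
  finally have "v powr (Re s - 1) * exp (- (Re k * v^2 / 2) - Re w * v)
      \<le> v powr (Re s - 1) * (exp C * exp (- (c * v)))" by (intro mult_left_mono) auto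
  then show ?thesis using assms by (simp add: norm_weber_kernel algebra_simps)
qed

lemma weber_kernel_integrable:
  assumes "exp_decay k w c C" "Re s > 0"
  shows "set_integrable lborel {0<..} (weber_kernel s k w)"
proof (rule set_integrable_bound)
  show "set_integrable lborel {0<..} (\<lambda>v. exp C * (v powr (Re s - 1) * exp (- (c * v))))"
    using set_integrable_powr_exp[of "Re s" c] assms by (auto simp: exp_decay_def)
  show "AE v in lborel. v \<in> {0<..} \<longrightarrow>
      norm (weber_kernel s k w v) \<le> norm (exp C * (v powr (Re s - 1) * exp (- (c * v))))"
    using norm_weber_kernel_le[OF assms(1)] by auto
qed (simp add: weber_kernel_measurable)

text \<open>Differentiation under the integral sign with an explicit quadratic remainder: for |h| <
  c/2 the perturbation exp(-h v) uses up at most half of the decay rate \<open>c\<close>, so the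
  Taylor remainder keeps an integrable majorant.\<close>

lemma weber_int_DERIV:
  assumes "exp_decay k w c C" "Re s > 0"
  shows "((\<lambda>w. weber_int s k w) has_field_derivative - weber_int (s + 1) k w) (at w)"
proof -
  have c: "c > 0" using assms by (simp add: exp_decay_def)
  \<comment> \<open>The quadratic Taylor remainder contributes a factor v^2, hence the exponent
    \<open>Re s + 2 - 1\<close>; the rate \<open>c/2\<close> is what the perturbation leaves
    over.\<close>
  define D where "D = (LBINT v:{0<..}. exp C * (v powr (Re s + 2 - 1) * exp (- (c/2 * v))))"
  have D_int: "set_integrable lborel {0<..} (\<lambda>v. exp C * (v powr (Re s + 2 - 1) * exp (- (c/2 * v))))"
    using set_integrable_powr_exp[of "Re s + 2" "c/2"] assms c by auto
  have main: "cmod (weber_int s k (w + h) - weber_int s k w + h * weber_int (s + 1) k w) \<le> (cmod h)^2 * D"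
    if h: "cmod h < c / 2" for h
  proof -
    have dec: "exp_decay k (w + h) (c/2) C"
      unfolding exp_decay_def
    proof (intro conjI allI impI)
      fix v :: real assume v: "v \<ge> 0"
      have "\<bar>Re h\<bar> \<le> c/2" using h abs_Re_le_cmod[of h] by linarith
      then have "- (Re h) * v \<le> c/2 * v" using v by (intro mult_right_mono) auto
      moreover have "- (Re k * v^2 / 2) - Re w * v \<le> C - c * v" using assms v by (simp add: exp_decay_def)
      ultimately show "- (Re k * v^2 / 2) - Re (w + h) * v \<le> C - c/2 * v" by (simp add: algebra_simps)
    qed (use c in simp)
    let ?f = "\<lambda>v. weber_kernel s k (w + h) v - weber_kernel s k w v + h * weber_kernel (s + 1) k w v"
    have i1: "set_integrable lborel {0<..} (weber_kernel s k (w + h))"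
      "set_integrable lborel {0<..} (weber_kernel s k w)"
      "set_integrable lborel {0<..} (weber_kernel (s + 1) k w)"
      using weber_kernel_integrable[OF dec] weber_kernel_integrable[OF assms(1)] assms(2) by auto
    have fint: "set_integrable lborel {0<..} ?f"
      using i1 by (intro set_integral_add set_integral_diff) auto
    have eq: "weber_int s k (w + h) - weber_int s k w + h * weber_int (s + 1) k w = (LBINT v:{0<..}. ?f v)"
      using i1 by (simp add: weber_int_def set_integral_add set_integral_diff)
    have bd: "cmod (?f v) \<le> (cmod h)^2 * (exp C * (v powr (Re s + 2 - 1) * exp (- (c/2 * v))))"
      if v: "v > 0" for v
    proof -
      define y where "y = - (h * of_real v)"
      have "weber_kernel s k (w + h) v = weber_kernel s k w v * exp y"
      proof -
        have e: "- (k * of_real v ^ 2 / 2) - (w + h) * of_real v = (- (k * of_real v ^ 2 / 2) - w * of_real v) + y"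
          by (simp add: y_def algebra_simps)
        show ?thesis unfolding weber_kernel_def e exp_add by (simp only: mult.assoc)
      qed
      then have "?f v = weber_kernel s k w v * (exp y - (1 + y))"
        using weber_kernel_Suc[OF v, of s k w] by (simp add: y_def algebra_simps)
      moreover have "cmod (exp y - (1 + y)) \<le> exp \<bar>Re y\<bar> * (cmod y)^2"
        using Taylor_exp[of y 1] by (simp add: power2_eq_square numeral_2_eq_2)
      moreover have "exp \<bar>Re y\<bar> \<le> exp (c/2 * v)"
      proof -
        have "\<bar>Re y\<bar> \<le> cmod y" by (rule abs_Re_le_cmod)
        also have "\<dots> = cmod h * v" using v by (simp add: y_def norm_mult)
        also have "\<dots> \<le> c/2 * v" using h v by (intro mult_right_mono) auto
        finally show ?thesis by simp
      qed
      moreover have "(cmod y)^2 = (cmod h)^2 * v powr 2"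
        using v by (simp add: y_def norm_mult power_mult_distrib)
      ultimately have "cmod (?f v) \<le> cmod (weber_kernel s k w v) * (exp (c/2 * v) * ((cmod h)^2 * v powr 2))"
        by (smt (verit) norm_mult mult_left_mono mult_right_mono norm_ge_zero zero_le_power2)
      also have "\<dots> \<le> (exp C * (v powr (Re s - 1) * exp (- (c * v)))) * (exp (c/2 * v) * ((cmod h)^2 * v powr 2))"
        by (intro mult_right_mono norm_weber_kernel_le[OF assms(1) v]) auto
      also have "\<dots> = (cmod h)^2 * (exp C * ((v powr (Re s - 1) * v powr 2) * (exp (- (c * v)) * exp (c/2 * v))))"
        by (simp add: algebra_simps)
      also have "exp (- (c * v)) * exp (c/2 * v) = exp (- (c/2 * v))"
        by (subst exp_add [symmetric]) (simp add: field_simps)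
      also have "v powr (Re s - 1) * v powr 2 = v powr (Re s + 2 - 1)"
        by (subst powr_add [symmetric]) (simp add: algebra_simps)
      finally show ?thesis .
    qed
    have "cmod (LBINT v:{0<..}. ?f v) \<le> (LBINT v:{0<..}. cmod (?f v))"
      using fint by (rule set_integral_norm_bound)
    also have "\<dots> \<le> (LBINT v:{0<..}. (cmod h)^2 * (exp C * (v powr (Re s + 2 - 1) * exp (- (c/2 * v)))))"
      using bd fint D_int by (intro set_integral_mono set_integrable_norm set_integrable_mult_right) auto
    also have "\<dots> = (cmod h)^2 * D" unfolding D_def by (rule set_integral_mult_right)
    finally show ?thesis using eq by simp
  qed
  show ?thesis unfolding DERIV_def
  proof (rule Lim_null[THEN iffD2, OF Lim_null_comparison])
    show "((\<lambda>h. cmod h * D) \<longlongrightarrow> 0) (at 0)" by (auto intro!: tendsto_eq_intros)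
    have "\<forall>\<^sub>F h in at (0::complex). cmod h < c / 2 \<and> h \<noteq> 0"
      using c eventually_at_ball[of "c/2" "0::complex" UNIV]
      by (auto simp: eventually_at_filter dist_norm elim: eventually_mono)
    then show "\<forall>\<^sub>F h in at 0. cmod ((weber_int s k (w + h) - weber_int s k w) / h - - weber_int (s + 1) k w) \<le> cmod h * D"
    proof eventually_elim
      case (elim h)
      then have "(weber_int s k (w + h) - weber_int s k w) / h - - weber_int (s + 1) k w
        = (weber_int s k (w + h) - weber_int s k w + h * weber_int (s + 1) k w) / h" by (simp add: field_simps)
      then show ?case using main[of h] elim
        by (simp add: norm_divide divide_simps power2_eq_square mult_ac)
    qed
  qed
qed

lemma tendsto_powr_times_exp:
  fixes x c :: real
  assumes "c > 0"
  shows "((\<lambda>v. v powr x * exp (- (c * v))) \<longlongrightarrow> 0) at_top"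
  using assms by real_asymp

text \<open>The derivative of v^s exp(-k v^2/2 - w v) integrates to zero over the half line. With k
  = l^2 and w = l z this recurrence is the Weber equation in disguise; with k = 0 it is the
  functional equation of Gamma.\<close>

lemma weber_int_parts:
  assumes "exp_decay k w c C" "Re s > 0"
  shows "s * weber_int s k w = k * weber_int (s + 2) k w + w * weber_int (s + 1) k w"
proof -
  let ?F = "\<lambda>v. weber_kernel (s + 1) k w v"
  let ?f = "\<lambda>v. s * weber_kernel s k w v - k * weber_kernel (s + 2) k w v - w * weber_kernel (s + 1) k w v"
  have c: "c > 0" using assms by (simp add: exp_decay_def)
  have i1: "set_integrable lborel {0<..} (weber_kernel s k w)"
      "set_integrable lborel {0<..} (weber_kernel (s + 1) k w)"
      "set_integrable lborel {0<..} (weber_kernel (s + 2) k w)"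
      using weber_kernel_integrable[OF assms(1)] assms(2) by auto
  have k2: "weber_kernel (s + 2) k w v = of_real v ^ 2 * weber_kernel s k w v" if "v > 0" for v
    using weber_kernel_Suc[OF that, of s k w] weber_kernel_Suc[OF that, of "s+1" k w]
    by (simp add: power2_eq_square add.assoc)
  have "(LBINT v=0..\<infinity>. ?f v) = 0 - 0"
  proof (rule interval_integral_FTC_integrable[where F = ?F])
    fix v :: real assume "0 < ereal v"
    then have v: "v > 0" by simp
    have "((\<lambda>z. z powr s * exp (- (k * z ^ 2 / 2) - w * z)) has_field_derivative
       s * of_real v powr (s - 1) * exp (- (k * of_real v ^ 2 / 2) - w * of_real v)
       + of_real v powr s * (exp (- (k * of_real v ^ 2 / 2) - w * of_real v) * (- (k * of_real v) - w))) (at (of_real v))"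
      using v by (auto intro!: derivative_eq_intros simp: complex_nonpos_Reals_iff power2_eq_square field_simps)
    then have "((\<lambda>x. of_real x powr s * exp (- (k * of_real x ^ 2 / 2) - w * of_real x)) has_vector_derivative
       s * of_real v powr (s - 1) * exp (- (k * of_real v ^ 2 / 2) - w * of_real v)
       + of_real v powr s * (exp (- (k * of_real v ^ 2 / 2) - w * of_real v) * (- (k * of_real v) - w))) (at v)"
      by (rule has_vector_derivative_real_field)
    moreover have "of_real v powr s = of_real v * of_real v powr (s - 1)"
      using v by (simp add: powr_diff)
    ultimately show "(?F has_vector_derivative ?f v) (at v)"
      using k2[OF v] weber_kernel_Suc[OF v, of s k w] unfolding weber_kernel_def
      by (simp add: algebra_simps power2_eq_square)
    show "isCont ?f v" using v by (intro continuous_intros isCont_weber_kernel)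
  next
    have "set_integrable lborel {0<..} ?f" using i1 by (intro set_integral_diff set_integrable_mult_right)
    moreover have "einterval 0 \<infinity> = {0<..}" by (auto simp: einterval_def)
    ultimately show "set_integrable lborel (einterval 0 \<infinity>) ?f" by simp
    have bd: "cmod (?F v) \<le> exp C * (v powr Re s * exp (- (c * v)))" if "v > 0" for v
      using norm_weber_kernel_le[OF assms(1) that, of "s+1"] by simp
    \<comment> \<open>\<open>Re s > 0\<close> makes the boundary term at the origin vanish.\<close>
    have "((\<lambda>v. exp C * (v powr Re s * exp (- (c * v)))) \<longlongrightarrow> 0) (at_right 0)"
    proof -
      have "\<forall>\<^sub>F v::real in at_right 0. v \<ge> 0"
        using eventually_at_right_less[of "0::real"] by (auto elim: eventually_mono)
      then have "((\<lambda>v. v powr Re s) \<longlongrightarrow> 0 powr Re s) (at_right 0)"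
        using assms(2) by (intro tendsto_powr') auto
      moreover have "((\<lambda>v. exp (- (c * v))) \<longlongrightarrow> exp (- (c * 0))) (at_right 0)"
        by (intro tendsto_intros)
      ultimately have "((\<lambda>v. exp C * (v powr Re s * exp (- (c * v)))) \<longlongrightarrow>
          exp C * (0 powr Re s * exp (- (c * 0)))) (at_right 0)" by (intro tendsto_mult tendsto_const)
      then show ?thesis by simp
    qed
    then have "(?F \<longlongrightarrow> 0) (at_right 0)"
      by (rule Lim_null_comparison[rotated]) (rule eventually_mono[OF eventually_at_right_less[of 0] bd])
    then show "((?F \<circ> real_of_ereal) \<longlongrightarrow> 0) (at_right 0)"
      by (simp add: zero_ereal_def ereal_tendsto_simps)
    have "((\<lambda>v. exp C * (v powr Re s * exp (- (c * v)))) \<longlongrightarrow> 0) at_top"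
      by (intro tendsto_mult_right_zero tendsto_powr_times_exp c)
    then have "(?F \<longlongrightarrow> 0) at_top"
      by (rule Lim_null_comparison[rotated]) (rule eventually_mono[OF eventually_gt_at_top[of 0] bd])
    then show "((?F \<circ> real_of_ereal) \<longlongrightarrow> 0) (at_left \<infinity>)"
      by (simp add: ereal_tendsto_simps)
  qed simp
  then have "(LBINT v:{0<..}. ?f v) = 0"
    by (simp add: interval_lebesgue_integral_0_infty)
  then show ?thesis using i1
    by (simp add: set_integral_diff weber_int_def set_integrable_mult_right diff_eq_eq add.commute)
qed

text \<open>For k = 0 the recurrence \<open>weber_int_parts\<close> says exactly that w^s times the
  integral has derivative zero in the right half plane; the constant is read off at w = 1. This
  replaces a rotation of the path of integration.\<close>

lemma weber_int_zero:
  assumes "Re w > 0" "Re s > 0"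
  shows "weber_int s 0 w = w powr (- s) * Gamma s"
proof -
  let ?S = "{w. Re w > 0}"
  have "\<exists>c. \<forall>w\<in>?S. w powr s * weber_int s 0 w = c"
  proof (rule has_field_derivative_zero_constant)
    show "convex ?S" by (rule convex_halfspace_Re_gt)
    fix w assume "w \<in> ?S"
    then have w: "Re w > 0" by simp
    have dec: "exp_decay 0 w (Re w) 0" using w by (intro exp_decay_Re_pos) auto
    have wn: "w \<notin> \<real>\<^sub>\<le>\<^sub>0" "w \<noteq> 0" using w by (auto simp: complex_nonpos_Reals_iff)
    have "((\<lambda>w. w powr s * weber_int s 0 w) has_field_derivative
        s * w powr (s - 1) * weber_int s 0 w + - weber_int (s + 1) 0 w * w powr s) (at w)"
      using wn by (intro DERIV_mult weber_int_DERIV[OF dec assms(2)] has_field_derivative_powr)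
    moreover have "s * w powr (s - 1) * weber_int s 0 w + - weber_int (s + 1) 0 w * w powr s
        = w powr (s - 1) * (s * weber_int s 0 w - w * weber_int (s + 1) 0 w)"
      using wn by (simp add: powr_diff field_simps)
    moreover have "s * weber_int s 0 w - w * weber_int (s + 1) 0 w = 0"
      using weber_int_parts[OF dec assms(2)] by simp
    ultimately show "((\<lambda>w. w powr s * weber_int s 0 w) has_field_derivative 0) (at w within ?S)"
      by (metis has_field_derivative_at_within mult_zero_right)
  qed
  then obtain c where c: "\<And>w. Re w > 0 \<Longrightarrow> w powr s * weber_int s 0 w = c" by auto
  have "set_integrable lborel {0<..} (weber_kernel s 0 1)"
    using exp_decay_Re_pos[of 1 0] assms by (intro weber_kernel_integrable) auto
  then have "weber_int s 0 1 = integral {0<..} (weber_kernel s 0 1)"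
    unfolding weber_int_def by (rule set_borel_integral_eq_integral)
  also have "\<dots> = integral {0<..} (\<lambda>t. of_real t powr (s - 1) / of_real (exp t))"
    by (intro integral_cong) (simp add: weber_kernel_def exp_minus exp_of_real field_simps)
  also have "\<dots> = Gamma s" using Gamma_integral_complex'[OF assms(2)] by (rule integral_unique)
  finally have "c = Gamma s" using c[of 1] by simp
  then have "w powr s * weber_int s 0 w = Gamma s" using c[OF assms(1)] by simp
  moreover have "w powr s \<noteq> 0" using assms(1) by auto
  ultimately show ?thesis by (metis powr_minus mult.assoc mult.left_neutral left_inverse)
qed

lemma norm_exp_minus_one_le:
  assumes "Re z \<le> 0"
  shows "cmod (exp z - 1) \<le> cmod z"
proof -
  have "cmod (exp z - exp 0) \<le> 1 * cmod (z - 0)"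
    by (rule field_differentiable_bound[where S="{z. Re z \<le> 0}" and f'=exp])
       (use assms in \<open>auto intro: convex_halfspace_Re_le DERIV_subset[OF DERIV_exp]\<close>)
  then show ?thesis by simp
qed

lemma LBINT_powr_exp:
  fixes x c :: real
  assumes "x > 0" "c > 0"
  shows "(LBINT v:{0<..}. v powr (x - 1) * exp (- (c * v))) = c powr (- x) * Gamma x"
proof -
  have "complex_of_real (LBINT v:{0<..}. v powr (x - 1) * exp (- (c * v)))
      = (LBINT v:{0<..}. complex_of_real (v powr (x - 1) * exp (- (c * v))))"
    by (rule set_integral_complex_of_real [symmetric])
  also have "\<dots> = weber_int (of_real x) 0 (of_real c)"
    unfolding weber_int_def
    by (intro set_lebesgue_integral_cong)
       (auto simp: weber_kernel_def powr_of_real powr_Reals_eq simp flip: exp_of_real)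
  also have "\<dots> = of_real (c powr (- x) * Gamma x)"
    using assms by (subst weber_int_zero) (auto simp: powr_of_real[symmetric] Gamma_complex_of_real)
  finally show ?thesis using of_real_eq_iff by blast
qed

text \<open>Since \<open>Re k\<close> is nonnegative, |exp(-k v^2/2) - 1| <= |k| v^2/2. The extra
  factor v^2 shifts the Gamma integral by two, so relative to the leading term the difference is of
  order |w|^(-2) wherever \<open>Re w\<close> is comparable with |w|.\<close>

lemma weber_int_diff_le:
  assumes "Re w > 0" "Re k \<ge> 0" "Re s > 0"
  shows "cmod (weber_int s k w - weber_int s 0 w) \<le> cmod k / 2 * (Re w powr - (Re s + 2) * Gamma (Re s + 2))"
proof -
  have i: "set_integrable lborel {0<..} (weber_kernel s k w)" "set_integrable lborel {0<..} (weber_kernel s 0 w)"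
    using weber_kernel_integrable[OF exp_decay_Re_pos] assms by auto
  have j: "set_integrable lborel {0<..} (\<lambda>v. v powr (Re s + 2 - 1) * exp (- (Re w * v)))"
    using assms by (intro set_integrable_powr_exp) auto
  have "cmod (weber_int s k w - weber_int s 0 w) = cmod (LBINT v:{0<..}. weber_kernel s k w v - weber_kernel s 0 w v)"
    using i by (simp add: weber_int_def set_integral_diff)
  also have "\<dots> \<le> (LBINT v:{0<..}. cmod (weber_kernel s k w v - weber_kernel s 0 w v))"
    using i by (intro set_integral_norm_bound set_integral_diff)
  also have "\<dots> \<le> (LBINT v:{0<..}. cmod k / 2 * (v powr (Re s + 2 - 1) * exp (- (Re w * v))))"
  proof (rule set_integral_mono)
    fix v :: real assume "v \<in> {0<..}"
    then have v: "v > 0" by simp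
    have "weber_kernel s k w v - weber_kernel s 0 w v = weber_kernel s 0 w v * (exp (- (k * of_real v^2 / 2)) - 1)"
    proof -
      have e: "- (k * of_real v ^ 2 / 2) - w * of_real v = (- (0 * of_real v ^ 2 / 2) - w * of_real v) + - (k * of_real v^2 / 2)"
        by simp
      show ?thesis unfolding weber_kernel_def e exp_add by (simp only: mult.assoc right_diff_distrib mult_1_right)
    qed
    moreover have "cmod (exp (- (k * of_real v^2 / 2)) - 1) \<le> cmod (- (k * of_real v^2 / 2))"
      using assms by (intro norm_exp_minus_one_le) (simp flip: of_real_power)
    moreover have "cmod (- (k * of_real v^2 / 2)) = cmod k / 2 * v powr 2"
      using v by (simp add: norm_mult norm_power norm_divide)
    ultimately have "cmod (weber_kernel s k w v - weber_kernel s 0 w v) \<le>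
        cmod (weber_kernel s 0 w v) * (cmod k / 2 * v powr 2)"
      by (metis norm_mult mult_left_mono norm_ge_zero)
    also have "cmod (weber_kernel s 0 w v) = v powr (Re s - 1) * exp (- (Re w * v))"
      using norm_weber_kernel[OF v, of s 0 w] by simp
    also have "v powr (Re s - 1) * exp (- (Re w * v)) * (cmod k / 2 * v powr 2)
        = cmod k / 2 * ((v powr (Re s - 1) * v powr 2) * exp (- (Re w * v)))"
      by (simp add: algebra_simps)
    also have "v powr (Re s - 1) * v powr 2 = v powr (Re s + 2 - 1)"
      by (subst powr_add [symmetric]) (simp add: algebra_simps)
    finally show "cmod (weber_kernel s k w v - weber_kernel s 0 w v)
        \<le> cmod k / 2 * (v powr (Re s + 2 - 1) * exp (- (Re w * v)))" .
  qed (use i j in \<open>auto intro!: set_integrable_norm set_integral_diff\<close>)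
  also have "\<dots> = cmod k / 2 * (Re w powr - (Re s + 2) * Gamma (Re s + 2))"
    using LBINT_powr_exp[of "Re s + 2" "Re w"] assms by (subst set_integral_mult_right) auto
  finally show ?thesis .
qed

section \<open>The solution attached to a ray and its leading asymptotics\<close>

definition weber_sol :: "complex \<Rightarrow> complex \<Rightarrow> complex \<Rightarrow> complex" where
  "weber_sol s l z = l powr s / Gamma s * (exp (- (z^2) / 4) * weber_int s (l^2) (l * z))"

text \<open>Differentiating in z raises the index of \<open>weber_int\<close> by one and brings down
  a factor -l, so only the integrals with exponents s, s + 1, s + 2 occur in the second derivative.
  \<open>weber_int_parts\<close> is the one linear relation among them.\<close>

lemma weber_sol_ODE:
  assumes "Re s > 0" "Re (l^2) > 0"
  shows "weber_sol s l holomorphic_on UNIV"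
    and "deriv (deriv (weber_sol s l)) z - (z^2 / 4 + (s - 1/2)) * weber_sol s l z = 0"
proof -
  define c where "c = l powr s / Gamma s"
  define P where "P = (\<lambda>j z. weber_int (s + j) (l^2) (l * z))"
  have dP: "(P j has_field_derivative - l * P (j + 1) z) (at z)" if "Re j \<ge> 0" for j z
  proof -
    have "((\<lambda>w. weber_int (s + j) (l^2) w) has_field_derivative - weber_int (s + j + 1) (l^2) (l * z)) (at (l * z))"
      using assms that by (intro weber_int_DERIV[OF exp_decay_quadratic]) auto
    moreover have "((\<lambda>z. l * z) has_field_derivative l) (at z)"
      by (auto intro!: derivative_eq_intros)
    ultimately show ?thesis
      unfolding P_def using DERIV_chain2[where f="\<lambda>w. weber_int (s + j) (l^2) w" and g="\<lambda>z. l * z"]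
      by (fastforce simp: add.assoc mult.commute)
  qed
  define y1 where "y1 = (\<lambda>z. c * (exp (- (z^2) / 4) * (- z / 2 * P 0 z - l * P 1 z)))"
  have P01: "(P 0 has_field_derivative - l * P 1 z) (at z)" "(P 1 has_field_derivative - l * P 2 z) (at z)" for z
    using dP[of 0 z] dP[of 1 z] by auto
  have d1: "(weber_sol s l has_field_derivative y1 z) (at z)" for z
  proof -
    have "((\<lambda>z. c * (exp (- (z^2) / 4) * P 0 z)) has_field_derivative y1 z) (at z)"
      unfolding y1_def by (rule derivative_eq_intros P01 refl | simp add: field_simps)+
    then show ?thesis unfolding P_def c_def weber_sol_def by simp
  qed
  have d2: "(y1 has_field_derivative c * (exp (- (z^2) / 4) * ((z^2 / 4 - 1/2) * P 0 z + (l * z) * P 1 z + l^2 * P 2 z))) (at z)" for z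
    unfolding y1_def
    by (rule derivative_eq_intros P01 refl | simp add: field_simps power2_eq_square)+
  show "weber_sol s l holomorphic_on UNIV"
    using d1 by (auto simp: holomorphic_on_open)
  have "deriv (weber_sol s l) = y1" using d1 by (intro ext DERIV_imp_deriv)
  moreover have "s * P 0 z = l^2 * P 2 z + (l * z) * P 1 z"
    using weber_int_parts[OF exp_decay_quadratic[OF assms(2), of "l*z"] assms(1)] by (simp add: P_def)
  then have "(z^2 / 4 - 1/2) * P 0 z + (l * z) * P 1 z + l^2 * P 2 z = (z^2 / 4 + (s - 1/2)) * P 0 z"
    by (simp add: algebra_simps)
  ultimately show "deriv (deriv (weber_sol s l)) z - (z^2 / 4 + (s - 1/2)) * weber_sol s l z = 0"
    using DERIV_imp_deriv[OF d2, of z] by (simp add: weber_sol_def P_def c_def)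
qed

definition weber_lead :: "complex \<Rightarrow> complex \<Rightarrow> complex" where
  "weber_lead a z = z powr (- a - 1 / 2) * exp (- (z^2) / 4)"

text \<open>An explicit form of asymptotic equivalence on a set: two sets are merged by taking the
  larger of two radii, and Cauchy estimates can be applied to the quotient minus 1.\<close>

definition weber_asymp :: "complex \<Rightarrow> (complex \<Rightarrow> complex) \<Rightarrow> complex set \<Rightarrow> bool" where
  "weber_asymp a y S \<longleftrightarrow> (\<forall>e>0. \<exists>B. \<forall>z\<in>S. cmod z \<ge> B \<longrightarrow> cmod (y z / weber_lead a z - 1) \<le> e)"

lemma weber_asymp_subset: "weber_asymp a y S \<Longrightarrow> T \<subseteq> S \<Longrightarrow> weber_asymp a y T"
  unfolding weber_asymp_def by (meson subsetD)

text \<open>\<open>asymp_equiv\<close> reads 0/0 as 1, so the two notions agree once the leading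
  term has no zero; that is why the origin is excluded.\<close>

lemma weber_asymp_iff_asymp_equiv:
  assumes "0 \<notin> S"
  shows "weber_asymp a y S \<longleftrightarrow> y \<sim>[inf at_infinity (principal S)] weber_lead a"
proof -
  have nz: "weber_lead a z \<noteq> 0" if "z \<in> S" for z using that assms by (auto simp: weber_lead_def)
  have "y \<sim>[inf at_infinity (principal S)] weber_lead a \<longleftrightarrow>
     ((\<lambda>z. y z / weber_lead a z) \<longlongrightarrow> 1) (inf at_infinity (principal S))"
    unfolding asymp_equiv_def
    by (rule tendsto_cong) (use nz in \<open>auto simp: eventually_inf_principal\<close>)
  also have "\<dots> \<longleftrightarrow> weber_asymp a y S"
  proof
    assume L: "((\<lambda>z. y z / weber_lead a z) \<longlongrightarrow> 1) (inf at_infinity (principal S))"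
    show "weber_asymp a y S" unfolding weber_asymp_def
    proof (intro allI impI)
      fix e :: real assume "e > 0"
      from tendstoD[OF L this] obtain B where "\<And>z. cmod z \<ge> B \<Longrightarrow> z \<in> S \<Longrightarrow> dist (y z / weber_lead a z) 1 < e"
        by (auto simp: eventually_inf_principal eventually_at_infinity)
      then show "\<exists>B. \<forall>z\<in>S. cmod z \<ge> B \<longrightarrow> cmod (y z / weber_lead a z - 1) \<le> e"
        by (intro exI[of _ B]) (auto simp: dist_norm intro: less_imp_le)
    qed
  next
    assume A: "weber_asymp a y S"
    show "((\<lambda>z. y z / weber_lead a z) \<longlongrightarrow> 1) (inf at_infinity (principal S))"
    proof (rule tendstoI)
      fix e :: real assume "e > 0"
      then obtain B where "\<forall>z\<in>S. cmod z \<ge> B \<longrightarrow> cmod (y z / weber_lead a z - 1) \<le> e / 2"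
        using A unfolding weber_asymp_def by (meson half_gt_zero)
      then have "\<forall>z. cmod z \<ge> B \<longrightarrow> z \<in> S \<longrightarrow> dist (y z / weber_lead a z) 1 < e"
        using \<open>e > 0\<close> by (force simp: dist_norm)
      then show "\<forall>\<^sub>F z in inf at_infinity (principal S). dist (y z / weber_lead a z) 1 < e"
        unfolding eventually_inf_principal eventually_at_infinity by blast
    qed
  qed
  finally show ?thesis by simp
qed

lemma norm_powr_complex_le:
  assumes "z \<noteq> 0"
  shows "cmod (z powr s) \<le> cmod z powr Re s * exp (pi * \<bar>Im s\<bar>)"
proof -
  have "cmod (z powr s) = exp (Re s * ln (cmod z) - Im s * Arg z)"
    using assms by (simp add: powr_def Arg_eq_Im_Ln)
  also have "\<dots> = cmod z powr Re s * exp (- (Im s * Arg z))"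
    using assms by (simp add: powr_def exp_diff exp_minus field_simps)
  also have "- (Im s * Arg z) \<le> pi * \<bar>Im s\<bar>"
  proof -
    have "- (Im s * Arg z) \<le> \<bar>Im s\<bar> * \<bar>Arg z\<bar>" by (metis abs_ge_minus_self abs_mult)
    also have "\<dots> \<le> \<bar>Im s\<bar> * pi" using Arg_bounded[of z] by (intro mult_left_mono) auto
    finally show ?thesis by (simp add: mult.commute)
  qed
  then have "cmod z powr Re s * exp (- (Im s * Arg z)) \<le> cmod z powr Re s * exp (pi * \<bar>Im s\<bar>)"
    by (intro mult_left_mono) auto
  finally show ?thesis .
qed

lemma powr_times_complex:
  fixes w z s :: complex
  assumes "w \<noteq> 0" "z \<noteq> 0" "- pi < Arg w + Arg z" "Arg w + Arg z \<le> pi"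
  shows "(w * z) powr s = w powr s * z powr s"
  using assms Ln_times_simple[of w z] by (simp add: powr_def Arg_eq_Im_Ln exp_add[symmetric] algebra_simps)

text \<open>The condition \<open>Re (cis t * z) \<ge> c * cmod z\<close> keeps the real part of w =
  l z comparable with |w|, and then \<open>weber_int_diff_le\<close> against the exact Gamma
  integral gives a relative error of order |z|^(-2).\<close>

lemma weber_sol_asymp:
  assumes s: "Re s > 0" and t: "\<bar>t\<bar> < pi / 4" and c: "c > 0"
  shows "weber_asymp (s - 1/2) (weber_sol s (cis t)) {z. z \<noteq> 0 \<and> \<bar>Arg z\<bar> < 3 * pi / 4 \<and> Re (cis t * z) \<ge> c * cmod z}"
    (is "weber_asymp _ _ ?S")
proof -
  define l where "l = cis t"
  have l: "l \<noteq> 0" "cmod l = 1" "Arg l = t" using t by (auto simp: l_def cis_Arg_unique)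
  have "cos (2 * t) > 0" using t by (intro cos_gt_zero_pi) auto
  then have l2: "Re (l^2) > 0" by (simp add: l_def power2_eq_square cis_mult flip: mult_2)
  define K where "K = 1 / 2 * (c powr - (Re s + 2) * Gamma (Re s + 2)) * exp (pi * \<bar>Im s\<bar>) / cmod (Gamma s)"
  have bd: "cmod (weber_sol s l z / weber_lead (s - 1/2) z - 1) \<le> K / (cmod z)^2" if z: "z \<in> ?S" for z
  proof -
    define w where "w = l * z"
    have z0: "z \<noteq> 0" and Rw: "Re w \<ge> c * cmod z" using z by (auto simp: w_def l_def)
    have w0: "w \<noteq> 0" using z0 l by (simp add: w_def)
    have Rw0: "Re w > 0" using Rw c z0 by (smt (verit) mult_pos_pos zero_less_norm_iff)
    have G: "Gamma s \<noteq> 0" using s by (auto simp: Gamma_eq_zero_iff elim!: nonpos_Ints_cases)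
    \<comment> \<open>The principal powers multiply because |Arg l| + |Arg z| < pi/4 + 3 pi/4 =
      pi.\<close>
    have "w powr s = l powr s * z powr s"
      unfolding w_def using z t l by (intro powr_times_complex) auto
    then have "weber_sol s l z / weber_lead (s - 1/2) z = weber_int s (l^2) w * w powr s / Gamma s"
      using z0 by (simp add: weber_sol_def weber_lead_def w_def powr_minus field_simps)
    also have "\<dots> = (weber_int s (l^2) w - weber_int s 0 w) * w powr s / Gamma s + 1"
      using weber_int_zero[OF Rw0 s] w0 G by (simp add: powr_minus field_simps)
    finally have "cmod (weber_sol s l z / weber_lead (s - 1/2) z - 1)
        = cmod (weber_int s (l^2) w - weber_int s 0 w) * cmod (w powr s) / cmod (Gamma s)"
      by (simp add: norm_mult norm_divide)
    also have "\<dots> \<le> (1 / 2 * (Re w powr - (Re s + 2) * Gamma (Re s + 2))) * (cmod w powr Re s * exp (pi * \<bar>Im s\<bar>)) / cmod (Gamma s)"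
      using weber_int_diff_le[OF Rw0 _ s, of "l^2"] l2 l s w0 
      by (intro divide_right_mono mult_mono norm_powr_complex_le) (auto simp: norm_power Gamma_real_nonneg)
    also have "\<dots> \<le> (1 / 2 * ((c * cmod z) powr - (Re s + 2) * Gamma (Re s + 2))) * (cmod z powr Re s * exp (pi * \<bar>Im s\<bar>)) / cmod (Gamma s)"
    proof -
      have "cmod w = cmod z" using l by (simp add: w_def norm_mult)
      moreover have "Re w powr - (Re s + 2) \<le> (c * cmod z) powr - (Re s + 2)"
        using Rw s c z0 by (intro powr_mono2') auto
      moreover have "Gamma (Re s + 2) \<ge> 0" using s by (intro less_imp_le Gamma_real_pos) auto
      ultimately show ?thesis by (auto intro!: divide_right_mono mult_mono)
    qed
    also have "(c * cmod z) powr - (Re s + 2) = c powr - (Re s + 2) * (cmod z powr - Re s * cmod z powr - 2)"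
      using c z0 by (subst powr_mult) (auto simp flip: powr_add)
    also have "(1 / 2 * (c powr - (Re s + 2) * (cmod z powr - Re s * cmod z powr - 2) * Gamma (Re s + 2))) * (cmod z powr Re s * exp (pi * \<bar>Im s\<bar>)) / cmod (Gamma s)
      = K * (cmod z powr - Re s * cmod z powr Re s) * cmod z powr - 2"
      by (simp add: K_def)
    also have "cmod z powr - Re s * cmod z powr Re s = 1" using z0 by (simp flip: powr_add)
    also have "cmod z powr - 2 = 1 / (cmod z)^2" using z0 by (simp add: powr_minus_divide)
    finally show ?thesis by simp
  qed
  show ?thesis unfolding weber_asymp_def l_def[symmetric]
  proof (intro allI impI)
    fix e :: real assume e: "e > 0"
    define B where "B = max 1 (K / e)"
    show "\<exists>B. \<forall>z\<in>{z. z \<noteq> 0 \<and> \<bar>Arg z\<bar> < 3 * pi / 4 \<and> c * cmod z \<le> Re (l * z)}. cmod z \<ge> B \<longrightarrow> cmod (weber_sol s l z / weber_lead (s - 1 / 2) z - 1) \<le> e"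
    proof (intro exI[of _ B] ballI impI)
      fix z assume z: "z \<in> {z. z \<noteq> 0 \<and> \<bar>Arg z\<bar> < 3 * pi / 4 \<and> c * cmod z \<le> Re (l * z)}" and B: "cmod z \<ge> B"
      have "cmod z \<ge> 1" "cmod z \<ge> K / e" using B by (auto simp: B_def)
      then have "K / e \<le> (cmod z)^2" by (smt (verit) mult_left_mono power2_eq_square mult_cancel_left2)
      then have "K / (cmod z)^2 \<le> e" using e z by (simp add: field_simps)
      then show "cmod (weber_sol s l z / weber_lead (s - 1 / 2) z - 1) \<le> e"
        using bd[of z] z by (simp add: l_def)
    qed
  qed
qed

section \<open>Uniqueness and existence of the parabolic cylinder function\<close>

lemma wronskian_constant:
  fixes y1 y2 Q :: "complex \<Rightarrow> complex"
  assumes "y1 holomorphic_on UNIV" "y2 holomorphic_on UNIV"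
    and "\<And>z. deriv (deriv y1) z = Q z * y1 z" "\<And>z. deriv (deriv y2) z = Q z * y2 z"
  shows "\<exists>c. \<forall>z. y1 z * deriv y2 z - deriv y1 z * y2 z = c"
proof -
  have d: "(f has_field_derivative deriv f z) (at z)" if "f holomorphic_on UNIV" for f :: "complex \<Rightarrow> complex" and z
    using that by (auto intro: holomorphic_derivI)
  have h: "deriv y1 holomorphic_on UNIV" "deriv y2 holomorphic_on UNIV"
    using assms by (auto intro: holomorphic_deriv)
  have "\<exists>c. \<forall>z\<in>UNIV. y1 z * deriv y2 z - deriv y1 z * y2 z = c"
  proof (rule has_field_derivative_zero_constant)
    fix z
    have "((\<lambda>z. y1 z * deriv y2 z - deriv y1 z * y2 z) has_field_derivative
       (deriv y1 z * deriv y2 z + deriv (deriv y2) z * y1 z - (deriv (deriv y1) z * y2 z + deriv y2 z * deriv y1 z))) (at z)"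
      by (intro DERIV_diff DERIV_mult d assms h)
    moreover have "deriv y1 z * deriv y2 z + deriv (deriv y2) z * y1 z - (deriv (deriv y1) z * y2 z + deriv y2 z * deriv y1 z) = 0"
      by (simp add: assms algebra_simps)
    ultimately show "((\<lambda>z. y1 z * deriv y2 z - deriv y1 z * y2 z) has_field_derivative 0) (at z within UNIV)"
      by simp
  qed auto
  then show ?thesis by simp
qed

lemma weber_lead_nonzero: "z \<noteq> 0 \<Longrightarrow> weber_lead a z \<noteq> 0"
  by (simp add: weber_lead_def)

lemma weber_lead_DERIV:
  assumes "z \<notin> \<real>\<^sub>\<le>\<^sub>0"
  shows "(weber_lead a has_field_derivative weber_lead a z * ((- a - 1/2) / z - z / 2)) (at z)"
proof -
  have z: "z \<noteq> 0" using assms by auto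
  define p where "p = - a - 1/2"
  have "((\<lambda>z. z powr p * exp (- (z^2) / 4)) has_field_derivative
      p * z powr (p - 1) * exp (- (z^2) / 4) + z powr p * (exp (- (z^2) / 4) * (- z / 2))) (at z)"
    by (rule derivative_eq_intros has_field_derivative_powr refl assms | simp)+
  moreover have "p * z powr (p - 1) * exp (- (z^2) / 4) + z powr p * (exp (- (z^2) / 4) * (- z / 2))
      = z powr p * exp (- (z^2) / 4) * (p / z - z / 2)"
    using z by (simp add: powr_diff field_simps)
  ultimately show ?thesis
    unfolding weber_lead_def p_def by simp
qed

lemma weber_quotient_DERIV:
  assumes "z \<notin> \<real>\<^sub>\<le>\<^sub>0" "y holomorphic_on UNIV"
  shows "((\<lambda>z. y z / weber_lead a z) has_field_derivative
      deriv y z / weber_lead a z - ((- a - 1/2) / z - z / 2) * (y z / weber_lead a z)) (at z)"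
proof -
  have z: "z \<noteq> 0" using assms by auto
  have dy: "(y has_field_derivative deriv y z) (at z)"
    using assms by (auto intro: holomorphic_derivI)
  show ?thesis
    by (rule DERIV_cong[OF DERIV_divide[OF dy weber_lead_DERIV[OF assms(1)]]])
       (use weber_lead_nonzero[OF z, of a] in \<open>simp_all add: diff_divide_distrib\<close>)
qed

lemma deriv_eq_weber_lead_times:
  assumes "z \<notin> \<real>\<^sub>\<le>\<^sub>0" "y holomorphic_on UNIV"
  shows "deriv y z = weber_lead a z *
     (deriv (\<lambda>z. y z / weber_lead a z) z + ((- a - 1/2) / z - z / 2) * (y z / weber_lead a z))"
proof -
  have "z \<noteq> 0" using assms by auto
  then show ?thesis
    using weber_lead_nonzero[of z a] by (subst DERIV_imp_deriv[OF weber_quotient_DERIV[OF assms]]) simp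
qed

text \<open>An asymptotic relation for holomorphic functions can be differentiated: the quotient is
  close to 1 on unit discs around far points of the ray, so Cauchy's inequality makes its derivative
  small at the centres.\<close>

lemma weber_asymp_ray:
  assumes "y holomorphic_on UNIV" "weber_asymp a y S" "S \<inter> \<real>\<^sub>\<le>\<^sub>0 = {}"
    and S: "\<And>r. r \<ge> r0 \<Longrightarrow> cball (of_real r * cis t) 1 \<subseteq> S"
  shows "((\<lambda>r. y (of_real r * cis t) / weber_lead a (of_real r * cis t)) \<longlongrightarrow> 1) at_top"
    and "((\<lambda>r. deriv (\<lambda>z. y z / weber_lead a z) (of_real r * cis t)) \<longlongrightarrow> 0) at_top"
proof -
  let ?h = "\<lambda>z. y z / weber_lead a z"
  have ev: "\<forall>\<^sub>F r in at_top. cmod (?h (of_real r * cis t) - 1) < e \<and> cmod (deriv ?h (of_real r * cis t)) < e"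
    if "e > 0" for e
  proof -
    obtain B where B: "\<And>z. z \<in> S \<Longrightarrow> cmod z \<ge> B \<Longrightarrow> cmod (?h z - 1) \<le> e / 2"
      using assms(2) \<open>e > 0\<close> unfolding weber_asymp_def by (meson half_gt_zero)
    have "cmod (?h p - 1) < e \<and> cmod (deriv ?h p) < e" if r: "r \<ge> max r0 (max 0 (B + 1))" and p: "p = of_real r * cis t" for r p
    proof -
      have sub: "cball p 1 \<subseteq> S" using S r p by auto
      have np: "cmod p = r" using r by (simp add: p norm_mult)
      have bd: "cmod (?h z - 1) \<le> e / 2" if "z \<in> cball p 1" for z
      proof (rule B)
        have "cmod p \<le> cmod z + dist p z" by (metis dist_norm norm_triangle_sub)
        then show "cmod z \<ge> B" using r np that by auto
      qed (use that sub in auto)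
      have nr: "z \<notin> \<real>\<^sub>\<le>\<^sub>0" if "z \<in> cball p 1" for z using that sub assms(3) by auto
      have dh: "((\<lambda>z. ?h z - 1) has_field_derivative deriv ?h z) (at z)" if "z \<in> cball p 1" for z
      proof -
        have "(?h has_field_derivative deriv ?h z) (at z)"
          using weber_quotient_DERIV[OF nr[OF that] assms(1), of a] DERIV_imp_deriv by metis
        from DERIV_diff[OF this DERIV_const[of 1]] show ?thesis by simp
      qed
      have hol: "(\<lambda>z. ?h z - 1) holomorphic_on cball p 1"
        unfolding holomorphic_on_def field_differentiable_def
        using dh has_field_derivative_at_within by blast
      have "cmod ((deriv ^^ 1) (\<lambda>z. ?h z - 1) p) \<le> fact 1 * (e / 2) / 1 ^ 1"
      proof (rule Cauchy_inequality)
        show "(\<lambda>z. ?h z - 1) holomorphic_on ball p 1" using hol by (rule holomorphic_on_subset) auto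
        show "continuous_on (cball p 1) (\<lambda>z. ?h z - 1)" using hol by (rule holomorphic_on_imp_continuous_on)
        fix z assume "cmod (p - z) = 1"
        then show "cmod (?h z - 1) \<le> e / 2" by (intro bd) (auto simp: dist_norm)
      qed auto
      moreover have "deriv (\<lambda>z. ?h z - 1) p = deriv ?h p" by (rule DERIV_imp_deriv[OF dh]) auto
      ultimately show ?thesis using bd[of p] \<open>e > 0\<close> by auto
    qed
    then show ?thesis
      using eventually_ge_at_top[of "max r0 (max 0 (B + 1))"] by (auto elim!: eventually_mono)
  qed
  show "((\<lambda>r. ?h (of_real r * cis t)) \<longlongrightarrow> 1) at_top"
    by (rule tendstoI) (use ev in \<open>force simp: dist_norm elim: eventually_mono\<close>)
  show "((\<lambda>r. deriv ?h (of_real r * cis t)) \<longlongrightarrow> 0) at_top"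
    by (rule tendstoI) (use ev in \<open>force simp: dist_norm elim: eventually_mono\<close>)
qed

lemma Re_pos_of_cone:
  assumes "z \<noteq> 0" "Re z \<ge> 4/5 * cmod z"
  shows "Re z > 0"
proof -
  have "cmod z > 0" using assms by simp
  then show ?thesis using assms(2) by linarith
qed

text \<open>In terms of the quotients h = y / \<open>weber_lead\<close> the constant Wronskian is
  \<open>weber_lead\<close>^2 (h1 h2' - h1' h2). On the positive axis the bracket tends to 0 and the
  leading factor is at most 1 in modulus because \<open>Re a > -1/2\<close>, so the Wronskian
  vanishes and the solutions are proportional. The common normalization fixes the factor.\<close>

lemma weber_unique:
  assumes a: "Re a > - 1/2"
    and y1: "y1 holomorphic_on UNIV" "\<And>z. deriv (deriv y1) z = (z^2 / 4 + a) * y1 z"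
    and y2: "y2 holomorphic_on UNIV" "\<And>z. deriv (deriv y2) z = (z^2 / 4 + a) * y2 z"
    and as: "weber_asymp a y1 {z. z \<noteq> 0 \<and> Re z \<ge> 4/5 * cmod z}"
            "weber_asymp a y2 {z. z \<noteq> 0 \<and> Re z \<ge> 4/5 * cmod z}"
  shows "y1 = y2"
proof -
  define S where "S = {z. z \<noteq> 0 \<and> Re z \<ge> 4/5 * cmod z}"
  have Snr: "S \<inter> \<real>\<^sub>\<le>\<^sub>0 = {}"
    using Re_pos_of_cone by (fastforce simp: S_def complex_nonpos_Reals_iff)
  \<comment> \<open>A unit disc around r fits into the cone if r - 1 >= (4/5)(r + 1), that is, r >=
    9.\<close>
  have ball: "cball (of_real r) 1 \<subseteq> S" if "r \<ge> 9" for r :: real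
  proof
    fix z assume z: "z \<in> cball (complex_of_real r) 1"
    then have d: "cmod (of_real r - z) \<le> 1" by (simp add: dist_norm)
    have "r - Re z \<le> 1" using d abs_Re_le_cmod[of "of_real r - z"] by simp
    moreover have "cmod z \<le> r + 1"
      using d norm_triangle_sub[of z "of_real r"] that by (simp add: norm_minus_commute)
    ultimately show "z \<in> S" using that by (auto simp: S_def)
  qed
  define h1 where "h1 = (\<lambda>z. y1 z / weber_lead a z)"
  define h2 where "h2 = (\<lambda>z. y2 z / weber_lead a z)"
  note as = as[folded S_def]
  have lim: "((\<lambda>r. h1 (of_real r)) \<longlongrightarrow> 1) at_top" "((\<lambda>r. deriv h1 (of_real r)) \<longlongrightarrow> 0) at_top"
    "((\<lambda>r. h2 (of_real r)) \<longlongrightarrow> 1) at_top" "((\<lambda>r. deriv h2 (of_real r)) \<longlongrightarrow> 0) at_top"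
    using weber_asymp_ray[OF y1(1) as(1) Snr, of 9 0] weber_asymp_ray[OF y2(1) as(2) Snr, of 9 0] ball
    by (simp_all add: h1_def h2_def)
  obtain w where w: "\<And>z. y1 z * deriv y2 z - deriv y1 z * y2 z = w"
    using wronskian_constant[OF y1(1) y2(1) y1(2) y2(2)] by auto
  have "((\<lambda>r::real. w) \<longlongrightarrow> 0) at_top"
  proof (rule Lim_null_comparison)
    show "\<forall>\<^sub>F r in at_top. cmod w \<le> cmod (h1 (of_real r) * deriv h2 (of_real r) - deriv h1 (of_real r) * h2 (of_real r))"
      using eventually_ge_at_top[of 1]
    proof eventually_elim
      case (elim r)
      let ?r = "complex_of_real r"
      let ?g = "weber_lead a ?r" 
      have r: "?r \<notin> \<real>\<^sub>\<le>\<^sub>0" "?r \<noteq> 0" using elim by (auto simp: complex_nonpos_Reals_iff)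
      have yy: "y1 ?r = ?g * h1 ?r" "y2 ?r = ?g * h2 ?r"
        using weber_lead_nonzero[OF r(2), of a] by (auto simp: h1_def h2_def)
      define L where "L = (- a - 1/2) / ?r - ?r / 2"
      have dd: "deriv y1 ?r = ?g * (deriv h1 ?r + L * h1 ?r)" "deriv y2 ?r = ?g * (deriv h2 ?r + L * h2 ?r)"
        unfolding h1_def h2_def L_def using r(1) y1(1) y2(1) by (intro deriv_eq_weber_lead_times; simp)+
      have "w = ?g * h1 ?r * (?g * (deriv h2 ?r + L * h2 ?r)) - ?g * (deriv h1 ?r + L * h1 ?r) * (?g * h2 ?r)"
        unfolding w[of ?r, symmetric] dd yy ..
      also have "\<dots> = ?g^2 * (h1 ?r * deriv h2 ?r - deriv h1 ?r * h2 ?r)"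
        by (simp add: power2_eq_square algebra_simps)
      finally have "w = ?g^2 * (h1 ?r * deriv h2 ?r - deriv h1 ?r * h2 ?r)" .
      moreover have "cmod ?g \<le> 1"
      proof -
        have "r powr (- Re a - 1/2) \<le> r powr 0" using elim a by (intro powr_mono) auto
        then have "cmod (?r powr (- a - 1/2)) \<le> 1" using elim by (simp add: norm_powr_real_powr)
        moreover have "cmod (exp (- (?r^2) / 4)) \<le> 1" by (simp flip: of_real_power)
        ultimately show ?thesis unfolding weber_lead_def norm_mult by (intro mult_le_one) auto
      qed
      then have "(cmod ?g)^2 \<le> 1" by (simp add: power_le_one)
      ultimately show ?case by (auto simp: norm_mult norm_power intro!: mult_left_le_one_le)
    qed
    show "((\<lambda>r. cmod (h1 (of_real r) * deriv h2 (of_real r) - deriv h1 (of_real r) * h2 (of_real r))) \<longlongrightarrow> 0) at_top"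
      by (auto intro!: tendsto_eq_intros lim)
  qed
  then have w0: "w = 0" by (simp add: tendsto_const_iff)
  obtain B where B: "\<And>z. z \<in> S \<Longrightarrow> cmod z \<ge> B \<Longrightarrow> cmod (h2 z - 1) \<le> 1/2"
    using as(2) unfolding weber_asymp_def h2_def by (meson half_gt_zero zero_less_one)
  define b where "b = max 9 (B + 1)"
  have ne: "y2 z \<noteq> 0" if "z \<in> ball (of_real b) 1" for z
  proof -
    have "z \<in> S" using that ball[of b] by (auto simp: b_def)
    moreover have "cmod z \<ge> B"
    proof -
      have "cmod (of_real b) \<le> cmod z + cmod (of_real b - z)" by (rule norm_triangle_sub)
      moreover have "cmod (of_real b - z) < 1" using that by (simp add: dist_norm)
      moreover have "cmod (complex_of_real b) = b" by (simp add: b_def)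
      ultimately show ?thesis by (simp add: b_def)
    qed
    ultimately have "cmod (h2 z - 1) \<le> 1/2" by (rule B)
    then have "h2 z \<noteq> 0" by auto
    then show ?thesis by (auto simp: h2_def)
  qed
  have "\<exists>c. \<forall>z\<in>ball (of_real b) 1. y1 z / y2 z = c"
  proof (rule has_field_derivative_zero_constant)
    fix z assume z: "z \<in> ball (complex_of_real b) 1"
    have "((\<lambda>z. y1 z / y2 z) has_field_derivative (deriv y1 z * y2 z - y1 z * deriv y2 z) / (y2 z * y2 z)) (at z)"
      using y1(1) y2(1) ne[OF z] by (intro DERIV_divide) (auto intro: holomorphic_derivI)
    moreover have "deriv y1 z * y2 z - y1 z * deriv y2 z = 0" using w[of z] w0 by simp
    ultimately show "((\<lambda>z. y1 z / y2 z) has_field_derivative 0) (at z within ball (of_real b) 1)"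
      by (simp add: has_field_derivative_at_within)
  qed auto
  then obtain c where c: "\<And>z. z \<in> ball (of_real b) 1 \<Longrightarrow> y1 z / y2 z = c" by auto
  have yc: "y1 z = c * y2 z" for z
  proof (rule analytic_continuation_open[where s="ball (of_real b) 1" and s'=UNIV and f=y1 and g="\<lambda>z. c * y2 z"])
    show "(\<lambda>z. c * y2 z) holomorphic_on UNIV" using y2(1) by (intro holomorphic_intros)
    fix z assume "z \<in> ball (complex_of_real b) 1"
    then show "y1 z = c * y2 z" using c[of z] ne[of z] by (auto simp: field_simps)
  qed (use y1 in auto)
  have "((\<lambda>r. h1 (of_real r)) \<longlongrightarrow> c * 1) at_top"
  proof -
    have "(\<lambda>r::real. h1 (of_real r)) = (\<lambda>r. c * h2 (of_real r))" using yc by (simp add: h1_def h2_def)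
    then show ?thesis using tendsto_mult_left[OF lim(3), of c] by simp
  qed
  from tendsto_unique[OF _ this lim(1)] have "c = 1" by simp
  then show ?thesis using yc by auto
qed

text \<open>\<open>Arg 0 = 0\<close> puts the origin into the sector of the definition, but removing
  one point does not change a filter at infinity.\<close>

lemma is_parabolic_cylinder_iff:
  "is_parabolic_cylinder a y \<longleftrightarrow> y holomorphic_on UNIV \<and> (\<forall>z. deriv (deriv y) z = (z^2 / 4 + a) * y z) \<and>
     (\<forall>d>0. weber_asymp a y {z. z \<noteq> 0 \<and> \<bar>Arg z\<bar> \<le> 3 * pi / 4 - d})"
proof -
  have "y \<sim>[inf at_infinity (principal {z. \<bar>Arg z\<bar> \<le> 3 * pi / 4 - d})] weber_lead a \<longleftrightarrow>
     weber_asymp a y {z. z \<noteq> 0 \<and> \<bar>Arg z\<bar> \<le> 3 * pi / 4 - d}" for d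
  proof -
    have "\<forall>\<^sub>F z::complex in at_infinity. z \<noteq> 0" by (auto simp: eventually_at_infinity intro!: exI[of _ 1])
    then have "inf at_infinity (principal {z. \<bar>Arg z\<bar> \<le> 3 * pi / 4 - d}) =
      inf at_infinity (principal {z. z \<noteq> 0 \<and> \<bar>Arg z\<bar> \<le> 3 * pi / 4 - d})"
      by (intro filter_eqI) (auto simp: eventually_inf_principal eventually_conj_iff elim: eventually_elim2)
    then show ?thesis by (simp add: weber_asymp_iff_asymp_equiv)
  qed
  then show ?thesis unfolding is_parabolic_cylinder_def weber_lead_def [symmetric] by simp
qed

lemma Arg_less_half_pi:
  assumes "Re z > 0"
  shows "\<bar>Arg z\<bar> < pi / 2"
proof -
  have "z \<noteq> 0" using assms by auto
  then show ?thesis using Re_Ln_pos_lt_imp[OF assms] by (simp add: Arg_eq_Im_Ln)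
qed

text \<open>Both solutions have the required asymptotics on a narrow cone around the positive axis,
  narrow enough to serve every ray with |t| < pi/4, and \<open>weber_unique\<close> identifies them.
  No contour has to be rotated.\<close>

lemma weber_sol_rotate:
  assumes s: "Re s > 0" and t: "\<bar>t\<bar> < pi / 4"
  shows "weber_sol s (cis t) = weber_sol s 1"
proof -
  have ct: "cos t > 0" "\<bar>sin t\<bar> \<le> cos t"
  proof -
    show "cos t > 0" using t by (intro cos_gt_zero_pi) auto
    have "cos (2 * t) > 0" using t by (intro cos_gt_zero_pi) auto
    then have "(sin t)^2 \<le> (cos t)^2" by (simp add: cos_double)
    then show "\<bar>sin t\<bar> \<le> cos t" using \<open>cos t > 0\<close> by (simp add: abs_le_square_iff[symmetric])
  qed
  have "weber_asymp (s - 1/2) (weber_sol s (cis t)) {z. z \<noteq> 0 \<and> Re z \<ge> 4/5 * cmod z}" if t: "\<bar>t\<bar> < pi / 4"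
     and ct: "cos t > 0" "\<bar>sin t\<bar> \<le> cos t" for t
  \<comment> \<open>\<open>Re z \<ge> 4/5 * cmod z\<close> forces |Im z| <= (3/5)|z|. As |sin t| <=
    cos t, Re (cis t z) is at least (4/5 - 3/5) cos t |z|, which is the origin of
    \<open>cos t / 5\<close>.\<close>
  proof (rule weber_asymp_subset[OF weber_sol_asymp[OF s t, of "cos t / 5"]])
    show "{z. z \<noteq> 0 \<and> Re z \<ge> 4/5 * cmod z} \<subseteq> {z. z \<noteq> 0 \<and> \<bar>Arg z\<bar> < 3 * pi / 4 \<and> Re (cis t * z) \<ge> cos t / 5 * cmod z}"
    proof safe
      fix z assume z: "z \<noteq> 0" "Re z \<ge> 4/5 * cmod z"
      then have "Re z > 0" by (rule Re_pos_of_cone)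
      from Arg_less_half_pi[OF this] show "\<bar>Arg z\<bar> < 3 * pi / 4" by linarith
      have "(Re z)^2 \<ge> (4/5 * cmod z)^2" using z by (intro power_mono) auto
      then have "(Im z)^2 \<le> (3/5 * cmod z)^2" using cmod_power2[of z] by (simp add: power_mult_distrib power_divide)
      then have "\<bar>Im z\<bar> \<le> 3/5 * cmod z" using abs_le_square_iff[of "Im z" "3/5 * cmod z"] by simp
      then have "\<bar>sin t\<bar> * \<bar>Im z\<bar> \<le> cos t * (3/5 * cmod z)"
        using ct by (intro mult_mono) auto
      moreover have "sin t * Im z \<le> \<bar>sin t\<bar> * \<bar>Im z\<bar>" by (metis abs_ge_self abs_mult)
      moreover have "cos t * Re z \<ge> cos t * (4/5 * cmod z)" using z ct by (intro mult_left_mono) auto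
      ultimately show "Re (cis t * z) \<ge> cos t / 5 * cmod z" by (simp add: algebra_simps)
    qed
  qed (use ct in auto)
  note as = this[OF t ct] this[of 0, simplified]
  have l: "Re (cis t ^ 2) > 0" "Re ((1::complex) ^ 2) > 0"
  proof -
    have "cos (2 * t) > 0" using t by (intro cos_gt_zero_pi) auto
    then show "Re (cis t ^ 2) > 0" by (simp add: power2_eq_square cis_mult flip: mult_2)
  qed auto
  show ?thesis
    using weber_sol_ODE[OF s l(1)] weber_sol_ODE[OF s l(2)] as s
    by (intro weber_unique[of "s - 1/2"]) auto
qed

lemma is_parabolic_cylinder_weber_sol:
  assumes "Re a > - 1/2"
  shows "is_parabolic_cylinder a (weber_sol (a + 1/2) 1)"
  unfolding is_parabolic_cylinder_iff
proof (intro conjI allI impI)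
  define s where "s = a + 1/2"
  have s: "Re s > 0" "a = s - 1/2" using assms by (auto simp: s_def)
  show "weber_sol (a + 1/2) 1 holomorphic_on UNIV" 
    using weber_sol_ODE(1)[OF s(1), of 1] by (simp add: s_def)
  show "deriv (deriv (weber_sol (a + 1/2) 1)) z = (z^2 / 4 + a) * weber_sol (a + 1/2) 1 z" for z
    using weber_sol_ODE(2)[OF s(1), of 1 z] by (simp add: s_def)
  fix d :: real assume "d > 0"
  \<comment> \<open>The two rays t and -t with t = pi/4 - d'/2 already cover the sector: for Arg z
    of either sign the ray of opposite sign brings Arg z + x to within pi/2 - d'/2 of 0. The cosine
    of that angle is the aperture constant \<open>c\<close>.\<close>
  define d' where "d' = min d (pi / 4)"
  define t where "t = pi / 4 - d' / 2"
  have d': "d' > 0" "d' \<le> pi/4" "d' \<le> d" using \<open>d > 0\<close> by (auto simp: d'_def)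
  have t: "\<bar>t\<bar> < pi / 4" "\<bar>- t\<bar> < pi / 4" using d' by (auto simp: t_def)
  define c where "c = sin (d' / 2)"
  have c: "c > 0" using d' by (auto simp: c_def intro!: sin_gt_zero)
  define T where "T = (\<lambda>t. {z. z \<noteq> 0 \<and> \<bar>Arg z\<bar> < 3 * pi / 4 \<and> Re (cis t * z) \<ge> c * cmod z})"
  have as: "weber_asymp a (weber_sol s 1) (T t)" "weber_asymp a (weber_sol s 1) (T (- t))"
    using weber_sol_asymp[OF s(1) t(1) c] weber_sol_asymp[OF s(1) t(2) c]
      weber_sol_rotate[OF s(1) t(1)] weber_sol_rotate[OF s(1) t(2)] by (auto simp: s(2) T_def)
  have un: "weber_asymp a (weber_sol s 1) (T t \<union> T (- t))"
    unfolding weber_asymp_def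
  proof (intro allI impI)
    fix e :: real assume "e > 0"
    then obtain B1 B2 where 
      "\<forall>z\<in>T t. cmod z \<ge> B1 \<longrightarrow> cmod (weber_sol s 1 z / weber_lead a z - 1) \<le> e"
      "\<forall>z\<in>T (-t). cmod z \<ge> B2 \<longrightarrow> cmod (weber_sol s 1 z / weber_lead a z - 1) \<le> e"
      using as unfolding weber_asymp_def by meson
    then show "\<exists>B. \<forall>z\<in>T t \<union> T (- t). cmod z \<ge> B \<longrightarrow> cmod (weber_sol s 1 z / weber_lead a z - 1) \<le> e"
      by (intro exI[of _ "max B1 B2"]) auto
  qed
  have "{z. z \<noteq> 0 \<and> \<bar>Arg z\<bar> \<le> 3 * pi / 4 - d} \<subseteq> T t \<union> T (- t)"
  proof safe
    fix z assume z: "z \<noteq> 0" "\<bar>Arg z\<bar> \<le> 3 * pi / 4 - d" and n: "z \<notin> T (- t)"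
    have key: "Re (cis x * z) \<ge> c * cmod z" if "\<bar>x + Arg z\<bar> \<le> pi / 2 - d' / 2" for x
    proof -
      have "cis x * z = of_real (cmod z) * cis (x + Arg z)"
        using Arg_eq[OF z(1)] by (metis cis_conv_exp cis_mult mult.left_commute)
      then have "Re (cis x * z) = cmod z * cos \<bar>x + Arg z\<bar>" by simp
      moreover have "cos \<bar>x + Arg z\<bar> \<ge> cos (pi / 2 - d' / 2)"
        using that d' by (intro cos_monotone_0_pi_le) auto
      moreover have "cos (pi / 2 - d' / 2) = c" by (simp add: c_def cos_diff)
      ultimately show ?thesis
        by (simp only: mult.commute[of c] mult_left_mono norm_ge_zero)
    qed
    have A: "\<bar>Arg z\<bar> < 3 * pi / 4" using z d' by linarith
    have "\<not> \<bar>- t + Arg z\<bar> \<le> pi / 2 - d' / 2" using key[of "-t"] n z(1) A by (auto simp: T_def)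
    then have "\<bar>t + Arg z\<bar> \<le> pi / 2 - d' / 2"
      using z(2) d' unfolding t_def by (auto simp: abs_if split: if_splits)
    then show "z \<in> T t" using key[of t] z(1) A by (auto simp: T_def)
  qed
  from weber_asymp_subset[OF un this]
  show "weber_asymp a (weber_sol (a + 1/2) 1) {z. z \<noteq> 0 \<and> \<bar>Arg z\<bar> \<le> 3 * pi / 4 - d}" by (simp add: s_def)
qed

text \<open>The half plane of convergence of the integral is all that is needed later: for real
  \<open>b\<close> the functions \<open>weber_W 0\<close> and \<open>weber_W 3\<close> have the
  purely imaginary parameters i b and -i b.\<close>

theorem is_parabolic_cylinder_parabolic_U:
  assumes "Re a > - 1/2"
  shows "is_parabolic_cylinder a (parabolic_U a)"
  unfolding parabolic_U_def
proof (rule theI[where P="is_parabolic_cylinder a" and a="weber_sol (a + 1/2) 1"])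
  show "is_parabolic_cylinder a (weber_sol (a + 1/2) 1)"
    by (rule is_parabolic_cylinder_weber_sol[OF assms])
  fix y assume y: "is_parabolic_cylinder a y"
  have sub: "weber_asymp a y {z. z \<noteq> 0 \<and> Re z \<ge> 4/5 * cmod z}" if "is_parabolic_cylinder a y" for y
  proof (rule weber_asymp_subset)
    show "weber_asymp a y {z. z \<noteq> 0 \<and> \<bar>Arg z\<bar> \<le> 3 * pi / 4 - pi / 4}"
      using that unfolding is_parabolic_cylinder_iff by (meson pi_gt_zero zero_less_divide_iff zero_less_numeral)
    have "\<bar>Arg z\<bar> \<le> pi / 2" if "z \<noteq> 0" "Re z \<ge> 4/5 * cmod z" for z
      using Arg_less_half_pi[OF Re_pos_of_cone[OF that]] by linarith
    then show "{z. z \<noteq> 0 \<and> Re z \<ge> 4/5 * cmod z} \<subseteq> {z. z \<noteq> 0 \<and> \<bar>Arg z\<bar> \<le> 3 * pi / 4 - pi / 4}"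
      by auto
  qed
  show "y = weber_sol (a + 1/2) 1"
    using y is_parabolic_cylinder_weber_sol[OF assms] sub[OF y] sub[OF is_parabolic_cylinder_weber_sol[OF assms]] assms
    by (intro weber_unique[of a]) (auto simp: is_parabolic_cylinder_iff)
qed

section \<open>The Weber functions\<close>

lemma is_parabolic_cylinderD:
  assumes "is_parabolic_cylinder a y"
  shows "y holomorphic_on UNIV" "deriv (deriv y) z = (z^2 / 4 + a) * y z"
    "d > 0 \<Longrightarrow> weber_asymp a y {z. z \<noteq> 0 \<and> \<bar>Arg z\<bar> \<le> 3 * pi / 4 - d}"
  using assms unfolding is_parabolic_cylinder_iff by auto

lemma deriv_rescale:
  fixes y :: "complex \<Rightarrow> complex"
  assumes "y holomorphic_on UNIV"
  shows "(\<lambda>z. y (k * z)) holomorphic_on UNIV" "deriv (\<lambda>z. y (k * z)) z = k * deriv y (k * z)"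
    "deriv (deriv (\<lambda>z. y (k * z))) z = k^2 * deriv (deriv y) (k * z)"
proof -
  have d: "((\<lambda>z. f (k * z)) has_field_derivative k * deriv f (k * z)) (at z)" if "f holomorphic_on UNIV" for f z
  proof -
    have "(f has_field_derivative deriv f (k * z)) (at (k * z))" using that by (auto intro: holomorphic_derivI)
    moreover have "((\<lambda>z. k * z) has_field_derivative k) (at z)" by (auto intro!: derivative_eq_intros)
    ultimately have "((\<lambda>z. f (k * z)) has_field_derivative deriv f (k * z) * k) (at z)"
      by (rule DERIV_chain2[where f=f])
    then show ?thesis by (simp add: mult.commute)
  qed
  show "(\<lambda>z. y (k * z)) holomorphic_on UNIV" using d[OF assms] by (auto simp: holomorphic_on_open)
  show 1: "deriv (\<lambda>z. y (k * z)) z = k * deriv y (k * z)" for z using d[OF assms] by (rule DERIV_imp_deriv)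
  have "deriv y holomorphic_on UNIV" using assms by (intro holomorphic_deriv) auto
  from DERIV_cmult[OF d[OF this], of k z]
  have "((\<lambda>z. k * deriv y (k * z)) has_field_derivative k^2 * deriv (deriv y) (k * z)) (at z)"
    by (simp add: power2_eq_square mult.assoc)
  then show "deriv (deriv (\<lambda>z. y (k * z))) z = k^2 * deriv (deriv y) (k * z)"
    unfolding 1[abs_def] by (rule DERIV_imp_deriv)
qed

text \<open>The cone has half angle arctan 2 < pi/2, so a turn by at most pi/4 leaves it at distance
  pi/2 - arctan 2 from the rays of argument 3 pi/4 and -3 pi/4, inside the sector where the
  asymptotics hold uniformly.\<close>

lemma Arg_times_cis_cone:
  assumes t: "t \<noteq> 0" "\<bar>Im t\<bar> \<le> 2 * Re t" and th: "\<bar>\<theta>\<bar> \<le> pi / 4"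
  shows "t * cis \<theta> \<noteq> 0" "\<bar>Arg (t * cis \<theta>)\<bar> \<le> 3 * pi / 4 - (pi / 2 - arctan 2)"
proof -
  have R: "Re t > 0" using t by (cases "Re t = 0") (auto simp: complex_eq_iff)
  have "Arg t = arctan (Im t / Re t)" using t(1) R by (simp add: Arg_eq_Im_Ln Im_Ln_eq)
  moreover have "\<bar>Im t / Re t\<bar> \<le> 2" using t(2) R by (simp add: abs_le_iff field_simps)
  then have "arctan (- 2) \<le> arctan (Im t / Re t)" "arctan (Im t / Re t) \<le> arctan 2"
    by (simp_all only: arctan_le_iff abs_le_iff) auto
  ultimately have A: "\<bar>Arg t\<bar> \<le> arctan 2" by (simp add: abs_le_iff arctan_minus)
  have "arctan 2 < pi / 2" by (rule arctan_ubound)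
  then have bd: "\<bar>Arg t + \<theta>\<bar> < pi" using A th by linarith
  have "t * cis \<theta> = rcis (cmod t) (Arg t + \<theta>)"
    using rcis_cmod_Arg[of t] by (metis mult.assoc cis_mult rcis_def)
  then have "Arg (t * cis \<theta>) = Arg t + \<theta>"
    using bd t(1) by (intro Arg_unique'[of "cmod t"]) auto
  then show "\<bar>Arg (t * cis \<theta>)\<bar> \<le> 3 * pi / 4 - (pi / 2 - arctan 2)" using A th by linarith
  show "t * cis \<theta> \<noteq> 0" using t(1) by simp
qed

lemma weber_rotated_bound:
  assumes y: "is_parabolic_cylinder a y" and a: "Re a = 0" and th: "\<bar>\<theta>\<bar> \<le> pi / 4"
  shows "\<exists>C. \<forall>t. \<bar>Im t\<bar> \<le> 2 * Re t \<longrightarrow> cmod (y (t * cis \<theta>)) \<le> C * exp (- Re ((t * cis \<theta>)^2) / 4)"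
proof -
  have "pi / 2 - arctan 2 > 0" using arctan_ubound[of 2] by simp
  from is_parabolic_cylinderD(3)[OF y this] obtain B where
    B: "\<And>z. z \<noteq> 0 \<Longrightarrow> \<bar>Arg z\<bar> \<le> 3 * pi / 4 - (pi / 2 - arctan 2) \<Longrightarrow> cmod z \<ge> B \<Longrightarrow> cmod (y z / weber_lead a z - 1) \<le> 1"
    unfolding weber_asymp_def by (metis (mono_tags, lifting) mem_Collect_eq zero_less_one)
  define B1 where "B1 = max B 1"
  have far: "cmod (y z) \<le> 2 * exp (pi * \<bar>Im a\<bar>) * exp (- Re (z^2) / 4)"
    if z: "z \<noteq> 0" "\<bar>Arg z\<bar> \<le> 3 * pi / 4 - (pi / 2 - arctan 2)" "cmod z \<ge> B1" for z
  proof -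
    have "cmod (y z / weber_lead a z - 1) \<le> 1" using B z by (auto simp: B1_def)
    then have "cmod (y z / weber_lead a z) \<le> 2"
      using norm_triangle_sub[of "y z / weber_lead a z" 1] by simp
    then have "cmod (y z) \<le> 2 * cmod (weber_lead a z)"
      using weber_lead_nonzero[OF z(1), of a] by (simp add: norm_divide divide_le_eq)
    also have "cmod (weber_lead a z) \<le> exp (pi * \<bar>Im a\<bar>) * exp (- Re (z^2) / 4)"
    proof -
      have "cmod (z powr (- a - 1/2)) \<le> cmod z powr Re (- a - 1/2) * exp (pi * \<bar>Im (- a - 1/2)\<bar>)"
        by (rule norm_powr_complex_le[OF z(1)])
      also have "\<dots> \<le> 1 * exp (pi * \<bar>Im a\<bar>)"
      proof -
        have "cmod z powr (- 1/2) \<le> cmod z powr 0" using z(3) by (intro powr_mono) (auto simp: B1_def)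
        then show ?thesis using a z(1) by (intro mult_mono) auto
      qed
      finally have "cmod (z powr (- a - 1/2)) \<le> exp (pi * \<bar>Im a\<bar>)" by simp
      moreover have "cmod (exp (- (z^2) / 4)) = exp (- Re (z^2) / 4)" by simp
      ultimately show ?thesis unfolding weber_lead_def norm_mult by (intro mult_mono) auto
    qed
    finally show ?thesis by (simp add: mult.assoc)
  qed
  have "continuous_on (cball 0 B1) (\<lambda>z. y z * exp (z^2 / 4))"
    using is_parabolic_cylinderD(1)[OF y]
    by (intro continuous_intros) (auto intro: holomorphic_on_imp_continuous_on continuous_on_subset)
  then have "bounded ((\<lambda>z. y z * exp (z^2 / 4)) ` cball 0 B1)"
    by (intro compact_imp_bounded compact_continuous_image) auto
  then obtain M where "\<forall>z\<in>cball 0 B1. cmod (y z * exp (z^2 / 4)) \<le> M"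
    by (auto simp: bounded_iff)
  then have M: "cmod (y z * exp (z^2 / 4)) \<le> M" if "cmod z \<le> B1" for z using that by simp
  have near: "cmod (y z) \<le> M * exp (- Re (z^2) / 4)" if "cmod z \<le> B1" for z
  proof -
    have "cmod (y z) = cmod (y z * exp (z^2 / 4)) * exp (- Re (z^2) / 4)"
      by (simp add: norm_mult mult.assoc flip: exp_add)
    then show ?thesis using M[OF that] by (simp add: mult_right_mono)
  qed
  define C where "C = max (2 * exp (pi * \<bar>Im a\<bar>)) M"
  show ?thesis
  proof (intro exI[of _ C] allI impI)
    fix t assume t: "\<bar>Im t\<bar> \<le> 2 * Re t"
    let ?z = "t * cis \<theta>"
    have le: "x * exp (- Re (?z^2) / 4) \<le> C * exp (- Re (?z^2) / 4)" if "x \<le> C" for x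
      using that by (intro mult_right_mono) auto
    show "cmod (y ?z) \<le> C * exp (- Re (?z^2) / 4)"
    proof (cases "cmod ?z \<le> B1")
      case True
      have "M \<le> C" by (simp add: C_def)
      from le[OF this] near[OF True] show ?thesis by linarith
    next
      case False
      have "B1 > 0" by (simp add: B1_def)
      then have "t \<noteq> 0" using False by auto
      from Arg_times_cis_cone[OF this t th]
      have "cmod (y ?z) \<le> 2 * exp (pi * \<bar>Im a\<bar>) * exp (- Re (?z^2) / 4)"
        using False by (intro far) auto
      also have "\<dots> \<le> C * exp (- Re (?z^2) / 4)" by (rule le) (simp add: C_def)
      finally show ?thesis .
    qed
  qed
qed

lemma weber_rotated_ray:
  assumes y: "is_parabolic_cylinder a y" and th: "\<bar>\<theta>\<bar> = pi / 4"
  shows "((\<lambda>r. y (of_real r * cis \<theta>) / weber_lead a (of_real r * cis \<theta>)) \<longlongrightarrow> 1) at_top"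
    and "((\<lambda>r. deriv (\<lambda>z. y z / weber_lead a z) (of_real r * cis \<theta>)) \<longlongrightarrow> 0) at_top"
proof -
  define S where "S = {z. z \<noteq> 0 \<and> \<bar>Arg z\<bar> \<le> 3 * pi / 4 - pi / 4}"
  have as: "weber_asymp a y S" unfolding S_def by (rule is_parabolic_cylinderD(3)[OF y]) simp
  have S0: "S \<inter> \<real>\<^sub>\<le>\<^sub>0 = {}"
  proof -
    have False if "z \<noteq> 0" "\<bar>Arg z\<bar> \<le> pi / 2" "z \<in> \<real>\<^sub>\<le>\<^sub>0" for z
    proof -
      have "Arg z = pi" using that by (auto simp: Arg_eq_pi complex_nonpos_Reals_iff complex_eq_iff)
      then show False using that pi_gt_zero by linarith
    qed
    then show ?thesis by (auto simp: S_def)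
  qed
  \<comment> \<open>Radius 2 suffices: 2 cos(pi/4) = sqrt 2 > 1, so the disc stays in the right half
    plane.\<close>
  have ball: "cball (of_real r * cis \<theta>) 1 \<subseteq> S" if "r \<ge> 2" for r
  proof
    fix z assume "z \<in> cball (complex_of_real r * cis \<theta>) 1"
    then have "cmod (of_real r * cis \<theta> - z) \<le> 1" by (simp add: dist_norm)
    then have "Re (of_real r * cis \<theta> - z) \<le> 1" using complex_Re_le_cmod order_trans by blast
    then have 1: "r * cos \<theta> - Re z \<le> 1" by simp
    have c: "cos \<theta> = sqrt 2 / 2"
    proof -
      have "\<theta> = pi / 4 \<or> \<theta> = - (pi / 4)" using th by linarith
      then show ?thesis using cos_45 cos_minus[of "pi / 4"] by metis
    qed
    have "sqrt 2 > (1::real)" by simp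
    moreover have "2 * cos \<theta> \<le> r * cos \<theta>" using that by (intro mult_right_mono) (simp_all add: c)
    ultimately have "Re z > 0" using 1 c by linarith
    then show "z \<in> S" using Arg_less_half_pi[of z] by (auto simp: S_def)
  qed
  show "((\<lambda>r. y (of_real r * cis \<theta>) / weber_lead a (of_real r * cis \<theta>)) \<longlongrightarrow> 1) at_top"
    "((\<lambda>r. deriv (\<lambda>z. y z / weber_lead a z) (of_real r * cis \<theta>)) \<longlongrightarrow> 0) at_top"
    using weber_asymp_ray[OF is_parabolic_cylinderD(1)[OF y] as S0 ball] by auto
qed

text \<open>The two points have squares -i r^2 and i r^2, so the Gaussian factors cancel exactly.
  What survives is 1/r from the two square roots, and exp(-pi b/2) from the arguments of size pi/4
  meeting the imaginary exponents.\<close>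

lemma weber_lead_product:
  assumes "r > 0"
  shows "weber_lead (\<i> * of_real b) (of_real r * cis (- pi / 4)) * weber_lead (- \<i> * of_real b) (of_real r * cis (pi / 4))
     = of_real (exp (- pi * b / 2)) / of_real r"
proof -
  have L: "Ln (of_real r * cis \<theta>) = of_real (ln r) + \<i> * of_real \<theta>" if "\<bar>\<theta>\<bar> < pi" for \<theta>
  proof -
    have "of_real r * cis \<theta> = exp (of_real (ln r) + \<i> * of_real \<theta>)"
    proof -
      have "exp (complex_of_real (ln r)) = of_real r" using assms by (simp add: exp_of_real)
      then show ?thesis by (simp add: exp_add cis_conv_exp)
    qed
    then show ?thesis using that by (simp add: Ln_exp)
  qed
  have c2: "(of_real r * cis (- pi / 4))^2 = - \<i> * of_real (r^2)" "(of_real r * cis (pi / 4))^2 = \<i> * of_real (r^2)"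
    by (simp_all add: power_mult_distrib Complex.DeMoivre cis_minus_pi_half)
  have L2: "Ln (of_real r * cis (- pi / 4)) = of_real (ln r) + \<i> * of_real (- pi / 4)"
    "Ln (of_real r * cis (pi / 4)) = of_real (ln r) + \<i> * of_real (pi / 4)" by (rule L; simp)+
  have e: "(- (\<i> * of_real b) - 1/2) * (of_real (ln r) + \<i> * of_real (- pi / 4))
     + (- (- \<i> * of_real b) - 1/2) * (of_real (ln r) + \<i> * of_real (pi / 4)) = of_real (- ln r + - pi * b / 2)"
    by (simp add: complex_eq_iff algebra_simps)
  have "weber_lead (\<i> * of_real b) (of_real r * cis (- pi / 4)) * weber_lead (- \<i> * of_real b) (of_real r * cis (pi / 4))
    = (exp ((- (\<i> * of_real b) - 1/2) * (of_real (ln r) + \<i> * of_real (- pi / 4)))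
     * exp ((- (- \<i> * of_real b) - 1/2) * (of_real (ln r) + \<i> * of_real (pi / 4))))
     * (exp (- (- \<i> * of_real (r^2)) / 4) * exp (- (\<i> * of_real (r^2)) / 4))"
    unfolding weber_lead_def powr_def L2 c2 using assms by (simp add: mult_ac)
  also have "exp (- (- \<i> * of_real (r^2)) / 4) * exp (- (\<i> * of_real (r^2)) / 4) = (1::complex)"
    by (simp flip: exp_add)
  also have "exp ((- (\<i> * of_real b) - 1/2) * (of_real (ln r) + \<i> * of_real (- pi / 4)))
     * exp ((- (- \<i> * of_real b) - 1/2) * (of_real (ln r) + \<i> * of_real (pi / 4))) = of_real (exp (- ln r + - pi * b / 2))"
    by (simp only: e flip: exp_add exp_of_real)
  also have "exp (- ln r + - pi * b / 2) = exp (- pi * b / 2) / r"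
  proof -
    have "exp (- ln r) = 1 / r" using assms by (simp add: exp_minus inverse_eq_divide)
    then show ?thesis unfolding exp_add by simp
  qed
  finally show ?thesis by simp
qed

lemma weber_W_eq:
  "weber_W 0 (of_real b) z = parabolic_U (\<i> * of_real b) (z * cis (- pi / 4))"
  "weber_W 3 (of_real b) z = parabolic_U (- \<i> * of_real b) (z * cis (pi / 4))"
proof -
  have e: "exp (- (of_real pi * \<i> / 4)) = cis (- pi / 4)" by (simp add: cis_conv_exp mult.commute)
  then show "weber_W 0 (of_real b) z = parabolic_U (\<i> * of_real b) (z * cis (- pi / 4))"
    by (simp add: weber_W_def)
  have "(- \<i>)^3 * exp (- (of_real pi * \<i> / 4)) = cis (pi / 2) * cis (- pi / 4)"
    unfolding e by (simp add: power3_eq_cube)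
  also have "\<dots> = cis (pi / 2 + - pi / 4)" by (rule cis_mult)
  also have "pi / 2 + - pi / 4 = pi / 4" by simp
  finally have "(- \<i>)^3 * z * exp (- (of_real pi * \<i> / 4)) = z * cis (pi / 4)"
    by (metis mult.assoc mult.commute)
  then show "weber_W 3 (of_real b) z = parabolic_U (- \<i> * of_real b) (z * cis (pi / 4))"
    by (simp add: weber_W_def)
qed

lemma weber_W_holomorphic: "j = 0 \<or> j = 3 \<Longrightarrow> weber_W j (of_real b) holomorphic_on UNIV"
  and weber_W_ODE: "j = 0 \<or> j = 3 \<Longrightarrow> deriv (deriv (weber_W j (of_real b))) z = (of_real b - z^2 / 4) * weber_W j (of_real b) z"
proof -
  have U: "is_parabolic_cylinder (\<i> * of_real b) (parabolic_U (\<i> * of_real b))"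
     "is_parabolic_cylinder (- \<i> * of_real b) (parabolic_U (- \<i> * of_real b))"
    by (rule is_parabolic_cylinder_parabolic_U; simp)+
  have c2: "(cis (- pi / 4))^2 = - \<i>" "(cis (pi / 4))^2 = \<i>"
    by (simp_all add: Complex.DeMoivre cis_minus_pi_half)
  have W: "weber_W 0 (of_real b) = (\<lambda>z. parabolic_U (\<i> * of_real b) (cis (- pi / 4) * z))"
    "weber_W 3 (of_real b) = (\<lambda>z. parabolic_U (- \<i> * of_real b) (cis (pi / 4) * z))"
    by (auto simp: weber_W_eq fun_eq_iff mult.commute)
  note r = deriv_rescale[OF is_parabolic_cylinderD(1)[OF U(1)], of "cis (- pi / 4)"]
    deriv_rescale[OF is_parabolic_cylinderD(1)[OF U(2)], of "cis (pi / 4)"]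
  show "j = 0 \<or> j = 3 \<Longrightarrow> weber_W j (of_real b) holomorphic_on UNIV" unfolding W using r W by auto
  have ii: "\<i> * (\<i> * w) = - w" for w by (simp flip: mult.assoc)
  have "deriv (deriv (weber_W 0 (of_real b))) z = (of_real b - z^2 / 4) * weber_W 0 (of_real b) z"
    unfolding W(1) r(3) is_parabolic_cylinderD(2)[OF U(1)] power_mult_distrib c2
    by (simp add: algebra_simps ii)
  moreover have "deriv (deriv (weber_W 3 (of_real b))) z = (of_real b - z^2 / 4) * weber_W 3 (of_real b) z"
    unfolding W(2) r(6) is_parabolic_cylinderD(2)[OF U(2)] power_mult_distrib c2
    by (simp add: algebra_simps ii)
  ultimately show "j = 0 \<or> j = 3 \<Longrightarrow> deriv (deriv (weber_W j (of_real b))) z = (of_real b - z^2 / 4) * weber_W j (of_real b) z"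
    by auto
qed

text \<open>The Wronskian is constant, so it is evaluated as the real argument tends to infinity.
  There the rotated arguments run along the rays of \<open>weber_rotated_ray\<close>, and the 1/r of
  \<open>weber_lead_product\<close> is compensated by the growth of the logarithmic
  derivatives.\<close>

lemma weber_W_wronskian:
  "weber_W 0 (of_real b) z * deriv (weber_W 3 (of_real b)) z - deriv (weber_W 0 (of_real b)) z * weber_W 3 (of_real b) z
     = - \<i> * of_real (exp (- pi * b / 2))"
proof -
  define a0 where "a0 = \<i> * complex_of_real b"
  define a3 where "a3 = - \<i> * complex_of_real b"
  define c0 where "c0 = cis (- pi / 4)"
  define c3 where "c3 = cis (pi / 4)"
  define y0 where "y0 = parabolic_U a0"
  define y3 where "y3 = parabolic_U a3"
  define W0 where "W0 = weber_W 0 (of_real b)"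
  define W3 where "W3 = weber_W 3 (of_real b)"
  have U: "is_parabolic_cylinder a0 y0" "is_parabolic_cylinder a3 y3"
    unfolding y0_def y3_def by (rule is_parabolic_cylinder_parabolic_U; simp add: a0_def a3_def)+
  have hol: "y0 holomorphic_on UNIV" "y3 holomorphic_on UNIV" using U by (auto dest: is_parabolic_cylinderD(1))
  have W: "W0 = (\<lambda>z. y0 (c0 * z))" "W3 = (\<lambda>z. y3 (c3 * z))"
    by (auto simp: W0_def W3_def weber_W_eq fun_eq_iff mult.commute y0_def y3_def a0_def a3_def c0_def c3_def)
  define h0 where "h0 = (\<lambda>z. y0 z / weber_lead a0 z)"
  define h3 where "h3 = (\<lambda>z. y3 z / weber_lead a3 z)"
  obtain w where w: "\<And>z. W0 z * deriv W3 z - deriv W0 z * W3 z = w"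
    using wronskian_constant[of W0 W3 "\<lambda>z. of_real b - z^2 / 4"] weber_W_holomorphic weber_W_ODE
    unfolding W0_def W3_def by (metis (no_types, lifting))
  have l0: "((\<lambda>r. h0 (of_real r * c0)) \<longlongrightarrow> 1) at_top" "((\<lambda>r. deriv h0 (of_real r * c0)) \<longlongrightarrow> 0) at_top"
    using weber_rotated_ray[OF U(1), of "- pi / 4"] by (simp_all add: h0_def c0_def)
  have l3: "((\<lambda>r. h3 (of_real r * c3)) \<longlongrightarrow> 1) at_top" "((\<lambda>r. deriv h3 (of_real r * c3)) \<longlongrightarrow> 0) at_top"
    using weber_rotated_ray[OF U(2), of "pi / 4"] by (simp_all add: h3_def c3_def)
  define E where "E = complex_of_real (exp (- pi * b / 2))"
  \<comment> \<open>This is the Wronskian at r in terms of the normalized quotients, with 1/r as the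
    small quantity; only the summand -i survives in the limit.\<close>
  let ?f = "\<lambda>r. E * (h0 (of_real r * c0) * h3 (of_real r * c3) * (2 * \<i> * of_real b * (of_real (1 / r) * of_real (1 / r)) - \<i>)
      + of_real (1 / r) * (c3 * h0 (of_real r * c0) * deriv h3 (of_real r * c3) - c0 * deriv h0 (of_real r * c0) * h3 (of_real r * c3)))"
  have wf: "w = ?f r" if r: "r > 0" for r
  proof -
    let ?x = "complex_of_real r"
    define z0 where "z0 = ?x * c0"
    define z3 where "z3 = ?x * c3"
    have cc: "c0 * c0 = - \<i>" "c3 * c3 = \<i>" "c0 \<noteq> 0" "c3 \<noteq> 0"
      by (simp_all add: c0_def c3_def cis_mult cis_minus_pi_half)
    have nr: "z0 \<notin> \<real>\<^sub>\<le>\<^sub>0" "z3 \<notin> \<real>\<^sub>\<le>\<^sub>0" "z0 \<noteq> 0" "z3 \<noteq> 0"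
      using r by (auto simp: z0_def z3_def c0_def c3_def complex_nonpos_Reals_iff sin_45)
    define g0 where "g0 = weber_lead a0 z0"
    define g3 where "g3 = weber_lead a3 z3"
    have yy: "W0 ?x = g0 * h0 z0" "W3 ?x = g3 * h3 z3"
      using weber_lead_nonzero[OF nr(3), of a0] weber_lead_nonzero[OF nr(4), of a3]
      by (auto simp: W h0_def h3_def g0_def g3_def z0_def z3_def mult.commute)
    define m0 where "m0 = (- a0 - 1/2) / z0 - z0 / 2"
    define m3 where "m3 = (- a3 - 1/2) / z3 - z3 / 2"
    have d0: "deriv W0 ?x = c0 * (g0 * (deriv h0 z0 + m0 * h0 z0))"
      unfolding W(1) deriv_rescale(2)[OF hol(1)] mult.commute[of c0 ?x] z0_def[symmetric]
      using deriv_eq_weber_lead_times[OF nr(1) hol(1), of a0] by (simp add: h0_def g0_def m0_def)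
    have d3: "deriv W3 ?x = c3 * (g3 * (deriv h3 z3 + m3 * h3 z3))"
      unfolding W(2) deriv_rescale(2)[OF hol(2)] mult.commute[of c3 ?x] z3_def[symmetric]
      using deriv_eq_weber_lead_times[OF nr(2) hol(2), of a3] by (simp add: h3_def g3_def m3_def)
    have gg: "g0 * g3 = E * of_real (1 / r)"
      using weber_lead_product[OF r, of b] by (simp add: g0_def g3_def z0_def z3_def c0_def c3_def a0_def a3_def E_def)
    \<comment> \<open>The difference of the logarithmic derivatives of the leading terms in the
      unrotated variable: as c0^2 = -i and c3^2 = i, the parts -z/2 add up to -i r instead of
      cancelling.\<close>
    have m: "c3 * m3 - c0 * m0 = 2 * \<i> * of_real b * of_real (1 / r) - \<i> * ?x"
    proof -
      have "c3 * m3 = (\<i> * of_real b - 1/2) / ?x - \<i> * ?x / 2"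
        using r cc(4) unfolding m3_def z3_def a3_def right_diff_distrib
        by (simp add: field_simps) (simp add: cc(2) flip: mult.assoc)
      moreover have "c0 * m0 = (- \<i> * of_real b - 1/2) / ?x + \<i> * ?x / 2"
        using r cc(3) unfolding m0_def z0_def a0_def right_diff_distrib
        by (simp add: field_simps) (simp add: cc(1) flip: mult.assoc)
      ultimately show ?thesis by (simp add: diff_divide_distrib)
    qed
    have "w = W0 ?x * deriv W3 ?x - deriv W0 ?x * W3 ?x" using w by simp
    also have "\<dots> = (g0 * g3) * (h0 z0 * h3 z3 * (c3 * m3 - c0 * m0) + (c3 * h0 z0 * deriv h3 z3 - c0 * deriv h0 z0 * h3 z3))"
      unfolding yy d0 d3 by (simp add: algebra_simps)
    also have "\<dots> = ?f r"
    proof -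
      have one: "of_real (1 / r) * ?x = 1" using r by simp
      have "E * q * (hh * (B * q - \<i> * x) + D) = E * (hh * (B * (q * q) - \<i>) + q * D)"
        if "q * x = 1" for q x hh B D
      proof -
        have "E * q * (hh * (B * q - \<i> * x) + D) = E * (hh * (B * (q * q) - \<i> * (q * x)) + q * D)"
          by (simp add: algebra_simps)
        then show ?thesis using that by simp
      qed
      from this[OF one, of "h0 z0 * h3 z3" "2 * \<i> * of_real b" "c3 * h0 z0 * deriv h3 z3 - c0 * deriv h0 z0 * h3 z3"]
      show ?thesis unfolding gg m unfolding z0_def z3_def .
    qed
    finally show ?thesis .
  qed
  have "\<forall>\<^sub>F r in at_top. ?f r = w"
    by (rule eventually_mono[OF eventually_gt_at_top[of 0]]) (rule wf[symmetric])
  then have "(?f \<longlongrightarrow> w) at_top" by (rule tendsto_eventually)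
  moreover have "(?f \<longlongrightarrow> E * (1 * 1 * (2 * \<i> * of_real b * (of_real 0 * of_real 0) - \<i>) + of_real 0 * (c3 * 1 * 0 - c0 * 0 * 1))) at_top"
  proof -
    have "((\<lambda>r::real. 1 / r) \<longlongrightarrow> 0) at_top" by real_asymp
    then show ?thesis by (intro tendsto_intros l0 l3)
  qed
  ultimately have "w = E * (- \<i>)" using tendsto_unique[of at_top ?f] by fastforce
  then show ?thesis using w[of z] by (simp add: W0_def W3_def E_def mult.commute)
qed

text \<open>With b = -u/2 and the scale sqrt(2u) both functions solve w'' + u^2 (z^2 + 1) w = 0.
  Their exponential bounds are reciprocal: \<open>w0\<close> decays where Im (z^2) is large and
  positive, \<open>w3\<close> where it is large and negative.\<close>

lemma weber_W_scaled:
  fixes u :: real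
  assumes u: "u > 0"
  defines "k \<equiv> sqrt (2 * u)"
  defines "w0 \<equiv> (\<lambda>z. weber_W 0 (of_real (- u / 2)) (of_real k * z))"
  defines "w3 \<equiv> (\<lambda>z. weber_W 3 (of_real (- u / 2)) (of_real k * z))"
  shows "w0 holomorphic_on UNIV" "w3 holomorphic_on UNIV"
    and "deriv (deriv w0) z = - (of_real (u^2) * (z^2 + 1) * w0 z)"
    and "deriv (deriv w3) z = - (of_real (u^2) * (z^2 + 1) * w3 z)"
    and "w0 z * deriv w3 z - deriv w0 z * w3 z = - \<i> * of_real k * of_real (exp (pi * u / 4))"
    and "\<exists>C. \<forall>z. \<bar>Im z\<bar> \<le> 2 * Re z \<longrightarrow> cmod (w0 z) \<le> C * exp (- (u * Im (z^2) / 2)) \<and> cmod (w3 z) \<le> C * exp (u * Im (z^2) / 2)"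
proof -
  let ?b = "complex_of_real (- u / 2)"
  have k: "k > 0" "k^2 = 2 * u" using u by (auto simp: k_def)
  have ck: "(complex_of_real k)^2 = 2 * of_real u" using k(2) by (metis of_real_mult of_real_numeral of_real_power)
  have hol: "weber_W 0 ?b holomorphic_on UNIV" "weber_W 3 ?b holomorphic_on UNIV"
    using weber_W_holomorphic by blast+
  note r = deriv_rescale[OF hol(1), of "of_real k"] deriv_rescale[OF hol(2), of "of_real k"]
  show "w0 holomorphic_on UNIV" "w3 holomorphic_on UNIV" using r by (auto simp: w0_def w3_def)
  have id: "2 * of_real u * ((?b - 2 * of_real u * z^2 / 4) * y) = - (of_real (u^2) * (z^2 + 1) * y)" for y
    by (simp add: field_simps power2_eq_square)
  show "deriv (deriv w0) z = - (of_real (u^2) * (z^2 + 1) * w0 z)"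
    unfolding w0_def r(3) weber_W_ODE[OF disjI1[OF refl]] power_mult_distrib ck by (rule id)
  show "deriv (deriv w3) z = - (of_real (u^2) * (z^2 + 1) * w3 z)"
    unfolding w3_def r(6) weber_W_ODE[OF disjI2[OF refl]] power_mult_distrib ck by (rule id)
  have "w0 z * deriv w3 z - deriv w0 z * w3 z = of_real k * (weber_W 0 ?b (k * z) * deriv (weber_W 3 ?b) (k * z)
      - deriv (weber_W 0 ?b) (k * z) * weber_W 3 ?b (k * z))"
    unfolding w0_def w3_def r(2) r(5) by (simp add: algebra_simps)
  also have "\<dots> = of_real k * (- \<i> * of_real (exp (- pi * (- u / 2) / 2)))"
    unfolding weber_W_wronskian ..
  finally show "w0 z * deriv w3 z - deriv w0 z * w3 z = - \<i> * of_real k * of_real (exp (pi * u / 4))"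
    by (simp add: mult_ac)
  have U: "is_parabolic_cylinder (\<i> * ?b) (parabolic_U (\<i> * ?b))"
     "is_parabolic_cylinder (- \<i> * ?b) (parabolic_U (- \<i> * ?b))"
    by (rule is_parabolic_cylinder_parabolic_U; simp)+
  obtain C0 where C0: "\<And>t. \<bar>Im t\<bar> \<le> 2 * Re t \<Longrightarrow>
      cmod (parabolic_U (\<i> * ?b) (t * cis (- pi / 4))) \<le> C0 * exp (- Re ((t * cis (- pi / 4))^2) / 4)"
    using weber_rotated_bound[OF U(1), of "- pi / 4"] by auto
  obtain C3 where C3: "\<And>t. \<bar>Im t\<bar> \<le> 2 * Re t \<Longrightarrow>
      cmod (parabolic_U (- \<i> * ?b) (t * cis (pi / 4))) \<le> C3 * exp (- Re ((t * cis (pi / 4))^2) / 4)"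
    using weber_rotated_bound[OF U(2), of "pi / 4"] by auto
  have c2: "(cis (- pi / 4))^2 = - \<i>" "(cis (pi / 4))^2 = \<i>"
    by (simp_all add: Complex.DeMoivre cis_minus_pi_half)
  show "\<exists>C. \<forall>z. \<bar>Im z\<bar> \<le> 2 * Re z \<longrightarrow> cmod (w0 z) \<le> C * exp (- (u * Im (z^2) / 2)) \<and> cmod (w3 z) \<le> C * exp (u * Im (z^2) / 2)"
  proof (intro exI[of _ "max C0 C3"] allI impI)
    fix z :: complex assume z: "\<bar>Im z\<bar> \<le> 2 * Re z"
    have "k * \<bar>Im z\<bar> \<le> k * (2 * Re z)" using z k by (intro mult_left_mono) auto
    then have kz: "\<bar>Im (of_real k * z)\<bar> \<le> 2 * Re (of_real k * z)" using k by (simp add: abs_mult)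
    have R: "Re ((of_real k * z * cis (- pi / 4))^2) = 2 * u * Im (z^2)" "Re ((of_real k * z * cis (pi / 4))^2) = - (2 * u * Im (z^2))"
      unfolding power_mult_distrib c2 ck by simp_all
    have "cmod (w0 z) \<le> C0 * exp (- (u * Im (z^2) / 2))"
      using C0[OF kz] unfolding w0_def weber_W_eq R by simp
    moreover have "cmod (w3 z) \<le> C3 * exp (u * Im (z^2) / 2)"
      using C3[OF kz] unfolding w3_def weber_W_eq R by simp
    moreover have "C0 * exp x \<le> max C0 C3 * exp x" "C3 * exp x \<le> max C0 C3 * exp x" for x
      by (intro mult_right_mono; simp)+
    ultimately show "cmod (w0 z) \<le> max C0 C3 * exp (- (u * Im (z^2) / 2)) \<and> cmod (w3 z) \<le> max C0 C3 * exp (u * Im (z^2) / 2)"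
      by (meson order_trans)
  qed
qed

section \<open>The function \<open>xi_bar\<close>\<close>

text \<open>The plane without the two cuts is star-shaped about 0, so the holomorphic square root
  has a primitive there, and integration along segments from 0 produces that primitive.\<close>

lemma xi_bar_DERIV:
  assumes z: "z^2 + 1 \<notin> \<real>\<^sub>\<le>\<^sub>0"
  shows "(xi_bar has_field_derivative csqrt (z^2 + 1)) (at z)"
proof -
  define D where "D = {z::complex. z^2 + 1 \<notin> \<real>\<^sub>\<le>\<^sub>0}"
  have oD: "open D"
  proof -
    have "D = (\<lambda>z. z^2 + 1) -` (- \<real>\<^sub>\<le>\<^sub>0)" by (auto simp: D_def)
    then show ?thesis by (auto intro!: open_vimage continuous_intros)
  qed
  have seg: "closed_segment 0 z \<subseteq> D" if "z \<in> D" for z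
  proof
    fix w assume "w \<in> closed_segment 0 z"
    then obtain t where t: "0 \<le> t" "t \<le> 1" "w = of_real t * z"
      by (auto simp: closed_segment_def scaleR_conv_of_real)
    show "w \<in> D"
    proof (cases "t = 0")
      case False
      have "z^2 + 1 \<in> \<real>\<^sub>\<le>\<^sub>0" if "w^2 + 1 \<in> \<real>\<^sub>\<le>\<^sub>0"
      proof -
        have "Im (z^2) = 0" "t^2 * Re (z^2) + 1 \<le> 0"
          using that False by (auto simp: complex_nonpos_Reals_iff t(3) power_mult_distrib simp flip: of_real_power)
        moreover have "t^2 \<le> 1" using t by (simp add: power_le_one)
        ultimately have "t^2 * (Re (z^2) + 1) \<le> 0" by (simp add: algebra_simps)
        moreover have "t^2 > 0" using False by simp
        ultimately have "Re (z^2) + 1 \<le> 0" by (simp add: mult_le_0_iff)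
        then show ?thesis using \<open>Im (z^2) = 0\<close> by (simp add: complex_nonpos_Reals_iff)
      qed
      then show ?thesis using that by (auto simp: D_def)
    qed (use t in \<open>auto simp: D_def complex_nonpos_Reals_iff\<close>)
  qed
  have hol: "(\<lambda>z. csqrt (z^2 + 1)) holomorphic_on D"
    by (intro holomorphic_intros) (auto simp: D_def)
  have "0 \<in> D" by (auto simp: D_def complex_nonpos_Reals_iff)
  then have "starlike D" using seg by (auto simp: starlike_def)
  then have "\<exists>g. \<forall>x\<in>D. (g has_field_derivative csqrt (x^2 + 1)) (at x)"
    using oD hol by (intro holomorphic_starlike_primitive[where k="{}"])
      (auto intro: holomorphic_on_imp_continuous_on holomorphic_on_imp_differentiable_at)
  then obtain g where g: "\<And>x. x \<in> D \<Longrightarrow> (g has_field_derivative csqrt (x^2 + 1)) (at x)" by blast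
  have eq: "xi_bar w = g w - g 0" if "w \<in> D" for w
  proof -
    have "((\<lambda>z. csqrt (z^2 + 1)) has_contour_integral (g (pathfinish (linepath 0 w)) - g (pathstart (linepath 0 w)))) (linepath 0 w)"
    proof (rule contour_integral_primitive[where S=D])
      show "path_image (linepath 0 w) \<subseteq> D" using seg[OF that] by (simp only: path_image_linepath)
    qed (use g in \<open>auto intro: has_field_derivative_at_within simp del: linepath_0\<close>)
    then show ?thesis unfolding xi_bar_def by (auto intro: contour_integral_unique)
  qed
  have "((\<lambda>w. g w - g 0) has_field_derivative csqrt (z^2 + 1)) (at z)"
    using g[of z] z by (auto simp: D_def intro!: derivative_eq_intros)
  then show ?thesis
    by (rule has_field_derivative_transform_within_open[OF _ oD]) (use z eq in \<open>auto simp: D_def\<close>)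
qed

lemma Re_pos_imp_square_plus_one:
  assumes "Re z > 0"
  shows "z^2 + 1 \<notin> \<real>\<^sub>\<le>\<^sub>0"
  using assms by (auto simp: complex_nonpos_Reals_iff Re_power2 Im_power2) 
    (smt (verit) zero_le_power2)

text \<open>With \<open>a = csqrt (t\<^sup>2 + 1) + t\<close> and \<open>b = csqrt (t\<^sup>2 + 1) - t\<close> we have \<open>a b = 1\<close>, and \<open>\<bar>b\<bar> \<le> \<bar>a\<bar>\<close>
  because both summands lie in the same quadrant.\<close>

lemma norm_csqrt_minus_le:
  assumes "Re t > 0"
  shows "cmod (csqrt (t^2 + 1) - t) \<le> 1"
proof -
  define c where "c = csqrt (t^2 + 1)"
  have c2: "c^2 = t^2 + 1" by (simp add: c_def)
  have Rc: "Re c > 0"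
  proof -
    have "Re c = 0 \<Longrightarrow> c^2 \<in> \<real>\<^sub>\<le>\<^sub>0" by (simp add: complex_nonpos_Reals_iff Re_power2 Im_power2)
    then show ?thesis
      using csqrt_principal[of "t^2+1"] Re_pos_imp_square_plus_one[OF assms] by (auto simp: c_def)
  qed
  have "Re c * Im c = Re t * Im t"
    using arg_cong[OF c2, of Im] by (simp add: Im_power2)
  then have "Re c * (Im c * Im t) = Re t * (Im t)^2" by (simp add: power2_eq_square mult_ac)
  then have "Re c * (Im c * Im t) \<ge> 0" using assms by simp
  then have pos: "Re c * Re t + Im c * Im t \<ge> 0" using Rc assms by (simp add: zero_le_mult_iff)
  have "(cmod (c - t))^2 \<le> (cmod (c + t))^2"
    unfolding cmod_power2 using pos by (simp add: power2_eq_square algebra_simps)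
  then have le: "cmod (c - t) \<le> cmod (c + t)" by (rule power2_le_imp_le) auto
  have "(c - t) * (c + t) = 1" using c2 by (simp add: algebra_simps power2_eq_square)
  then have "cmod (c - t) * cmod (c + t) = 1" by (metis norm_mult norm_one)
  moreover have "cmod (c - t) * cmod (c - t) \<le> cmod (c - t) * cmod (c + t)" using le by (intro mult_left_mono) auto
  ultimately have "(cmod (c - t))^2 \<le> 1^2" by (simp add: power2_eq_square)
  then show ?thesis unfolding c_def by (rule power2_le_imp_le) auto
qed

section \<open>Variation of parameters along an admissible path\<close>

text \<open>Dividing by f a moves the base point to 1, away from the cut of \<open>csqrt\<close>.
  Near a the quotient f s / f a has positive real part, so it is the principal root of g s / (f
  a)^2, whatever branch f follows globally.\<close>

lemma square_root_vector_derivative: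
  fixes f g :: "real \<Rightarrow> complex"
  assumes cont: "continuous_on UNIV f" and sq: "\<And>s. f s ^ 2 = g s"
    and dg: "(g has_vector_derivative g') (at a)" and nz: "f a \<noteq> 0"
  shows "(f has_vector_derivative g' / (2 * f a)) (at a)"
proof -
  let ?S = "{s. Re (f s / f a) > 0}"
  have oS: "open ?S"
    using cont nz by (intro open_Collect_less continuous_intros) auto
  have ga: "g a / f a ^ 2 = 1" using nz by (simp flip: sq)
  have "((\<lambda>z. f a * csqrt (z / f a ^ 2)) has_field_derivative 1 / (2 * f a)) (at (g a))"
  proof -
    have "((\<lambda>z. z / f a ^ 2) has_field_derivative 1 / f a ^ 2) (at (g a))"
      by (rule DERIV_cdivide[OF DERIV_ident])
    moreover have "(csqrt has_field_derivative inverse (2 * csqrt 1)) (at (g a / f a ^ 2))"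
      unfolding ga by (rule has_field_derivative_csqrt) (simp add: complex_nonpos_Reals_iff)
    ultimately have "((\<lambda>z. f a * csqrt (z / f a ^ 2)) has_field_derivative
        f a * (inverse (2 * csqrt 1) * (1 / f a ^ 2))) (at (g a))"
      by (intro DERIV_cmult DERIV_chain2[where f=csqrt])
    then show ?thesis using nz by (simp add: power2_eq_square field_simps)
  qed
  from field_vector_diff_chain_at[OF dg this]
  have d: "((\<lambda>s. f a * csqrt (g s / f a ^ 2)) has_vector_derivative g' / (2 * f a)) (at a)"
    by (simp add: o_def)
  show ?thesis
  proof (rule has_vector_derivative_transform_within_open[OF d oS])
    show "a \<in> ?S" using nz by simp
    fix s assume s: "s \<in> ?S"
    have "g s / f a ^ 2 = (f s / f a) ^ 2" by (simp add: power_divide flip: sq)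
    then have "csqrt (g s / f a ^ 2) = f s / f a" using s by (simp add: csqrt_square)
    then show "f a * csqrt (g s / f a ^ 2) = f s" using nz by simp
  qed
qed

lemma norm_diff_le_integral:
  fixes f :: "real \<Rightarrow> complex"
  assumes "a \<le> b" "\<And>s. (f has_vector_derivative f' s) (at s)"
    "continuous_on UNIV h" "\<And>s. a \<le> s \<Longrightarrow> s \<le> b \<Longrightarrow> cmod (f' s) \<le> c * h s"
  shows "cmod (f b - f a) \<le> c * integral {a..b} h"
proof -
  have F: "(f' has_integral (f b - f a)) {a..b}"
    using assms by (intro fundamental_theorem_of_calculus) (auto intro: has_vector_derivative_at_within)
  have "cmod (integral {a..b} f') \<le> integral {a..b} (\<lambda>s. c * h s)"
  proof (rule integral_norm_bound_integral)
    show "f' integrable_on {a..b}" using F by blast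
    show "(\<lambda>s. c * h s) integrable_on {a..b}"
      using continuous_on_subset[OF assms(3), of "{a..b}"]
      by (intro integrable_continuous_interval continuous_on_mult_left) auto
  qed (use assms(4) in auto)
  then show ?thesis using integral_unique[OF F] by simp
qed

text \<open>Variation of parameters along a path on which \<open>Im X\<close> decreases: the kernels
  \<open>exp (\<plusminus>\<i> u (X s - X v))\<close> have modulus at most 1.\<close>

lemma variation_of_parameters_bound:
  fixes X V F P A B F1 :: "real \<Rightarrow> complex" and k :: "real \<Rightarrow> real" and u K W M :: real
  assumes u: "u > 0"
    and dA: "\<And>s. (A has_vector_derivative exp (- (\<i> * u * X s)) * (P s + F1 s / (\<i> * u))) (at s)"
    and dB: "\<And>s. (B has_vector_derivative exp (\<i> * u * X s) * (P s - F1 s / (\<i> * u))) (at s)"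
    and AB: "\<And>s. exp (\<i> * u * X s) * A s - exp (- (\<i> * u * X s)) * B s = 2 * \<i> * u * (V s - F s / u^2)"
    and mono: "antimono (\<lambda>s. Im (X s))"
    and lim: "(A \<longlongrightarrow> 0) at_top" "(B \<longlongrightarrow> 0) at_bot"
    and P: "\<And>s. cmod (P s) \<le> cmod (V s) * k s"
    and k: "\<And>s. k s \<ge> 0" and cont: "continuous_on UNIV k" "continuous_on UNIV F1"
    and K: "\<And>a b. a \<le> b \<Longrightarrow> integral {a..b} k \<le> K"
    and W: "\<And>a b. a \<le> b \<Longrightarrow> integral {a..b} (\<lambda>s. cmod (F1 s)) \<le> W"
    and M: "\<And>s. cmod (V s) \<le> M"
  shows "cmod (V s - F s / u^2) \<le> (M * K + W / u) / (2 * u)"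
proof -
  define h where "h = (\<lambda>s. M * k s + cmod (F1 s) / u)"
  have M0: "M \<ge> 0" using M[of 0] norm_ge_zero order_trans by blast
  have ch: "continuous_on UNIV h" unfolding h_def using u by (intro continuous_intros cont) auto
  have ci: "continuous_on {a..b} k" "continuous_on {a..b} F1" for a b
    using cont by (auto intro: continuous_on_subset)
  have hI: "h integrable_on {a..b}" for a b
    using ch by (intro integrable_continuous_interval) (auto intro: continuous_on_subset)
  have h: "integral {a..b} h \<le> M * K + W / u" if "a \<le> b" for a b
  proof -
    have "integral {a..b} h = M * integral {a..b} k + integral {a..b} (\<lambda>s. cmod (F1 s)) / u"
      unfolding h_def using ci
      by (subst integral_add) (auto intro!: integrable_continuous_interval continuous_intros simp: u less_imp_neq[OF u, symmetric])
    also have "\<dots> \<le> M * K + W / u"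
      using K[OF that] W[OF that] M0 u by (intro add_mono mult_left_mono divide_right_mono) auto
    finally show ?thesis .
  qed
  have PF: "cmod (P s + F1 s / (\<i> * u)) \<le> h s" "cmod (P s - F1 s / (\<i> * u)) \<le> h s" for s
  proof -
    have "cmod (P s) \<le> M * k s" using P[of s] mult_right_mono[OF M[of s] k[of s]] by linarith
    moreover have "cmod (F1 s / (\<i> * u)) = cmod (F1 s) / u" using u by (simp add: norm_divide norm_mult)
    ultimately show "cmod (P s + F1 s / (\<i> * u)) \<le> h s" "cmod (P s - F1 s / (\<i> * u)) \<le> h s"
      unfolding h_def by (smt (verit) norm_triangle_ineq norm_triangle_ineq4)+
  qed
  have ne: "cmod (exp (\<i> * u * X s)) = exp (- (u * Im (X s)))" "cmod (exp (- (\<i> * u * X s))) = exp (u * Im (X s))" for s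
    by simp_all
  have monoD: "Im (X b) \<le> Im (X a)" if "a \<le> b" for a b using mono that by (auto dest: antimonoD)
  define eA where "eA = exp (- (u * Im (X s)))"
  define eB where "eB = exp (u * Im (X s))"
  \<comment> \<open>\<open>A\<close> is integrated forwards and \<open>B\<close> backwards, each
    towards the end where it vanishes. Since Im X decreases, the exponential weight on that part of
    the path is largest at s itself, where it is cancelled by the prefactor.\<close>
  have A: "eA * cmod (A s) \<le> eA * cmod (A t) + integral {s..t} h" if "s \<le> t" for t
  proof -
    have "cmod (A t - A s) \<le> eB * integral {s..t} h"
    proof (rule norm_diff_le_integral[OF that dA ch])
      fix v assume v: "s \<le> v" "v \<le> t"
      have "exp (u * Im (X v)) \<le> eB" unfolding eB_def using monoD[OF v(1)] u by simp
      then show "cmod (exp (- (\<i> * u * X v)) * (P v + F1 v / (\<i> * u))) \<le> eB * h v"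
        unfolding norm_mult ne using PF[of v] by (intro mult_mono) (auto simp: eB_def)
    qed
    then have "eA * cmod (A t - A s) \<le> eA * (eB * integral {s..t} h)" by (intro mult_left_mono) (auto simp: eA_def)
    also have "\<dots> = integral {s..t} h" by (simp add: eA_def eB_def mult.assoc[symmetric] flip: exp_add)
    finally have "eA * cmod (A t - A s) \<le> integral {s..t} h" .
    moreover have "eA * cmod (A s) \<le> eA * (cmod (A t) + cmod (A t - A s))"
      by (intro mult_left_mono) (auto simp: eA_def norm_minus_commute intro: norm_triangle_sub)
    ultimately show ?thesis by (simp add: distrib_left)
  qed
  have B: "eB * cmod (B s) \<le> eB * cmod (B t) + integral {t..s} h" if "t \<le> s" for t
  proof -
    have "cmod (B s - B t) \<le> eA * integral {t..s} h"
    proof (rule norm_diff_le_integral[OF that dB ch])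
      fix v assume v: "t \<le> v" "v \<le> s"
      have "exp (- (u * Im (X v))) \<le> eA" unfolding eA_def using monoD[OF v(2)] u by simp
      then show "cmod (exp (\<i> * u * X v) * (P v - F1 v / (\<i> * u))) \<le> eA * h v"
        unfolding norm_mult ne using PF[of v] by (intro mult_mono) (auto simp: eA_def)
    qed
    then have "eB * cmod (B s - B t) \<le> eB * (eA * integral {t..s} h)" by (intro mult_left_mono) (auto simp: eB_def)
    also have "\<dots> = integral {t..s} h" by (simp add: eA_def eB_def mult.assoc[symmetric] flip: exp_add)
    finally have "eB * cmod (B s - B t) \<le> integral {t..s} h" .
    moreover have "eB * cmod (B s) \<le> eB * (cmod (B t) + cmod (B s - B t))"
      by (intro mult_left_mono) (auto simp: eB_def intro: norm_triangle_sub)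
    ultimately show ?thesis by (simp add: distrib_left)
  qed
  have "2 * u * cmod (V s - F s / u^2) = cmod (2 * \<i> * u * (V s - F s / u^2))"
    using u by (simp add: norm_mult)
  also have "\<dots> \<le> eA * cmod (A s) + eB * cmod (B s)"
    unfolding AB[symmetric] using norm_triangle_ineq4[of "exp (\<i> * u * X s) * A s" "exp (- (\<i> * u * X s)) * B s"]
    by (simp add: norm_mult eA_def eB_def)
  \<comment> \<open>The integrals over [t1, s] and [s, t2] join to a single one over [t1, t2], so
    the total M K + W/u is counted once and not twice.\<close>
  finally have main: "2 * u * cmod (V s - F s / u^2) \<le> eA * cmod (A t2) + (eB * cmod (B t1) + (M * K + W / u))"
    if "t1 \<le> s" "s \<le> t2" for t1 t2
    using A[OF that(2)] B[OF that(1)] h[of t1 t2] Henstock_Kurzweil_Integration.integral_combine[OF that hI] that by linarith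
  have "2 * u * cmod (V s - F s / u^2) \<le> eB * cmod (B t1) + (M * K + W / u)" if "t1 \<le> s" for t1
  proof (rule tendsto_lowerbound)
    show "((\<lambda>t2. eA * cmod (A t2) + (eB * cmod (B t1) + (M * K + W / u))) \<longlongrightarrow> eB * cmod (B t1) + (M * K + W / u)) at_top"
      using lim(1) by (auto intro!: tendsto_eq_intros)
    show "\<forall>\<^sub>F t2 in at_top. 2 * u * cmod (V s - F s / u^2) \<le> eA * cmod (A t2) + (eB * cmod (B t1) + (M * K + W / u))"
      using eventually_ge_at_top[of s] by eventually_elim (rule main[OF that])
  qed auto
  note m2 = this
  have "2 * u * cmod (V s - F s / u^2) \<le> M * K + W / u"
  proof (rule tendsto_lowerbound)
    show "((\<lambda>t1. eB * cmod (B t1) + (M * K + W / u)) \<longlongrightarrow> M * K + W / u) at_bot"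
      using lim(2) by (auto intro!: tendsto_eq_intros)
    show "\<forall>\<^sub>F t1 in at_bot. 2 * u * cmod (V s - F s / u^2) \<le> eB * cmod (B t1) + (M * K + W / u)"
      using eventually_le_at_bot[of s] by eventually_elim (rule m2)
  qed auto
  then show ?thesis using u by (simp add: field_simps)
qed

text \<open>Inserting the supremum M of |V| into its own estimate gives M <= (S + W/2)/u^2 + M
  K/(2u), which is solvable for M as K < 2u. This M goes back only into the K-term, so the pointwise
  value |F s| survives in front. The a priori bound \<open>M0\<close> makes the supremum
  finite.\<close>

lemma self_bound:
  fixes V F :: "'a \<Rightarrow> complex" and u K W S M0 :: real
  assumes u: "u > 0" and K: "K \<ge> 0" "K < 2 * u"
    and M0: "\<And>s. cmod (V s) \<le> M0"
    and F: "\<And>s. cmod (F s) \<le> S"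
    and step: "\<And>M s. (\<And>s. cmod (V s) \<le> M) \<Longrightarrow> cmod (V s - F s / u^2) \<le> (M * K + W / u) / (2 * u)"
  shows "cmod (V s) \<le> cmod (F s) / u^2 + W / (2 * u^2) + K / (2 * u) * (((S + W / 2) / u^2) / (1 - K / (2 * u)))"
proof -
  define M where "M = (SUP s. cmod (V s))"
  have bdd: "bdd_above (range (\<lambda>s. cmod (V s)))" using M0 by (auto intro!: bdd_aboveI)
  have M: "cmod (V s) \<le> M" for s unfolding M_def using bdd by (rule cSUP_upper[rotated]) auto
  have st: "cmod (V s) \<le> cmod (F s) / u^2 + (M * K + W / u) / (2 * u)" for s
  proof -
    have "cmod (V s) \<le> cmod (F s / u^2) + cmod (V s - F s / u^2)" by (rule norm_triangle_sub)
    also have "cmod (F s / u^2) = cmod (F s) / u^2" by (simp add: norm_divide norm_power)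
    finally show ?thesis using step[OF M, of s] by linarith
  qed
  have "M \<le> S / u^2 + (M * K + W / u) / (2 * u)"
    unfolding M_def
  proof (rule cSUP_least)
    fix s
    have "cmod (F s) / u^2 \<le> S / u^2" using F by (intro divide_right_mono) auto
    then show "cmod (V s) \<le> S / u^2 + ((SUP s. cmod (V s)) * K + W / u) / (2 * u)"
      using st[of s] unfolding M_def by linarith
  qed auto
  also have "\<dots> = (S + W / 2) / u^2 + M * (K / (2 * u))" using u by (simp add: field_simps power2_eq_square)
  finally have "M * (1 - K / (2 * u)) \<le> (S + W / 2) / u^2" by (simp add: algebra_simps)
  moreover have p: "1 - K / (2 * u) > 0" using u K by simp
  ultimately have "M \<le> ((S + W / 2) / u^2) / (1 - K / (2 * u))"
    using pos_le_divide_eq[OF p] by blast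
  then have "K / (2 * u) * M \<le> K / (2 * u) * (((S + W / 2) / u^2) / (1 - K / (2 * u)))"
    using K u by (intro mult_left_mono) auto
  moreover have "(M * K + W / u) / (2 * u) = W / (2 * u^2) + K / (2 * u) * M"
    using u by (simp add: field_simps power2_eq_square)
  ultimately show ?thesis using st[of s] by linarith
qed

text \<open>The difference has derivative csqrt(t^2 + 1) - t, of modulus at most 1 in the right half
  plane and at 0; it is integrated along the segment from 0.\<close>

lemma xi_bar_approx:
  assumes "Re z > 0"
  shows "cmod (xi_bar z - z^2 / 2) \<le> cmod z"
proof -
  let ?f = "\<lambda>w. xi_bar w - w^2 / 2"
  have "cmod (?f z - ?f 0) \<le> 1 * cmod (z - 0)"
  proof (rule field_differentiable_bound[where S="closed_segment 0 z" and f'="\<lambda>w. csqrt (w^2 + 1) - w"])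
    fix w assume w: "w \<in> closed_segment 0 z"
    then obtain t where t: "0 \<le> t" "t \<le> 1" "w = of_real t * z"
      by (auto simp: closed_segment_def scaleR_conv_of_real)
    then consider "w = 0" | "Re w > 0" using assms by (cases "t = 0") auto
    then have nr: "w^2 + 1 \<notin> \<real>\<^sub>\<le>\<^sub>0" and le: "cmod (csqrt (w^2 + 1) - w) \<le> 1"
      by (cases; use Re_pos_imp_square_plus_one norm_csqrt_minus_le in \<open>auto simp: complex_nonpos_Reals_iff\<close>)+
    show "cmod (csqrt (w^2 + 1) - w) \<le> 1" by (rule le)
    have "(?f has_field_derivative csqrt (w^2 + 1) - w) (at w)"
      using xi_bar_DERIV[OF nr] by (auto intro!: derivative_eq_intros)
    then show "(?f has_field_derivative csqrt (w^2 + 1) - w) (at w within closed_segment 0 z)"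
      by (rule has_field_derivative_at_within)
  qed auto
  moreover have "xi_bar 0 = 0" by (simp add: xi_bar_def)
  ultimately show ?thesis by simp
qed

text \<open>The exponent has the shape that \<open>admissible_path_ends\<close> provides: |z|^2/4 -
  |z| bounds Im X at the ends up to sign and a constant. The decay of the recessive solutions on
  their rays is brought to the same form.\<close>

lemma tendsto_dir_bound:
  fixes u c :: real
  assumes "u > 0"
  shows "((\<lambda>x. exp (c + u * x - u * x^2 / 4) * x ^ N) \<longlongrightarrow> 0) at_top"
proof (rule Lim_null_comparison)
  show "((\<lambda>x::real. exp c * (x ^ N / exp x)) \<longlongrightarrow> 0) at_top"
    by (intro tendsto_mult_right_zero tendsto_power_div_exp_0)
  show "\<forall>\<^sub>F x in at_top. norm (exp (c + u * x - u * x^2 / 4) * x ^ N) \<le> exp c * (x ^ N / exp x)"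
    using eventually_ge_at_top[of "max 0 (4 * (1 + u) / u)"]
  proof eventually_elim
    case (elim x)
    then have x: "x \<ge> 0" "4 * (1 + u) / u \<le> x" by auto
    then have "4 * (1 + u) \<le> u * x" using assms by (simp add: field_simps)
    then have "4 * (1 + u) * x \<le> u * x * x" using x by (intro mult_right_mono) auto
    then have "c + u * x - u * x^2 / 4 \<le> c - x" by (simp add: power2_eq_square algebra_simps)
    then have "exp (c + u * x - u * x^2 / 4) \<le> exp (c - x)" by simp
    then have "exp (c + u * x - u * x^2 / 4) * x ^ N \<le> exp (c - x) * x ^ N" using x by (intro mult_right_mono) auto
    also have "\<dots> = exp c * (x ^ N / exp x)" by (simp add: exp_diff)
    finally show ?case using x by (simp add: abs_mult)
  qed
qed

text \<open>Both coordinates of the limiting direction have modulus sqrt 2 / 2, so those of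
  \<open>sgn (\<gamma> s)\<close> eventually lie between 0.6 and 0.8 in modulus. Their ratios are
  then below 4/3 < 3/2, and twice their product exceeds 0.72 > 1/2.\<close>

lemma tends_to_inf_dir_cone:
  fixes \<gamma> :: "real \<Rightarrow> complex" and \<sigma> :: real
  assumes dir: "tends_to_inf_dir (\<sigma> * pi / 4) \<gamma> F" and \<sigma>: "\<sigma> = 1 \<or> \<sigma> = - 1"
  shows "\<forall>\<^sub>F s in F. cmod (\<gamma> s) \<ge> \<rho> \<and> Re (\<gamma> s) > 0 \<and> Re (\<gamma> s) \<le> 3/2 * \<bar>Im (\<gamma> s)\<bar> \<and>
      \<bar>Im (\<gamma> s)\<bar> \<le> 3/2 * Re (\<gamma> s) \<and> \<sigma> * Im ((\<gamma> s)^2) \<ge> (cmod (\<gamma> s))^2 / 2"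
proof -
  have r: "0.6 < sqrt 2 / 2" "sqrt 2 / 2 < 0.8"
  proof -
    have "6/5 < sqrt 2" by (rule real_less_rsqrt) (simp add: power2_eq_square)
    moreover have "sqrt 2 < 8/5" by (rule real_less_lsqrt) (simp_all add: power2_eq_square)
    ultimately show "0.6 < sqrt 2 / 2" "sqrt 2 / 2 < 0.8" by simp_all
  qed
  have lim: "((\<lambda>s. sgn (\<gamma> s)) \<longlongrightarrow> cis (\<sigma> * pi / 4)) F" and inf: "filterlim \<gamma> at_infinity F"
    using dir by (auto simp: tends_to_inf_dir_def)
  have a: "((\<lambda>s. Re (sgn (\<gamma> s))) \<longlongrightarrow> sqrt 2 / 2) F"
    using tendsto_Re[OF lim] \<sigma> by (auto simp: cos_45)
  note order_tendstoD(1)[OF a r(1)] order_tendstoD(2)[OF a r(2)]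
  moreover have b: "((\<lambda>s. \<sigma> * Im (sgn (\<gamma> s))) \<longlongrightarrow> sqrt 2 / 2) F"
    using tendsto_mult_left[OF tendsto_Im[OF lim], of \<sigma>] \<sigma> by (auto simp: sin_45)
  note order_tendstoD(1)[OF b r(1)] order_tendstoD(2)[OF b r(2)]
  moreover have "\<forall>\<^sub>F s in F. cmod (\<gamma> s) \<ge> max \<rho> 1"
  proof -
    have "\<forall>r>0. \<forall>\<^sub>F s in F. r \<le> cmod (\<gamma> s)" using inf unfolding filterlim_at_infinity[OF order_refl] .
    from this[rule_format, of "max \<rho> 1"] show ?thesis by simp
  qed
  ultimately show ?thesis
  proof eventually_elim
    case (elim s)
    define m where "m = cmod (\<gamma> s)"
    define x where "x = Re (sgn (\<gamma> s))"
    define y where "y = \<sigma> * Im (sgn (\<gamma> s))"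
    have m: "m \<ge> 1" "m \<ge> \<rho>" using elim by (auto simp: m_def)
    have g: "\<gamma> s = of_real m * sgn (\<gamma> s)" using m by (auto simp: m_def sgn_eq)
    have "Re (of_real m * w) = m * Re w" "Im (of_real m * w) = m * Im w" for w by simp_all
    with arg_cong[OF g, of Re] arg_cong[OF g, of Im]
    have R: "Re (\<gamma> s) = m * x" and I': "Im (\<gamma> s) = m * Im (sgn (\<gamma> s))" by (simp_all only: x_def)
    have I: "\<sigma> * Im (\<gamma> s) = m * y" unfolding y_def by (subst I') (rule mult.left_commute)
    have xb: "0.6 < x" "x < 0.8" "0.6 < y" "y < 0.8" unfolding x_def y_def using elim by blast+
    have aI: "\<bar>Im (\<gamma> s)\<bar> = m * y"
    proof -
      have "m * y > 0" using m xb by (intro mult_pos_pos) linarith+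
      then show ?thesis using I \<sigma> by auto
    qed
    have "\<sigma> * Im ((\<gamma> s)^2) = 2 * Re (\<gamma> s) * (\<sigma> * Im (\<gamma> s))" by (simp add: Im_power2)
    also have "\<dots> = m^2 * (2 * x * y)" unfolding R I by (simp add: power2_eq_square)
    also have "\<dots> \<ge> m^2 * (1/2)"
    proof (rule mult_left_mono)
      have "0.6 * 0.6 \<le> x * y" using xb by (intro mult_mono) auto
      then show "1/2 \<le> 2 * x * y" by simp
    qed auto
    finally have 1: "\<sigma> * Im ((\<gamma> s)^2) \<ge> (cmod (\<gamma> s))^2 / 2" by (simp add: m_def)
    have xy: "x \<le> 3/2 * y" "y \<le> 3/2 * x" "x > 0" using xb by auto
    have "m * x \<le> m * (3/2 * y)" "m * y \<le> m * (3/2 * x)" "m * x > 0"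
      using m xy by (auto intro!: mult_left_mono simp del: mult_le_cancel_left_pos)
    then show ?case using 1 m unfolding R aI m_def by auto
  qed
qed

section \<open>Coefficients, variations and branches along a path\<close>

lemma G_bar_holomorphic: "G_bar R s holomorphic_on {z. z^2 + 1 \<noteq> 0}"
proof (induction s)
  case 0
  show ?case by (auto intro!: holomorphic_intros)
next
  case (Suc s)
  have "open {z::complex. z^2 + 1 \<noteq> 0}" by (intro open_Collect_neq continuous_intros)
  then show ?case using Suc by (auto intro!: holomorphic_intros holomorphic_deriv)
qed

lemma open_not_pm_i: "open {z::complex. z^2 + 1 \<noteq> 0}"
  by (intro open_Collect_neq continuous_intros)

lemma norm_powr_of_real:
  assumes "z \<noteq> 0"
  shows "cmod (z powr complex_of_real r) = cmod z powr r"
  using assms by (simp add: powr_def)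

text \<open>The locally holomorphic branch has logarithmic derivative t / (2 (t^2 + 1)). In this
  form the modulus can be matched with a fourth root that is continued along a path and differs from
  the principal one by a unit.\<close>

lemma norm_deriv_root4:
  assumes g: "(g has_field_derivative g') (at t)" and t: "t^2 + 1 \<noteq> 0"
  shows "cmod (deriv_root4 g t) = cmod (t^2 + 1) powr (1/4) * cmod (g' + t / (2 * (t^2 + 1)) * g t)"
proof -
  define c where "c = (t^2 + 1) powr (1/4)"
  define d where "d = t^2 + 1"
  have D1: "((\<lambda>w. (w^2 + 1) / d) has_field_derivative 2 * t / d) (at t)"
    by (rule DERIV_cdivide) (auto intro!: derivative_eq_intros)
  have one: "(t^2 + 1) / d = 1" using t by (simp add: d_def)
  have D2: "((\<lambda>z. z powr (1/4)) has_field_derivative 1/4 * 1 powr (1/4 - 1)) (at ((t^2 + 1) / d))"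
    unfolding one by (intro has_field_derivative_powr) (simp add: complex_nonpos_Reals_iff)
  note DERIV_chain2[where f="\<lambda>z. z powr (1/4)" and g="\<lambda>w. (w^2 + 1) / d" and x=t, OF D2 D1]
  from DERIV_mult[OF DERIV_cmult[OF this, of c] g, unfolded one]
  have "((\<lambda>w. c * ((w^2 + 1) / d) powr (1/4) * g w) has_field_derivative c * (g' + t / (2 * d) * g t)) (at t)"
    by (simp add: algebra_simps)
  then have "deriv_root4 g t = c * (g' + t / (2 * d) * g t)"
    unfolding deriv_root4_def c_def d_def by (rule DERIV_imp_deriv)
  then show ?thesis using norm_powr_of_real[OF t, of "1/4"] by (simp add: norm_mult c_def d_def)
qed

lemma abs_path_integral_bound:
  assumes cont: "continuous_on UNIV h" and h: "\<And>s. h s = cmod (f (\<gamma> s) * vector_derivative \<gamma> (at s))"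
    and I: "abs_path_integral \<gamma> f = ennreal I" "I \<ge> 0"
  shows "integral {a..b} h \<le> I"
proof -
  have hn: "h s \<ge> 0" for s by (simp add: h)
  have "h integrable_on {a..b}"
    using cont by (intro integrable_continuous_interval) (auto intro: continuous_on_subset)
  then have "ennreal (integral {a..b} h) = (\<integral>\<^sup>+ s. ennreal (h s) * indicator {a..b} s \<partial>lborel)"
    using hn by (intro nn_integral_has_integral_lebesgue'[symmetric]) auto
  also have "\<dots> \<le> (\<integral>\<^sup>+ s. ennreal (h s) \<partial>lborel)"
    by (intro nn_integral_mono) (auto simp: indicator_def)
  also have "\<dots> = ennreal I" using I(1) by (simp add: abs_path_integral_def h)
  finally show ?thesis using I(2) by simp
qed

text \<open>Along an admissible path the continued branch returns to the principal one (up to an additive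
  constant) at the final end, since \<open>Im X\<close> has to decrease there as well.\<close>

lemma admissible_path_ends:
  assumes adm: "admissible_path \<gamma>" and X: "xi_bar_along \<gamma> X"
    and mono: "mono (\<lambda>s. Im (X s)) \<or> antimono (\<lambda>s. Im (X s))"
  shows "antimono (\<lambda>s. Im (X s))"
    and "\<forall>\<^sub>F s in at_bot. Im (X s) \<ge> (cmod (\<gamma> s))^2 / 4 - cmod (\<gamma> s)"
    and "\<exists>c. \<forall>\<^sub>F s in at_top. Im (X s) \<le> c - ((cmod (\<gamma> s))^2 / 4 - cmod (\<gamma> s))"
proof -
  have dirs: "tends_to_inf_dir (1 * pi / 4) \<gamma> at_bot" "tends_to_inf_dir (- 1 * pi / 4) \<gamma> at_top"
    using adm by (auto simp: admissible_path_def)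
  have approx: "\<sigma> * Im (xi_bar z) \<ge> (cmod z)^2 / 4 - cmod z"
    if "Re z > 0" "\<sigma> * Im (z^2) \<ge> (cmod z)^2 / 2" "\<sigma> = 1 \<or> \<sigma> = - 1" for z \<sigma>
  proof -
    have "\<bar>Im (xi_bar z - z^2 / 2)\<bar> \<le> cmod z"
      using xi_bar_approx[OF that(1)] abs_Im_le_cmod order_trans by blast
    then have "\<bar>Im (xi_bar z) - Im (z^2) / 2\<bar> \<le> cmod z" by simp
    then show ?thesis using that(2,3) by auto
  qed
  have b: "\<forall>\<^sub>F s in at_bot. Im (X s) \<ge> (cmod (\<gamma> s))^2 / 4 - cmod (\<gamma> s)"
  proof -
    have "\<forall>\<^sub>F s in at_bot. X s = xi_bar (\<gamma> s)" using X by (auto simp: xi_bar_along_def)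
    then show ?thesis using tends_to_inf_dir_cone[OF dirs(1) disjI1[OF refl], of 0]
      by eventually_elim (use approx[of _ 1] in auto)
  qed
  then show "\<forall>\<^sub>F s in at_bot. Im (X s) \<ge> (cmod (\<gamma> s))^2 / 4 - cmod (\<gamma> s)" .
  have infty: "\<exists>s. P s \<and> s \<in> S \<and> M < (cmod (\<gamma> s))^2 / 4 - cmod (\<gamma> s)"
    if F: "filterlim \<gamma> at_infinity F" "\<forall>\<^sub>F s in F. P s" "\<forall>\<^sub>F s in F. s \<in> S" "F \<noteq> bot" for F P S and M :: real
  proof -
    have "filterlim (\<lambda>s. cmod (\<gamma> s)) at_top F"
      using F(1) by (rule filterlim_at_infinity_imp_norm_at_top)
    then have "\<forall>\<^sub>F s in F. cmod (\<gamma> s) \<ge> 8 + \<bar>M\<bar>" by (simp add: filterlim_at_top)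
    then have "\<forall>\<^sub>F s in F. M < (cmod (\<gamma> s))^2 / 4 - cmod (\<gamma> s)"
    proof eventually_elim
      case (elim s)
      then have "8 * cmod (\<gamma> s) \<le> (cmod (\<gamma> s))^2"
        unfolding power2_eq_square by (intro mult_right_mono) auto
      then show ?case using elim by linarith
    qed
    then have "\<forall>\<^sub>F s in F. P s \<and> s \<in> S \<and> M < (cmod (\<gamma> s))^2 / 4 - cmod (\<gamma> s)"
      using F(2,3) by eventually_elim auto
    then show ?thesis using F(4) eventually_happens by blast
  qed
  have infs: "filterlim \<gamma> at_infinity at_bot" "filterlim \<gamma> at_infinity at_top"
    using dirs by (auto simp: tends_to_inf_dir_def)
  \<comment> \<open>At the initial end the branch is principal and Im X tends to plus infinity,
    which an increasing function cannot do there.\<close>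
  have "\<not> mono (\<lambda>s. Im (X s))"
  proof
    assume m: "mono (\<lambda>s. Im (X s))"
    obtain s where "Im (X s) \<ge> (cmod (\<gamma> s))^2 / 4 - cmod (\<gamma> s)" "s \<in> {..0}" "Im (X 0) < (cmod (\<gamma> s))^2 / 4 - cmod (\<gamma> s)"
      using infty[OF infs(1) b, of "{..0}" "Im (X 0)"] by (auto simp: eventually_le_at_bot)
    moreover have "Im (X s) \<le> Im (X 0)" using m \<open>s \<in> {..0}\<close> by (auto dest: monoD)
    ultimately show False by linarith
  qed
  with mono show anti: "antimono (\<lambda>s. Im (X s))" by blast
  obtain q where q: "continuous_on UNIV q" "\<And>s. (q s)^2 = (\<gamma> s)^2 + 1"
    "\<And>s. (X has_vector_derivative q s * vector_derivative \<gamma> (at s)) (at s)"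
    using X by (auto simp: xi_bar_along_def)
  obtain \<gamma>' where \<gamma>': "\<And>s. (\<gamma> has_vector_derivative \<gamma>' s) (at s)"
    using adm by (auto simp: admissible_path_def R2_path_def)
  have c\<gamma>: "continuous_on UNIV \<gamma>" using \<gamma>' by (auto intro!: continuous_at_imp_continuous_on has_vector_derivative_continuous)
  obtain s1 where s1: "\<And>s. s \<ge> s1 \<Longrightarrow> Re (\<gamma> s) > 0"
    using tends_to_inf_dir_cone[OF dirs(2) disjI2[OF refl], of 0] unfolding eventually_at_top_linorder by auto
  have nr: "(\<gamma> s)^2 + 1 \<notin> \<real>\<^sub>\<le>\<^sub>0" if "s \<ge> s1" for s
    using Re_pos_imp_square_plus_one[OF s1[OF that]] .
  have nz: "csqrt ((\<gamma> s)^2 + 1) \<noteq> 0" if "s \<ge> s1" for s using nr[OF that] by auto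
  \<comment> \<open>Two continuous square roots of the same nonvanishing function on a half line:
    their ratio takes only the values 1 and -1, hence is constant.\<close>
  let ?r = "\<lambda>s. q s / csqrt ((\<gamma> s)^2 + 1)"
  have r2: "?r s = 1 \<or> ?r s = - 1" if "s \<ge> s1" for s
  proof -
    have "(\<gamma> s)^2 + 1 \<noteq> 0" using nr[OF that] by auto
    then have "(?r s)^2 = 1" by (simp add: power_divide q(2))
    then show ?thesis by (simp add: power2_eq_1_iff)
  qed
  have "?r constant_on {s1..}"
  proof (rule continuous_finite_range_constant)
    show "continuous_on {s1..} ?r"
    proof (intro continuous_on_divide)
      show "continuous_on {s1..} (\<lambda>s. csqrt ((\<gamma> s)^2 + 1))"
      proof (rule continuous_on_compose2[where t="- \<real>\<^sub>\<le>\<^sub>0" and g=csqrt])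
        show "continuous_on (- \<real>\<^sub>\<le>\<^sub>0) csqrt" by (intro continuous_at_imp_continuous_on ballI continuous_at_csqrt) auto
        show "continuous_on {s1..} (\<lambda>s. (\<gamma> s)^2 + 1)" by (intro continuous_intros continuous_on_subset[OF c\<gamma>]) auto
      qed (use nr in auto)
    qed (use nz q(1) in \<open>auto intro: continuous_on_subset simp del: csqrt_eq_0\<close>)
    have "?r ` {s1..} \<subseteq> {1, - 1}" using r2 by (intro image_subsetI) (metis atLeast_iff insertI1 insertI2)
    then show "finite (?r ` {s1..})" by (rule finite_subset) auto
  qed auto
  then obtain \<sigma>' where r: "\<And>s. s \<ge> s1 \<Longrightarrow> ?r s = \<sigma>'" unfolding constant_on_def by auto
  then obtain \<sigma> :: real where \<sigma>: "\<sigma>' = of_real \<sigma>" "\<sigma> = 1 \<or> \<sigma> = - 1" using r2[of s1] by force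
  have qs: "q s = of_real \<sigma> * csqrt ((\<gamma> s)^2 + 1)" if "s \<ge> s1" for s
    using r[OF that] nz[OF that] \<sigma>(1) by (simp add: divide_eq_eq)
  have "\<exists>c. \<forall>s\<in>{s1..}. X s - of_real \<sigma> * xi_bar (\<gamma> s) = c"
  proof (rule has_vector_derivative_zero_constant)
    fix s assume s: "s \<in> {s1..}"
    have "((\<lambda>s. xi_bar (\<gamma> s)) has_vector_derivative \<gamma>' s * csqrt ((\<gamma> s)^2 + 1)) (at s)"
      using field_vector_diff_chain_at[OF \<gamma>'[of s] xi_bar_DERIV[OF nr]] s by (simp add: o_def)
    from has_vector_derivative_mult_right[OF this, of "of_real \<sigma>"]
    have "((\<lambda>s. X s - of_real \<sigma> * xi_bar (\<gamma> s)) has_vector_derivative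
       q s * vector_derivative \<gamma> (at s) - of_real \<sigma> * (\<gamma>' s * csqrt ((\<gamma> s)^2 + 1))) (at s)"
      by (intro has_vector_derivative_diff q(3))
    moreover have "vector_derivative \<gamma> (at s) = \<gamma>' s" using \<gamma>' by (rule vector_derivative_at)
    ultimately have "((\<lambda>s. X s - of_real \<sigma> * xi_bar (\<gamma> s)) has_vector_derivative 0) (at s)"
      using qs s by simp
    then show "((\<lambda>s. X s - of_real \<sigma> * xi_bar (\<gamma> s)) has_vector_derivative 0) (at s within {s1..})"
      by (rule has_vector_derivative_at_within)
  qed auto
  then obtain c where c: "\<And>s. s \<ge> s1 \<Longrightarrow> X s = of_real \<sigma> * xi_bar (\<gamma> s) + c" by (force simp: algebra_simps)
  have t: "\<forall>\<^sub>F s in at_top. \<sigma> * Im (X s) \<le> \<sigma> * Im c - ((cmod (\<gamma> s))^2 / 4 - cmod (\<gamma> s))"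
    using tends_to_inf_dir_cone[OF dirs(2) disjI2[OF refl], of 0] eventually_ge_at_top[of s1]
  proof eventually_elim
    case (elim s)
    then have "- 1 * Im (xi_bar (\<gamma> s)) \<ge> (cmod (\<gamma> s))^2 / 4 - cmod (\<gamma> s)" by (intro approx) auto
    moreover have "\<sigma> * Im (X s) = Im (xi_bar (\<gamma> s)) + \<sigma> * Im c" using c[of s] elim \<sigma>(2) by (auto simp: algebra_simps)
    ultimately show ?case by simp
  qed
  \<comment> \<open>With the opposite branch Im X would tend to plus infinity at the final end as
    well, against its monotonicity.\<close>
  have "\<sigma> \<noteq> - 1"
  proof
    assume "\<sigma> = - 1"
    obtain s where "\<sigma> * Im (X s) \<le> \<sigma> * Im c - ((cmod (\<gamma> s))^2 / 4 - cmod (\<gamma> s))" "s \<in> {0..}"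
       "Im (X 0) + Im (- c) < (cmod (\<gamma> s))^2 / 4 - cmod (\<gamma> s)"
      using infty[OF infs(2) t, of "{0..}" "Im (X 0) + Im (- c)"] by (auto simp: eventually_ge_at_top)
    moreover have "Im (X s) \<le> Im (X 0)" using anti \<open>s \<in> {0..}\<close> by (auto dest: antimonoD)
    ultimately show False using \<open>\<sigma> = - 1\<close> by simp
  qed
  then show "\<exists>c. \<forall>\<^sub>F s in at_top. Im (X s) \<le> c - ((cmod (\<gamma> s))^2 / 4 - cmod (\<gamma> s))"
    using t \<sigma>(2) by auto
qed

text \<open>The left side is the product rule for the transformed first derivative e1 r + g e r^5 /
  2. Its e1-terms cancel, and r^5 = (g^2 + 1) r^9 brings the e-terms to (1/2)(g^2 + 1) - (5/4) g^2 =
  (2 - 3 g^2)/4 times g' e r^9, which is where the numerator in \<open>psi_integral\<close> comes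
  from.\<close>

lemma liouville_transform_identity:
  fixes p r g g' e e1 e2 U c G :: complex
  assumes pr: "p * r = 1" and p4: "p^4 = g^2 + 1" and ode: "e2 + U * p^4 * e = c * p^4 * G"
  shows "(e1 * (- (g * g' * r^5 / 2)) + g' * e2 * r) +
      ((g * e) * (5 * r^4 * (- (g * g' * r^5 / 2))) + (g * (g' * e1) + g' * e) * r^5) / 2
     = p^2 * g' * (- (U * (p * e)) + c * p * G) + g' * (p * e) * (2 - 3 * g^2) * r^10 / 4"
proof -
  have r9: "r^4 * r^5 = r^9" by simp
  have "p^4 * r = p^3 * (p * r)" by (simp add: power4_eq_xxxx power3_eq_cube)
  then have p4r: "p^4 * r = p^3" using pr by simp
  have "p * r^10 = (p * r) * r^9" by (simp flip: power_Suc)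
  then have pr10: "p * r^10 = r^9" using pr by simp
  have "(p * r)^4 * r^5 = p^4 * (r^4 * r^5)" by (simp only: power_mult_distrib mult.assoc)
  then have "p^4 * r^9 = (p * r)^4 * r^5" by (simp only: r9)
  then have "(g^2 + 1) * r^9 = r^5" using pr p4 by simp
  then have r5: "r^5 = g^2 * r^9 + r^9" by (simp add: distrib_right)
  have "e2 * r = - (U * e * (p^4 * r)) + c * G * (p^4 * r)"
  proof -
    have "(e2 + U * p^4 * e) * r = (c * p^4 * G) * r" unfolding ode ..
    then show ?thesis by (simp add: algebra_simps)
  qed
  then have e2r: "e2 * r = - (U * e * p^3) + c * G * p^3" using p4r by simp
  have "(e1 * (- (g * g' * r^5 / 2)) + g' * e2 * r) +
      ((g * e) * (5 * r^4 * (- (g * g' * r^5 / 2))) + (g * (g' * e1) + g' * e) * r^5) / 2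
     = g' * (e2 * r) + g' * e * r^5 / 2 - 5 / 4 * g^2 * g' * e * r^9"
  proof -
    have "(e1 * (- (g * g' * b / 2)) + g' * e2 * r) +
        ((g * e) * (5 * a * (- (g * g' * b / 2))) + (g * (g' * e1) + g' * e) * b) / 2
      = g' * (e2 * r) + g' * e * b / 2 - 5 / 4 * g^2 * g' * e * (a * b)" for a b
      by (simp add: power2_eq_square field_simps)
    from this[of "r^5" "r^4", unfolded r9] show ?thesis .
  qed
  also have "\<dots> = g' * (e2 * r) + g' * e * (2 - 3 * g^2) * r^9 / 4"
  proof -
    have "Y + g' * e * (g^2 * d + d) / 2 - 5 / 4 * g^2 * g' * e * d = Y + g' * e * (2 - 3 * g^2) * d / 4" for Y d
      by (simp add: field_simps)
    from this[of _ "r^9", folded r5] show ?thesis .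
  qed
  also have "\<dots> = p^2 * g' * (- (U * (p * e)) + c * p * G) + g' * e * (2 - 3 * g^2) * (p * r^10) / 4"
    unfolding pr10 e2r by (simp add: algebra_simps power2_eq_square power3_eq_cube)
  finally show ?thesis by (simp add: mult_ac)
qed

text \<open>\<open>weber_WR03\<close> does not occur: the bound belongs to any solution of the error
  equation for which (z^2 + 1)^(1/4) \<open>eps\<close> stays bounded and \<open>eps1\<close> grows
  polynomially in sectors that contain both ends of every admissible path.\<close>

theorem admissible_path_error_bound:
  fixes eps eps1 eps2 :: "complex \<Rightarrow> complex" and \<gamma> :: "real \<Rightarrow> complex" and u \<rho> C :: real
  assumes u: "u > 0"
    and d1: "\<And>z. z^2 + 1 \<noteq> 0 \<Longrightarrow> (eps has_field_derivative eps1 z) (at z)"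
    and d2: "\<And>z. z^2 + 1 \<noteq> 0 \<Longrightarrow> (eps1 has_field_derivative eps2 z) (at z)"
    and ode: "\<And>z. z^2 + 1 \<noteq> 0 \<Longrightarrow>
       eps2 z + of_real (u^2) * (z^2 + 1) * eps z = (- 1)^(n + 1) / of_real (u^(2 * n)) * (z^2 + 1) * G_bar R n z"
    and growth: "\<And>z. cmod z \<ge> \<rho> \<Longrightarrow> Re z > 0 \<Longrightarrow> Re z \<le> 3/2 * \<bar>Im z\<bar> \<Longrightarrow> \<bar>Im z\<bar> \<le> 3/2 * Re z \<Longrightarrow>
       sqrt (cmod z) * cmod (eps z) \<le> C \<and> cmod (eps1 z) \<le> C * cmod z ^ N"
    and adm: "admissible_path \<gamma>" and z: "z \<in> range \<gamma>" and br: "brace u \<gamma> > 0"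
  shows "ennreal (cmod (eps z)) \<le> error_bound n R u z \<gamma>"
proof (cases "var_G n R \<gamma> = \<infinity>")
  case True
  have "ennreal (2 * cmod (z^2 + 1) powr (1/4)) < \<infinity>" by simp
  then have "var_G n R \<gamma> / ennreal (2 * cmod (z^2 + 1) powr (1/4)) = \<infinity>"
    unfolding True by (simp add: ennreal_top_divide)
  then have "ennreal (1 / u^(2 * n + 2)) *
       (ennreal (cmod (G_bar R n z)) + var_G n R \<gamma> / ennreal (2 * cmod (z^2 + 1) powr (1/4))) = \<infinity>"
    using u by (simp add: ennreal_mult_top)
  then show ?thesis by (simp add: error_bound_def)
next
  case False
  then obtain Var where Var: "var_G n R \<gamma> = ennreal Var" "Var \<ge> 0" by (cases "var_G n R \<gamma>") auto
  \<comment> \<open>Truncated subtraction gives 1 - infinity = 0, so a positive \<open>brace\<close>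
    excludes an infinite integral.\<close>
  have psi_fin: "psi_integral \<gamma> \<noteq> \<infinity>"
    using br u by (auto simp: brace_def ennreal_top_divide diff_eq_0_ennreal)
  then obtain Psi where Psi: "psi_integral \<gamma> = ennreal Psi" "Psi \<ge> 0" by (cases "psi_integral \<gamma>") auto
  have brace_eq: "brace u \<gamma> = ennreal (1 - Psi / (8 * u))"
    unfolding brace_def Psi(1) using u Psi(2) by (simp add: divide_ennreal ennreal_minus[symmetric] flip: ennreal_1)
  then have Psi_lt: "Psi / (8 * u) < 1" using br by (auto simp: ennreal_less_zero_iff)
  obtain \<gamma>' \<gamma>'' where \<gamma>': "\<And>s. (\<gamma> has_vector_derivative \<gamma>' s) (at s)" "\<And>s. (\<gamma>' has_vector_derivative \<gamma>'' s) (at s)"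
    using adm by (auto simp: admissible_path_def R2_path_def)
  have vd: "vector_derivative \<gamma> (at s) = \<gamma>' s" for s using \<gamma>'(1) by (rule vector_derivative_at)
  have cont_vd: "continuous_on UNIV f" if "\<And>s. (f has_vector_derivative f' s) (at s)" for f f' :: "real \<Rightarrow> complex"
    using that by (auto intro!: continuous_at_imp_continuous_on has_vector_derivative_continuous)
  have c\<gamma>: "continuous_on UNIV \<gamma>" "continuous_on UNIV \<gamma>'" by (rule cont_vd[OF \<gamma>'(1)], rule cont_vd[OF \<gamma>'(2)])
  obtain X where X: "xi_bar_along \<gamma> X" "mono (\<lambda>s. Im (X s)) \<or> antimono (\<lambda>s. Im (X s))"
    using adm by (auto simp: admissible_path_def)
  note ends = admissible_path_ends[OF adm X]
  obtain q where q: "continuous_on UNIV q" "\<And>s. (q s)^2 = (\<gamma> s)^2 + 1"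
    "\<And>s. (X has_vector_derivative q s * \<gamma>' s) (at s)"
    using X(1) unfolding xi_bar_along_def vd by auto
  have ne: "(\<gamma> s)^2 + 1 \<noteq> 0" for s
  proof
    assume "(\<gamma> s)^2 + 1 = 0"
    then have "(\<gamma> s - \<i>) * (\<gamma> s + \<i>) = 0" by (simp add: algebra_simps power2_eq_square)
    then have "\<gamma> s = \<i> \<or> \<gamma> s = - \<i>" by (metis eq_iff_diff_eq_0 add_eq_0_iff2 mult_eq_0_iff)
    then show False using adm unfolding admissible_path_def by (metis rangeI)
  qed
  have qnz: "q s \<noteq> 0" for s using q(2)[of s] ne[of s] by auto
  \<comment> \<open>A globally continuous fourth root of z^2 + 1 along the path: the nonvanishing
    \<open>q\<close> has a continuous square root since the real line is contractible. The path may
    cross the cuts of the principal root.\<close>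
  obtain p where p: "continuous_on UNIV p" "\<And>s. q s = (p s)^2"
    using continuous_sqrt_on_contractible[OF q(1)] qnz contractible_UNIV by (metis UNIV_I)
  have pnz: "p s \<noteq> 0" for s using p(2)[of s] qnz[of s] by auto
  have p4: "(p s)^4 = (\<gamma> s)^2 + 1" for s using p(2)[of s] q(2)[of s] by (simp flip: power_mult)
  define r where "r = (\<lambda>s. inverse (p s))"
  have pr: "p s * r s = 1" for s using pnz by (simp add: r_def)
  define p1 where "p1 = (\<lambda>s. \<gamma> s * \<gamma>' s * (r s)^3 / 2)"
  have dp: "(p has_vector_derivative p1 s) (at s)" for s
  proof -
    have "((\<lambda>s. (\<gamma> s)^2 + 1) has_vector_derivative \<gamma>' s * (2 * \<gamma> s)) (at s)"
    proof -
      have "((\<lambda>z. z^2 + 1) has_field_derivative 2 * \<gamma> s) (at (\<gamma> s))" by (auto intro!: derivative_eq_intros)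
      from field_vector_diff_chain_at[OF \<gamma>'(1)[of s] this] show ?thesis by (simp add: o_def)
    qed
    then have "(q has_vector_derivative \<gamma>' s * (2 * \<gamma> s) / (2 * q s)) (at s)"
      by (rule square_root_vector_derivative[OF q(1) q(2)]) (rule qnz)
    then have "(p has_vector_derivative \<gamma>' s * (2 * \<gamma> s) / (2 * q s) / (2 * p s)) (at s)"
      by (rule square_root_vector_derivative[OF p(1) p(2)[symmetric]]) (rule pnz)
    moreover have "\<gamma>' s * (2 * \<gamma> s) / (2 * q s) / (2 * p s) = p1 s"
      using pnz[of s] by (simp add: p1_def p(2) r_def power2_eq_square power3_eq_cube field_simps)
    ultimately show ?thesis by simp
  qed
  have dr: "(r has_vector_derivative - (\<gamma> s * \<gamma>' s * (r s)^5 / 2)) (at s)" for s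
  proof -
    have "(r has_vector_derivative p1 s * - (inverse (p s) ^ Suc (Suc 0))) (at s)"
      using field_vector_diff_chain_at[OF dp[of s] DERIV_inverse[OF pnz]] by (simp add: o_def r_def)
    moreover have "p1 s * - (inverse (p s) ^ Suc (Suc 0)) = - (\<gamma> s * \<gamma>' s * (r s)^5 / 2)"
      by (simp add: p1_def r_def flip: power_add power_Suc)
    ultimately show ?thesis by (simp only:)
  qed
  define c where "c = (- 1)^(n + 1) / complex_of_real (u^(2 * n))"
  have nc: "cmod c = 1 / u^(2 * n)" using u by (simp add: c_def norm_divide norm_power)
  let ?G = "G_bar R n"
  let ?U = "complex_of_real (u^2)"
  define e where "e = (\<lambda>s. eps (\<gamma> s))"
  define e1 where "e1 = (\<lambda>s. eps1 (\<gamma> s))"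
  define g where "g = (\<lambda>s. ?G (\<gamma> s))"
  have de: "(e has_vector_derivative \<gamma>' s * e1 s) (at s)" for s
    using field_vector_diff_chain_at[OF \<gamma>'(1)[of s] d1[OF ne]] by (simp add: o_def e_def e1_def)
  have de1: "(e1 has_vector_derivative \<gamma>' s * eps2 (\<gamma> s)) (at s)" for s
    using field_vector_diff_chain_at[OF \<gamma>'(1)[of s] d2[OF ne]] by (simp add: o_def e1_def)
  have G: "(?G has_field_derivative deriv ?G w) (at w)" if "w^2 + 1 \<noteq> 0" for w
    using G_bar_holomorphic[of R n] open_not_pm_i that by (auto intro: holomorphic_derivI)
  have dg: "(g has_vector_derivative \<gamma>' s * deriv ?G (\<gamma> s)) (at s)" for s
    using field_vector_diff_chain_at[OF \<gamma>'(1)[of s] G[OF ne]] by (simp add: o_def g_def)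
  \<comment> \<open>In the variable X, with dX = q \<gamma>' ds, \<open>T\<close> is dV/dX. The
    equation becomes d^2V/dX^2 + u^2 V = psi V + F with psi = (2 - 3 z^2) / (4 (z^2 + 1)^3), and
    \<open>P\<close> is psi V dX/ds.\<close>
  define V where "V = (\<lambda>s. p s * e s)"
  define T where "T = (\<lambda>s. e1 s * r s + (\<gamma> s * e s) * (r s)^5 / 2)"
  define F where "F = (\<lambda>s. c * (p s * g s))"
  define F1 where "F1 = (\<lambda>s. c * (p s * (\<gamma>' s * deriv ?G (\<gamma> s)) + p1 s * g s))"
  define P where "P = (\<lambda>s. \<gamma>' s * V s * (2 - 3 * (\<gamma> s)^2) * (r s)^10 / 4)"
  have dF: "(F has_vector_derivative F1 s) (at s)" for s
    unfolding F_def F1_def by (intro has_vector_derivative_mult_right has_vector_derivative_mult dp dg)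
  have dV: "(V has_vector_derivative q s * \<gamma>' s * T s) (at s)" for s
  proof -
    have "(V has_vector_derivative p s * (\<gamma>' s * e1 s) + p1 s * e s) (at s)"
      unfolding V_def by (intro has_vector_derivative_mult dp de)
    moreover have "q s * \<gamma>' s * T s = p s * (\<gamma>' s * e1 s) * (p s * r s) + \<gamma> s * \<gamma>' s * (r s)^3 / 2 * e s * (p s * r s)^2"
      by (simp add: T_def p(2) algebra_simps power2_eq_square eval_nat_numeral)
    ultimately show ?thesis by (simp add: pr p1_def)
  qed
  have dT: "(T has_vector_derivative q s * \<gamma>' s * (- (?U * V s) + F s) + P s) (at s)" for s
  proof -
    have "((\<lambda>s. (r s)^5) has_vector_derivative - (\<gamma> s * \<gamma>' s * (r s)^5 / 2) * (5 * (r s)^4)) (at s)"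
    proof -
      have "((\<lambda>z. z^5) has_field_derivative 5 * (r s)^4) (at (r s))" by (auto intro!: derivative_eq_intros)
      from field_vector_diff_chain_at[OF dr[of s] this] show ?thesis by (simp add: o_def)
    qed
    then have "((\<lambda>s. (r s)^5) has_vector_derivative 5 * (r s)^4 * - (\<gamma> s * \<gamma>' s * (r s)^5 / 2)) (at s)"
      by (simp add: mult.commute)
    then have "(T has_vector_derivative
       (e1 s * (- (\<gamma> s * \<gamma>' s * (r s)^5 / 2)) + \<gamma>' s * eps2 (\<gamma> s) * r s) +
       ((\<gamma> s * e s) * (5 * (r s)^4 * (- (\<gamma> s * \<gamma>' s * (r s)^5 / 2))) + (\<gamma> s * (\<gamma>' s * e1 s) + \<gamma>' s * e s) * (r s)^5) / 2) (at s)"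
      unfolding T_def
      by (intro has_vector_derivative_add has_vector_derivative_mult has_vector_derivative_divide de1 dr de \<gamma>'(1))
    moreover have "eps2 (\<gamma> s) + ?U * (p s)^4 * e s = c * (p s)^4 * g s"
      unfolding p4 e_def g_def c_def by (rule ode[OF ne])
    from liouville_transform_identity[OF pr p4 this, of "e1 s" "\<gamma>' s"]
    have "(e1 s * (- (\<gamma> s * \<gamma>' s * (r s)^5 / 2)) + \<gamma>' s * eps2 (\<gamma> s) * r s) +
       ((\<gamma> s * e s) * (5 * (r s)^4 * (- (\<gamma> s * \<gamma>' s * (r s)^5 / 2))) + (\<gamma> s * (\<gamma>' s * e1 s) + \<gamma>' s * e s) * (r s)^5) / 2
       = q s * \<gamma>' s * (- (?U * V s) + F s) + P s"
      unfolding p(2) V_def F_def P_def by (simp only: mult.assoc)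
    ultimately show ?thesis by simp
  qed
  \<comment> \<open>T + i u V and T - i u V with their exponentials are the usual coefficients of
    variation of parameters. The added terms F/(i u) carry out the integration by parts: in the
    derivatives \<open>F\<close> is replaced by \<open>F1\<close> / (i u).\<close>
  define A where "A = (\<lambda>s. exp (- (\<i> * u * X s)) * (T s + \<i> * u * V s + F s / (\<i> * u)))"
  define B where "B = (\<lambda>s. exp (\<i> * u * X s) * (T s - \<i> * u * V s - F s / (\<i> * u)))"
  have iu: "\<i> * complex_of_real u \<noteq> 0" using u by simp
  have iuV: "\<i> * u * (\<i> * u * w) = - (?U * w)" for w
  proof -
    have "\<i> * u * (\<i> * u * w) = (\<i> * \<i>) * (complex_of_real u * complex_of_real u) * w" by (simp only: mult_ac)
    then show ?thesis by (simp add: power2_eq_square)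
  qed
  have dA: "(A has_vector_derivative exp (- (\<i> * u * X s)) * (P s + F1 s / (\<i> * u))) (at s)" for s
  proof -
    have "((\<lambda>z. exp (- (\<i> * u * z))) has_field_derivative exp (- (\<i> * u * X s)) * - (\<i> * u)) (at (X s))"
      by (auto intro!: derivative_eq_intros)
    from field_vector_diff_chain_at[OF q(3)[of s] this]
    have dE: "((\<lambda>s. exp (- (\<i> * u * X s))) has_vector_derivative q s * \<gamma>' s * (exp (- (\<i> * u * X s)) * - (\<i> * u))) (at s)"
      by (simp add: o_def)
    have "(A has_vector_derivative exp (- (\<i> * u * X s)) *
          (q s * \<gamma>' s * (- (?U * V s) + F s) + P s + \<i> * u * (q s * \<gamma>' s * T s) + F1 s / (\<i> * u))
        + q s * \<gamma>' s * (exp (- (\<i> * u * X s)) * - (\<i> * u)) * (T s + \<i> * u * V s + F s / (\<i> * u))) (at s)"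
      unfolding A_def
      by (intro has_vector_derivative_mult has_vector_derivative_add has_vector_derivative_divide
          has_vector_derivative_mult_right dE dT dV dF)
    moreover have "E * (Q * (- (?U * V s) + F s) + P s + \<i> * u * (Q * T s) + F1 s / (\<i> * u))
        + Q * (E * - (\<i> * u)) * (T s + \<i> * u * V s + F s / (\<i> * u)) = E * (P s + F1 s / (\<i> * u))" for E Q
    proof -
      have "\<i> * u * (F s / (\<i> * u)) = F s" using iu by simp
      moreover note iuV[of "V s"]
      moreover have "Q * (E * - (\<i> * u)) * (T s + \<i> * u * V s + F s / (\<i> * u))
         = - (E * Q * (\<i> * u * T s + \<i> * u * (\<i> * u * V s) + \<i> * u * (F s / (\<i> * u))))"
        by (simp only: distrib_left mult_minus_left mult_minus_right minus_add_distrib mult_ac)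
      ultimately show ?thesis by (simp add: algebra_simps)
    qed
    ultimately show ?thesis by simp
  qed
  have dB: "(B has_vector_derivative exp (\<i> * u * X s) * (P s - F1 s / (\<i> * u))) (at s)" for s
  proof -
    have "((\<lambda>z. exp (\<i> * u * z)) has_field_derivative exp (\<i> * u * X s) * (\<i> * u)) (at (X s))"
      by (auto intro!: derivative_eq_intros)
    from field_vector_diff_chain_at[OF q(3)[of s] this]
    have dE: "((\<lambda>s. exp (\<i> * u * X s)) has_vector_derivative q s * \<gamma>' s * (exp (\<i> * u * X s) * (\<i> * u))) (at s)"
      by (simp add: o_def)
    have "(B has_vector_derivative exp (\<i> * u * X s) *
          (q s * \<gamma>' s * (- (?U * V s) + F s) + P s - \<i> * u * (q s * \<gamma>' s * T s) - F1 s / (\<i> * u))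
        + q s * \<gamma>' s * (exp (\<i> * u * X s) * (\<i> * u)) * (T s - \<i> * u * V s - F s / (\<i> * u))) (at s)"
      unfolding B_def
      by (intro has_vector_derivative_mult has_vector_derivative_diff has_vector_derivative_divide
          has_vector_derivative_mult_right dE dT dV dF)
    moreover have "E * (Q * (- (?U * V s) + F s) + P s - \<i> * u * (Q * T s) - F1 s / (\<i> * u))
        + Q * (E * (\<i> * u)) * (T s - \<i> * u * V s - F s / (\<i> * u)) = E * (P s - F1 s / (\<i> * u))" for E Q
    proof -
      have "\<i> * u * (F s / (\<i> * u)) = F s" using iu by simp
      moreover note iuV[of "V s"]
      moreover have "Q * (E * (\<i> * u)) * (T s - \<i> * u * V s - F s / (\<i> * u))
         = E * Q * (\<i> * u * T s - \<i> * u * (\<i> * u * V s) - \<i> * u * (F s / (\<i> * u)))"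
        by (simp only: right_diff_distrib mult_ac)
      ultimately show ?thesis by (simp add: algebra_simps)
    qed
    ultimately show ?thesis by simp
  qed
  have AB: "exp (\<i> * u * X s) * A s - exp (- (\<i> * u * X s)) * B s = 2 * \<i> * u * (V s - F s / u^2)" for s
  proof -
    have E: "exp (\<i> * u * X s) * exp (- (\<i> * u * X s)) = 1" by (simp flip: exp_add)
    have "exp (\<i> * u * X s) * A s - exp (- (\<i> * u * X s)) * B s =
      (exp (\<i> * u * X s) * exp (- (\<i> * u * X s))) * ((T s + \<i> * u * V s + F s / (\<i> * u)) - (T s - \<i> * u * V s - F s / (\<i> * u)))"
    proof -
      have "a1 * (b1 * x) - b1 * (a1 * y) = (a1 * b1) * (x - y)" for a1 b1 x y :: complex
        by (simp add: algebra_simps)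
      then show ?thesis unfolding A_def B_def .
    qed
    also have "\<dots> = 2 * \<i> * u * V s + 2 * (F s / (\<i> * u))" unfolding E by simp
    also have "F s / (\<i> * u) = - (\<i> * u * (F s / u^2))" using u by (simp add: field_simps power2_eq_square)
    finally show ?thesis by (simp add: algebra_simps)
  qed
  define W where "W = Var / u^(2 * n)"
  \<comment> \<open>The integrand of \<open>psi_integral\<close> is four times |psi dX/ds|.\<close>
  define K where "K = Psi / 4"
  define h where "h = (\<lambda>s. cmod ((2 - 3 * (\<gamma> s)^2) / ((\<gamma> s)^2 + 1) powr (5/2) * vector_derivative \<gamma> (at s)))"
  have h_eq: "h s = cmod (2 - 3 * (\<gamma> s)^2) / cmod ((\<gamma> s)^2 + 1) powr (5/2) * cmod (\<gamma>' s)" for s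
    using norm_powr_of_real[OF ne, of s "5/2"] by (simp add: h_def norm_mult norm_divide vd)
  have ch: "continuous_on UNIV h" unfolding h_eq using ne
    by (intro continuous_intros c\<gamma> continuous_on_powr') auto
  have hI: "integral {a..b} h \<le> Psi" for a b
    using ch Psi unfolding psi_integral_def h_def by (intro abs_path_integral_bound) auto
  have np: "cmod (p s) = cmod ((\<gamma> s)^2 + 1) powr (1/4)" for s
  proof -
    have "cmod ((\<gamma> s)^2 + 1) = cmod (p s) ^ 4" by (simp add: norm_power flip: p4)
    also have "\<dots> = cmod (p s) powr real 4" using pnz[of s] by (subst powr_realpow) auto
    finally have "cmod ((\<gamma> s)^2 + 1) powr (1/4) = cmod (p s) powr (real 4 * (1/4))" by (simp only: powr_powr)
    then show ?thesis using pnz[of s] by simp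
  qed
  have P_le: "cmod (P s) \<le> cmod (V s) * (h s / 4)" for s
  proof -
    have "cmod ((\<gamma> s)^2 + 1) powr (5/2) = cmod (p s) ^ 10"
      unfolding np using ne[of s] by (simp add: powr_power)
    moreover have "cmod (P s) = cmod (\<gamma>' s) * cmod (V s) * cmod (2 - 3 * (\<gamma> s)^2) * cmod (r s) ^ 10 / 4"
      unfolding P_def by (simp only: norm_mult norm_divide norm_power norm_numeral)
    moreover have "cmod (r s) ^ 10 = 1 / cmod (p s) ^ 10"
      by (simp add: r_def norm_divide power_divide inverse_eq_divide)
    ultimately show ?thesis unfolding h_eq by (simp add: mult_ac)
  qed
  have F1_eq: "cmod (F1 s) = cmod (deriv_root4 ?G (\<gamma> s) * vector_derivative \<gamma> (at s)) / u^(2 * n)" for s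
  proof -
    have "(r s)^3 * ((\<gamma> s)^2 + 1) = p s * ((p s * r s)^3)"
      unfolding p4[symmetric] by (simp add: power_mult_distrib power4_eq_xxxx power3_eq_cube mult_ac)
    then have "(r s)^3 = p s / ((\<gamma> s)^2 + 1)" using ne[of s] by (simp add: pr field_simps)
    then have "F1 s = c * (p s * (deriv ?G (\<gamma> s) + \<gamma> s / (2 * ((\<gamma> s)^2 + 1)) * g s)) * \<gamma>' s"
      by (simp add: F1_def p1_def algebra_simps)
    then have "cmod (F1 s) = cmod c * (cmod (p s) * cmod (deriv ?G (\<gamma> s) + \<gamma> s / (2 * ((\<gamma> s)^2 + 1)) * g s)) * cmod (\<gamma>' s)"
      by (simp only: norm_mult)
    then show ?thesis unfolding norm_mult vd norm_deriv_root4[OF G[OF ne] ne] nc np g_def by simp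
  qed
  have cF1: "continuous_on UNIV F1"
  proof -
    have "continuous_on {z. z^2 + 1 \<noteq> 0} (deriv ?G)"
      using G_bar_holomorphic[of R n] open_not_pm_i by (intro holomorphic_on_imp_continuous_on holomorphic_deriv)
    then have "continuous_on UNIV (\<lambda>s. deriv ?G (\<gamma> s))"
      by (rule continuous_on_compose2[OF _ c\<gamma>(1)]) (use ne in auto)
    moreover note cont_vd[OF dg] cont_vd[OF dr]
    ultimately show ?thesis unfolding F1_def p1_def by (intro continuous_intros c\<gamma> p(1)) auto
  qed
  have W: "integral {a..b} (\<lambda>s. cmod (F1 s)) \<le> W" for a b
  proof -
    let ?h = "\<lambda>s. cmod (deriv_root4 ?G (\<gamma> s) * vector_derivative \<gamma> (at s))"
    have eq: "?h = (\<lambda>s. u^(2 * n) * cmod (F1 s))" using u by (simp add: F1_eq fun_eq_iff)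
    have "integral {a..b} ?h \<le> Var"
    proof (rule abs_path_integral_bound)
      show "continuous_on UNIV ?h" unfolding eq by (intro continuous_intros cF1)
      show "abs_path_integral \<gamma> (deriv_root4 ?G) = ennreal Var" using Var(1) by (simp add: var_G_def)
    qed (use Var in auto)
    then have "u^(2 * n) * integral {a..b} (\<lambda>s. cmod (F1 s)) \<le> Var" unfolding eq by simp
    then show ?thesis using u by (simp add: W_def pos_le_divide_eq mult.commute)
  qed
  have cFn: "continuous_on UNIV (\<lambda>s. cmod (F1 s))" by (intro continuous_intros cF1)
  \<comment> \<open>A function of finite total variation is bounded; this keeps the supremum in
    \<open>L_const\<close> finite.\<close>
  have F_bd: "cmod (F s) \<le> cmod (F 0) + W" for s
  proof -
    have "cmod (F b - F a) \<le> W" if "a \<le> b" for a b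
      using norm_diff_le_integral[OF that dF cFn, of 1] W[of a b] by simp
    then have "cmod (F s - F 0) \<le> W" by (metis linear norm_minus_commute)
    then show ?thesis using norm_triangle_sub[of "F s" "F 0"] by linarith
  qed
  define SF where "SF = cmod (F 0) + W"
  have SF: "cmod (F s) \<le> SF" "SF \<ge> 0" for s using F_bd[of s] norm_ge_zero[of "F s"] F_bd unfolding SF_def by (simp, linarith)
  define C2 where "C2 = 2 * C + 2 * u * C + SF / u"
  have bounds: "cmod (V s) \<le> 2 * C \<and> cmod (T s) + u * cmod (V s) + cmod (F s) / u \<le> C2 * cmod (\<gamma> s) ^ (N + 1)"
    if "cmod (\<gamma> s) \<ge> max \<rho> 2" "Re (\<gamma> s) > 0" "Re (\<gamma> s) \<le> 3/2 * \<bar>Im (\<gamma> s)\<bar>" "\<bar>Im (\<gamma> s)\<bar> \<le> 3/2 * Re (\<gamma> s)" for s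
  proof -
    define m where "m = cmod (\<gamma> s)"
    have m: "m \<ge> 2" using that by (simp add: m_def)
    have gr: "sqrt m * cmod (e s) \<le> C" "cmod (e1 s) \<le> C * m ^ N"
      using growth[of "\<gamma> s"] that by (auto simp: m_def e_def e1_def)
    have C0: "C \<ge> 0" using gr(1) by (smt (verit) mult_nonneg_nonneg norm_ge_zero real_sqrt_ge_zero m)
    have p4n: "cmod (p s) ^ 4 = cmod ((\<gamma> s)^2 + 1)" by (simp add: norm_power flip: p4)
    have m2: "m^2 \<ge> 2 * 2" unfolding power2_eq_square using m by (intro mult_mono) auto
    have "m^2 \<le> cmod ((\<gamma> s)^2 + 1) + 1"
      using norm_triangle_sub[of "(\<gamma> s)^2" "(\<gamma> s)^2 + 1"] by (simp add: m_def norm_power)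
    then have "1 \<le> cmod (p s) ^ 4" using m2 p4n by linarith
    then have p_ge: "1 \<le> cmod (p s)" by (metis norm_ge_zero not_le power_less_one_iff zero_neq_numeral zero_less_numeral)
    then have r_le: "cmod (r s) \<le> 1" by (simp add: r_def norm_inverse inverse_le_1_iff)
    have "cmod ((\<gamma> s)^2 + 1) \<le> m^2 + 1"
      using norm_triangle_ineq[of "(\<gamma> s)^2" 1] by (simp add: m_def norm_power)
    also have "\<dots> \<le> 16 * m^2" using m2 by simp
    also have "\<dots> = (2 * sqrt m) ^ 4"
    proof -
      have "(sqrt m) ^ 4 = ((sqrt m)^2)^2" by (simp flip: power_mult)
      then show ?thesis using m by (simp add: power_mult_distrib)
    qed
    finally have q4: "cmod (p s) ^ 4 \<le> (2 * sqrt m) ^ 4" by (simp only: p4n)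
    have nn: "0 \<le> 2 * sqrt m" "0 < (4::nat)" using m by auto
    \<comment> \<open>The fourth root of z^2 + 1 is of size sqrt |z|, which is why the growth
      hypothesis weights \<open>eps\<close> by this factor.\<close>
    have p_le: "cmod (p s) \<le> 2 * sqrt m" by (rule iffD1[OF power_mono_iff[OF norm_ge_zero nn] q4])
    have V_le: "cmod (V s) \<le> 2 * C"
    proof -
      have "cmod (V s) \<le> (2 * sqrt m) * cmod (e s)" unfolding V_def norm_mult using p_le by (intro mult_right_mono) auto
      then show ?thesis using gr(1) by linarith
    qed
    have e_le: "cmod (e s) \<le> C"
    proof -
      have "1 * cmod (e s) \<le> sqrt m * cmod (e s)" using m by (intro mult_right_mono) auto
      then show ?thesis using gr(1) by linarith
    qed
    have mN: "m ^ N \<le> m ^ (N + 1)" "m \<le> m ^ (N + 1)" "1 \<le> m ^ (N + 1)"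
    proof -
      show "m ^ N \<le> m ^ (N + 1)" using m by (intro power_increasing) auto
      have "m ^ 1 \<le> m ^ (N + 1)" using m by (intro power_increasing) auto
      then show "m \<le> m ^ (N + 1)" by simp
      show "1 \<le> m ^ (N + 1)" using m by (intro one_le_power) auto
    qed
    have "cmod (T s) \<le> cmod (e1 s) * cmod (r s) + (m * cmod (e s)) * cmod (r s) ^ 5 / 2"
      unfolding T_def m_def
      by (rule order_trans[OF norm_triangle_ineq]) (simp add: norm_mult norm_divide norm_power)
    also have "\<dots> \<le> cmod (e1 s) * 1 + (m * cmod (e s)) * 1 / 2"
      using r_le m by (intro add_mono mult_mono divide_right_mono power_le_one) auto
    also have "\<dots> \<le> C * m ^ N + m * C"
    proof -
      have "m * cmod (e s) \<le> m * C" "m * cmod (e s) \<ge> 0" using e_le m by (auto intro: mult_left_mono)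
      then show ?thesis using gr(2) by linarith
    qed
    also have "\<dots> \<le> C * m ^ (N + 1) + m ^ (N + 1) * C"
      using mN C0 by (intro add_mono mult_left_mono mult_right_mono) auto
    finally have T_le: "cmod (T s) \<le> 2 * C * m ^ (N + 1)" by simp
    have "u * cmod (V s) \<le> u * (2 * C) * 1" using V_le u by simp
    also have "\<dots> \<le> u * (2 * C) * m ^ (N + 1)" using mN u C0 by (intro mult_left_mono) auto
    finally have uV: "u * cmod (V s) \<le> 2 * u * C * m ^ (N + 1)" by (simp add: mult_ac)
    have "cmod (F s) / u \<le> SF / u * 1" using SF u by (simp add: divide_right_mono)
    also have "\<dots> \<le> SF / u * m ^ (N + 1)" using mN u SF by (intro mult_left_mono) auto
    finally have "cmod (T s) + u * cmod (V s) + cmod (F s) / u \<le> C2 * m ^ (N + 1)"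
      using T_le uV by (simp add: C2_def distrib_right)
    then show ?thesis using V_le by (simp add: m_def)
  qed
  have dirs: "tends_to_inf_dir (1 * pi / 4) \<gamma> at_bot" "tends_to_inf_dir (- 1 * pi / 4) \<gamma> at_top"
    using adm by (auto simp: admissible_path_def)
  have ev: "\<forall>\<^sub>F s in at_bot. cmod (V s) \<le> 2 * C \<and> cmod (T s) + u * cmod (V s) + cmod (F s) / u \<le> C2 * cmod (\<gamma> s) ^ (N + 1)"
     "\<forall>\<^sub>F s in at_top. cmod (V s) \<le> 2 * C \<and> cmod (T s) + u * cmod (V s) + cmod (F s) / u \<le> C2 * cmod (\<gamma> s) ^ (N + 1)"
    by (rule eventually_mono[OF tends_to_inf_dir_cone[OF dirs(1) disjI1[OF refl], of "max \<rho> 2"]],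
        elim conjE, rule bounds, assumption+,
        rule eventually_mono[OF tends_to_inf_dir_cone[OF dirs(2) disjI2[OF refl], of "max \<rho> 2"]],
        elim conjE, rule bounds, assumption+)
  have lim_aux: "(f \<longlongrightarrow> 0) Fl" if "filterlim \<gamma> at_infinity Fl"
     and "\<forall>\<^sub>F s in Fl. cmod (f s) \<le> exp (a + u * cmod (\<gamma> s) - u * (cmod (\<gamma> s))^2 / 4) * (C2 * cmod (\<gamma> s) ^ (N + 1))"
    for f :: "real \<Rightarrow> complex" and Fl and a
  proof (rule Lim_null_comparison[OF that(2)])
    have "filterlim (\<lambda>s. cmod (\<gamma> s)) at_top Fl" using that(1) by (rule filterlim_at_infinity_imp_norm_at_top)
    from filterlim_compose[OF tendsto_mult_right_zero[OF tendsto_dir_bound[OF u, of a "N + 1"], of C2] this]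
    show "((\<lambda>s. exp (a + u * cmod (\<gamma> s) - u * (cmod (\<gamma> s))^2 / 4) * (C2 * cmod (\<gamma> s) ^ (N + 1))) \<longlongrightarrow> 0) Fl"
      by (simp add: mult_ac)
  qed
  have nY: "cmod (T s + \<i> * u * V s + F s / (\<i> * u)) \<le> cmod (T s) + u * cmod (V s) + cmod (F s) / u"
    "cmod (T s - \<i> * u * V s - F s / (\<i> * u)) \<le> cmod (T s) + u * cmod (V s) + cmod (F s) / u" for s
  proof -
    have n: "cmod (\<i> * u * V s) = u * cmod (V s)" "cmod (F s / (\<i> * u)) = cmod (F s) / u"
      using u by (simp_all add: norm_mult norm_divide)
    show "cmod (T s + \<i> * u * V s + F s / (\<i> * u)) \<le> cmod (T s) + u * cmod (V s) + cmod (F s) / u"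
      using norm_triangle_ineq[of "T s + \<i> * u * V s" "F s / (\<i> * u)"] norm_triangle_ineq[of "T s" "\<i> * u * V s"] n by linarith
    show "cmod (T s - \<i> * u * V s - F s / (\<i> * u)) \<le> cmod (T s) + u * cmod (V s) + cmod (F s) / u"
      using norm_triangle_ineq4[of "T s - \<i> * u * V s" "F s / (\<i> * u)"] norm_triangle_ineq4[of "T s" "\<i> * u * V s"] n by linarith
  qed
  have A0: "(A \<longlongrightarrow> 0) at_top"
  proof -
    obtain a where a: "\<forall>\<^sub>F s in at_top. Im (X s) \<le> a - ((cmod (\<gamma> s))^2 / 4 - cmod (\<gamma> s))" using ends(3) by blast
    show ?thesis
    proof (rule lim_aux)
      show "filterlim \<gamma> at_infinity at_top" using dirs by (simp add: tends_to_inf_dir_def)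
      show "\<forall>\<^sub>F s in at_top. cmod (A s) \<le> exp (u * a + u * cmod (\<gamma> s) - u * (cmod (\<gamma> s))^2 / 4) * (C2 * cmod (\<gamma> s) ^ (N + 1))"
        using a ev(2)
      proof eventually_elim
        case (elim s)
        have "u * Im (X s) \<le> u * (a - ((cmod (\<gamma> s))^2 / 4 - cmod (\<gamma> s)))" using elim u by (intro mult_left_mono) auto
        then have "exp (u * Im (X s)) \<le> exp (u * a + u * cmod (\<gamma> s) - u * (cmod (\<gamma> s))^2 / 4)" by (simp add: algebra_simps)
        moreover have "cmod (T s + \<i> * u * V s + F s / (\<i> * u)) \<le> C2 * cmod (\<gamma> s) ^ (N + 1)" using nY(1)[of s] elim by linarith
        moreover have "cmod (A s) = exp (u * Im (X s)) * cmod (T s + \<i> * u * V s + F s / (\<i> * u))" by (simp add: A_def norm_mult)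
        ultimately show ?case by (metis mult_mono exp_ge_zero norm_ge_zero)
      qed
    qed
  qed
  have B0: "(B \<longlongrightarrow> 0) at_bot"
  proof (rule lim_aux)
    show "filterlim \<gamma> at_infinity at_bot" using dirs by (simp add: tends_to_inf_dir_def)
    show "\<forall>\<^sub>F s in at_bot. cmod (B s) \<le> exp (0 + u * cmod (\<gamma> s) - u * (cmod (\<gamma> s))^2 / 4) * (C2 * cmod (\<gamma> s) ^ (N + 1))"
      using ends(2) ev(1)
    proof eventually_elim
      case (elim s)
      have "u * Im (X s) \<ge> u * ((cmod (\<gamma> s))^2 / 4 - cmod (\<gamma> s))" using elim u by (intro mult_left_mono) auto
      then have "exp (- (u * Im (X s))) \<le> exp (0 + u * cmod (\<gamma> s) - u * (cmod (\<gamma> s))^2 / 4)" by (simp add: algebra_simps)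
      moreover have "cmod (T s - \<i> * u * V s - F s / (\<i> * u)) \<le> C2 * cmod (\<gamma> s) ^ (N + 1)" using nY(2)[of s] elim by linarith
      moreover have "cmod (B s) = exp (- (u * Im (X s))) * cmod (T s - \<i> * u * V s - F s / (\<i> * u))" by (simp add: B_def norm_mult)
      ultimately show ?case by (metis mult_mono exp_ge_zero norm_ge_zero)
    qed
  qed
  have "\<exists>M0. \<forall>s. cmod (V s) \<le> M0"
  proof -
    obtain sa where sa: "\<And>s. s \<le> sa \<Longrightarrow> cmod (V s) \<le> 2 * C" using ev(1) by (auto simp: eventually_at_bot_linorder)
    obtain sb where sb: "\<And>s. s \<ge> sb \<Longrightarrow> cmod (V s) \<le> 2 * C" using ev(2) by (auto simp: eventually_at_top_linorder)
    have "continuous_on {sa..sb} V" using cont_vd[OF dV] by (rule continuous_on_subset) auto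
    then have "bounded (V ` {sa..sb})" by (intro compact_imp_bounded compact_continuous_image) auto
    then obtain M1 where "\<forall>s\<in>{sa..sb}. cmod (V s) \<le> M1" by (auto simp: bounded_iff)
    then have M1: "cmod (V s) \<le> M1" if "s \<in> {sa..sb}" for s using that by blast
    have "cmod (V s) \<le> max (2 * C) M1" for s
      using sa[of s] sb[of s] M1[of s] by (cases "s \<le> sa"; cases "s \<ge> sb") auto
    then show ?thesis by blast
  qed
  then obtain M0 where M0: "\<And>s. cmod (V s) \<le> M0" by blast
  have step: "cmod (V s - F s / u^2) \<le> (M * K + W / u) / (2 * u)" if "\<And>s. cmod (V s) \<le> M" for M s
  proof (rule variation_of_parameters_bound[OF u dA dB AB ends(1) A0 B0 P_le])
    show "integral {a..b} (\<lambda>s. h s / 4) \<le> K" for a b using hI[of a b] by (simp add: K_def)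
    show "continuous_on UNIV (\<lambda>s. h s / 4)" by (intro continuous_intros ch) auto
  qed (use W that cF1 in \<open>auto simp: h_eq\<close>)
  define g4 where "g4 = (\<lambda>t. cmod ((t^2 + 1) powr (1/4) * ?G t))"
  \<comment> \<open>The branch and the constant of modulus u^(-2n) in \<open>F\<close> disappear in
    modulus, so the supremum over the range of the path controls \<open>F\<close> up to this
    power.\<close>
  have g4: "g4 (\<gamma> s) = u^(2 * n) * cmod (F s)" for s
    using u norm_powr_of_real[OF ne, of s "1/4"] by (simp add: g4_def F_def norm_mult nc np g_def)
  define Sg where "Sg = (SUP t\<in>range \<gamma>. ennreal (g4 t))"
  have "Sg \<le> ennreal (u^(2 * n) * SF)" unfolding Sg_def
    using SF u by (intro SUP_least) (auto simp: g4 intro!: ennreal_leI mult_left_mono)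
  then have "Sg \<noteq> \<infinity>" by (auto simp: top_unique)
  then obtain S where S: "Sg = ennreal S" "S \<ge> 0" by (cases Sg) auto
  have gS: "cmod (F s) \<le> S / u^(2 * n)" for s
  proof -
    have "ennreal (g4 (\<gamma> s)) \<le> ennreal S" unfolding S(1)[symmetric] Sg_def by (intro SUP_upper) auto
    then show ?thesis using S(2) u by (simp add: g4 pos_le_divide_eq mult.commute)
  qed
  have K: "K \<ge> 0" "K < 2 * u" using Psi Psi_lt u by (auto simp: K_def field_simps)
  obtain s where s: "z = \<gamma> s" using z by auto
  have fin: "cmod (V s) \<le> cmod (F s) / u^2 + W / (2 * u^2) + K / (2 * u) * (((S / u^(2 * n) + W / 2) / u^2) / (1 - K / (2 * u)))"
    by (rule self_bound[OF u K M0 gS step])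
  define a where "a = cmod (z^2 + 1) powr (1/4)"
  have a: "a > 0" using ne[of s] by (simp add: a_def s)
  have "cmod (V s) = a * cmod (eps z)" by (simp add: V_def norm_mult np a_def s e_def)
  moreover have "cmod (F s) = a * cmod (?G z) / u^(2 * n)" by (simp add: F_def norm_mult nc np a_def s g_def)
  ultimately have "a * cmod (eps z) \<le> a * ((1 / u^(2 * n + 2)) * (cmod (?G z) + Var / (2 * a))
      + (S + Var / 2) / (8 * u^(2 * n + 3) * a) * inverse (1 - Psi / (8 * u)) * Psi)"
  proof -
    assume 1: "cmod (V s) = a * cmod (eps z)" and 2: "cmod (F s) = a * cmod (?G z) / u^(2 * n)"
    have u3: "u^(2 * n + 2) = u^(2 * n) * u^2" "u^(2 * n + 3) = u^(2 * n) * u^2 * u"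
      by (simp_all add: power_add power2_eq_square power3_eq_cube)
    have D: "1 - K / (2 * u) = 1 - Psi / (8 * u)" by (simp add: K_def)
    define d where "d = inverse (1 - Psi / (8 * u))"
    define v where "v = u^(2 * n)"
    have v: "v > 0" using u by (simp add: v_def)
    have "a * ((1 / u^(2 * n + 2)) * (cmod (?G z) + Var / (2 * a))
      + (S + Var / 2) / (8 * u^(2 * n + 3) * a) * d * Psi)
     = a * cmod (?G z) / v / u^2 + Var / v / (2 * u^2) + Psi / 4 / (2 * u) * (((S / v + Var / v / 2) / u^2) * d)"
      unfolding u3 v_def[symmetric] using a u v by (simp add: field_simps power2_eq_square)
    then show ?thesis using fin unfolding 1 2 D W_def v_def[symmetric] d_def[symmetric] divide_inverse[of _ "1 - Psi / (8 * u)"]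
      by (simp add: K_def v_def)
  qed
  then have main: "cmod (eps z) \<le> (1 / u^(2 * n + 2)) * (cmod (?G z) + Var / (2 * a))
      + (S + Var / 2) / (8 * u^(2 * n + 3) * a) * inverse (1 - Psi / (8 * u)) * Psi"
    using a by (simp only: mult_le_cancel_left_pos)
  have "error_bound n R u z \<gamma> = ennreal ((1 / u^(2 * n + 2)) * (cmod (?G z) + Var / (2 * a))
      + (S + Var / 2) / (8 * u^(2 * n + 3) * a) * inverse (1 - Psi / (8 * u)) * Psi)"
  proof -
    have L: "L_const n R \<gamma> = ennreal (S + Var / 2)"
    proof -
      have 1: "(SUP t\<in>range \<gamma>. ennreal (cmod ((t^2 + 1) powr (1/4) * ?G t))) = Sg" by (simp only: Sg_def g4_def)
      have 2: "var_G n R \<gamma> / 2 = ennreal (Var / 2)" using divide_ennreal[OF Var(2), of 2] Var(1) by simp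
      show ?thesis unfolding L_const_def 1 2 S(1) using S(2) Var(2) by (simp add: ennreal_plus[symmetric] del: ennreal_plus)
    qed
    have 1: "var_G n R \<gamma> / ennreal (2 * a) = ennreal (Var / (2 * a))" using a Var by (simp add: divide_ennreal)
    have 2: "inverse (brace u \<gamma>) = ennreal (inverse (1 - Psi / (8 * u)))" using Psi_lt by (simp add: brace_eq inverse_ennreal)
    have 3: "L_const n R \<gamma> / ennreal (8 * u^(2 * n + 3) * a) = ennreal ((S + Var / 2) / (8 * u^(2 * n + 3) * a))"
      unfolding L using a u S Var by (intro divide_ennreal) auto
    have nn: "inverse (1 - Psi / (8 * u)) \<ge> 0" "(S + Var / 2) / (8 * u^(2 * n + 3) * a) \<ge> 0" "Var / (2 * a) \<ge> 0"
      using Psi_lt S Var a u by auto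
    have gen: "ennreal x * (ennreal g + ennreal v) + ennreal l * ennreal i * ennreal P = ennreal (x * (g + v) + l * i * P)"
      if "x \<ge> 0" "g \<ge> 0" "v \<ge> 0" "l \<ge> 0" "i \<ge> 0" "P \<ge> 0" for x g v l i P
      using that by (simp add: ennreal_mult ennreal_plus)
    show ?thesis
      unfolding error_bound_def a_def[symmetric] 1 2 3 Psi(1) by (rule gen) (use nn Psi(2) u in auto)
  qed
  then show ?thesis using main by (simp add: ennreal_leI)
qed

section \<open>Growth of the remainder at the ends of the path\<close>

text \<open>The radius is at least 2 so that z^2 + 1 is nonzero and comparable with z^2. The
  exponent is real because negative and half-integral powers occur.\<close>

definition power_growth :: "(complex \<Rightarrow> complex) \<Rightarrow> real \<Rightarrow> bool" where
  "power_growth f d \<longleftrightarrow> (\<exists>C \<rho>. \<rho> \<ge> 2 \<and> (\<forall>z. cmod z \<ge> \<rho> \<longrightarrow> cmod (f z) \<le> C * cmod z powr d))"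

lemma norm_square_plus_one_ge:
  assumes "cmod z \<ge> 2"
  shows "cmod (z^2 + 1) \<ge> (cmod z)^2 / 2" "z^2 + 1 \<noteq> 0"
proof -
  have 4: "(cmod z)^2 \<ge> 2^2" using assms by (intro power_mono) auto
  have "(cmod z)^2 \<le> cmod (z^2 + 1) + 1"
    using norm_triangle_sub[of "z^2" "z^2 + 1"] by (simp add: norm_power)
  then show 1: "cmod (z^2 + 1) \<ge> (cmod z)^2 / 2" using 4 by simp
  show "z^2 + 1 \<noteq> 0" using 1 4 by auto
qed

lemma power_growth_mono:
  assumes "power_growth f d" "d \<le> d'"
  shows "power_growth f d'"
proof -
  obtain C \<rho> where C: "\<rho> \<ge> 2" "\<And>z. cmod z \<ge> \<rho> \<Longrightarrow> cmod (f z) \<le> C * cmod z powr d"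
    using assms by (auto simp: power_growth_def)
  have "cmod (f z) \<le> \<bar>C\<bar> * cmod z powr d'" if z: "cmod z \<ge> \<rho>" for z
  proof -
    have "cmod (f z) \<le> C * cmod z powr d" by (rule C(2)[OF z])
    also have "\<dots> \<le> \<bar>C\<bar> * cmod z powr d'"
      using z C(1) assms(2) by (intro mult_mono powr_mono) auto
    finally show ?thesis .
  qed
  then show ?thesis using C(1) by (auto simp: power_growth_def)
qed

lemma power_growth_add:
  assumes "power_growth f d" "power_growth g d"
  shows "power_growth (\<lambda>z. f z + g z) d"
proof -
  obtain C \<rho> where C: "\<rho> \<ge> 2" "\<And>z. cmod z \<ge> \<rho> \<Longrightarrow> cmod (f z) \<le> C * cmod z powr d"
    using assms by (auto simp: power_growth_def)
  obtain C' \<rho>' where C': "\<rho>' \<ge> 2" "\<And>z. cmod z \<ge> \<rho>' \<Longrightarrow> cmod (g z) \<le> C' * cmod z powr d"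
    using assms by (auto simp: power_growth_def)
  have "cmod (f z + g z) \<le> (C + C') * cmod z powr d" if "cmod z \<ge> max \<rho> \<rho>'" for z
  proof -
    have "cmod (f z + g z) \<le> cmod (f z) + cmod (g z)" by (rule norm_triangle_ineq)
    then show ?thesis using C(2)[of z] C'(2)[of z] that by (simp add: distrib_right)
  qed
  then show ?thesis unfolding power_growth_def using C(1)
    by - (rule exI[of _ "C + C'"], rule exI[of _ "max \<rho> \<rho>'"], auto)
qed

lemma power_growth_cmult:
  assumes "power_growth f d"
  shows "power_growth (\<lambda>z. c * f z) d"
proof -
  obtain C \<rho> where C: "\<rho> \<ge> 2" "\<And>z. cmod z \<ge> \<rho> \<Longrightarrow> cmod (f z) \<le> C * cmod z powr d"
    using assms by (auto simp: power_growth_def)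
  have "cmod (c * f z) \<le> cmod c * C * cmod z powr d" if "cmod z \<ge> \<rho>" for z
    using mult_left_mono[OF C(2)[OF that], of "cmod c"] by (simp add: norm_mult mult.assoc)
  then show ?thesis using C(1) by (auto simp: power_growth_def)
qed

lemma power_growth_sum:
  assumes "finite I" "\<And>i. i \<in> I \<Longrightarrow> power_growth (f i) d"
  shows "power_growth (\<lambda>z. \<Sum>i\<in>I. f i z) d"
  using assms
proof (induction I rule: finite_induct)
  case empty
  show ?case by (auto simp: power_growth_def intro!: exI[of _ 0] exI[of _ 2])
next
  case (insert i I)
  then show ?case using power_growth_add[of "f i" d "\<lambda>z. \<Sum>i\<in>I. f i z"] by simp
qed

text \<open>Cauchy's inequality on the disc of radius |z|/2, where all moduli lie between |z|/2 and
  2|z|, gains a full power of |z|. This gain makes successive \<open>G_bar\<close> decay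
  faster.\<close>

lemma power_growth_deriv:
  assumes f: "f holomorphic_on {z. z^2 + 1 \<noteq> 0}" and g: "power_growth f d"
  shows "power_growth (deriv f) (d - 1)"
proof -
  obtain C \<rho> where C: "\<rho> \<ge> 2" "\<And>z. cmod z \<ge> \<rho> \<Longrightarrow> cmod (f z) \<le> C * cmod z powr d"
    using g by (auto simp: power_growth_def)
  define C' where "C' = 2 * \<bar>C\<bar> * 2 powr \<bar>d\<bar>"
  have "cmod (deriv f z) \<le> C' * cmod z powr (d - 1)" if z: "cmod z \<ge> 2 * \<rho>" for z
  proof -
    define m where "m = cmod z"
    have m: "m > 0" "m / 2 \<ge> \<rho>" using z C(1) by (auto simp: m_def)
    have pt: "m / 2 \<le> cmod x" "cmod x \<le> 2 * m" if "x \<in> cball z (m / 2)" for x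
    proof -
      have d: "cmod (z - x) \<le> m / 2" using that by (simp add: dist_norm)
      show "m / 2 \<le> cmod x" using d norm_triangle_sub[of z x] by (simp add: m_def)
      show "cmod x \<le> 2 * m" using d norm_triangle_sub[of x z] norm_ge_zero[of z]
        unfolding m_def norm_minus_commute[of x z] by linarith
    qed
    have sub: "cball z (m / 2) \<subseteq> {z. z^2 + 1 \<noteq> 0}"
    proof
      fix x assume "x \<in> cball z (m / 2)"
      from pt(1)[OF this] have "cmod x \<ge> 2" using m C(1) by linarith
      then show "x \<in> {z. z^2 + 1 \<noteq> 0}" using norm_square_plus_one_ge(2) by simp
    qed
    have hol: "f holomorphic_on cball z (m / 2)" using f sub by (rule holomorphic_on_subset)
    have "cmod ((deriv ^^ 1) f z) \<le> fact 1 * (\<bar>C\<bar> * (2 powr \<bar>d\<bar> * m powr d)) / (m / 2) ^ 1"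
    proof (rule Cauchy_inequality)
      show "f holomorphic_on ball z (m / 2)" using hol by (rule holomorphic_on_subset) auto
      show "continuous_on (cball z (m / 2)) f" using hol by (rule holomorphic_on_imp_continuous_on)
      fix x assume "cmod (z - x) = m / 2"
      then have x: "x \<in> cball z (m / 2)" by (simp add: dist_norm)
      note p = pt[OF x]
      have "cmod x powr d \<le> 2 powr \<bar>d\<bar> * m powr d"
      proof (cases "d \<ge> 0")
        case True
        then have "cmod x powr d \<le> (2 * m) powr d" using p m by (intro powr_mono2) auto
        then show ?thesis using True m by (simp add: powr_mult)
      next
        case False
        then have "cmod x powr d \<le> (m / 2) powr d" using p m by (intro powr_mono2') auto
        also have "\<dots> = 2 powr \<bar>d\<bar> * m powr d"
          using False m by (simp add: powr_divide powr_minus_divide abs_if)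
        finally show ?thesis .
      qed
      moreover have "cmod (f x) \<le> C * cmod x powr d" using C(2) p m by auto
      moreover have "C * cmod x powr d \<le> \<bar>C\<bar> * cmod x powr d" by (intro mult_right_mono) auto
      ultimately show "cmod (f x) \<le> \<bar>C\<bar> * (2 powr \<bar>d\<bar> * m powr d)"
        by (meson abs_ge_zero mult_left_mono order_trans)
    qed (use m in auto)
    also have "\<dots> = C' * m powr (d - 1)" using m by (simp add: C'_def powr_diff field_simps)
    finally show ?thesis by (simp add: m_def)
  qed
  then show ?thesis unfolding power_growth_def using C(1) by (intro exI[of _ C'] exI[of _ "2 * \<rho>"]) auto
qed

lemma power_growth_times_square:
  assumes "power_growth f d"
  shows "power_growth (\<lambda>z. (z^2 + 1) * f z) (d + 2)"
proof -
  obtain C \<rho> where C: "\<rho> \<ge> 2" "\<And>z. cmod z \<ge> \<rho> \<Longrightarrow> cmod (f z) \<le> C * cmod z powr d"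
    using assms by (auto simp: power_growth_def)
  have "cmod ((z^2 + 1) * f z) \<le> 2 * C * cmod z powr (d + 2)" if z: "cmod z \<ge> \<rho>" for z
  proof -
    have "1 \<le> (cmod z)^2" using z C(1) by simp
    then have "cmod (z^2 + 1) \<le> 2 * (cmod z)^2"
      using norm_triangle_ineq[of "z^2" 1] by (simp add: norm_power)
    then have "cmod ((z^2 + 1) * f z) \<le> (2 * (cmod z)^2) * (C * cmod z powr d)"
      unfolding norm_mult using C(2)[OF z] by (intro mult_mono) auto
    also have "\<dots> = 2 * C * cmod z powr (d + 2)"
      using z C(1) by (simp add: powr_add)
    finally show ?thesis .
  qed
  then show ?thesis using C(1) by (auto simp: power_growth_def)
qed

lemma power_growth_divide_square:
  assumes "power_growth f d"
  shows "power_growth (\<lambda>z. f z / (z^2 + 1)) (d - 2)"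
proof -
  obtain C \<rho> where C: "\<rho> \<ge> 2" "\<And>z. cmod z \<ge> \<rho> \<Longrightarrow> cmod (f z) \<le> C * cmod z powr d"
    using assms by (auto simp: power_growth_def)
  have "cmod (f z / (z^2 + 1)) \<le> 2 * C * cmod z powr (d - 2)" if z: "cmod z \<ge> \<rho>" for z
  proof -
    have "cmod z \<ge> 2" using z C(1) by linarith
    note s = norm_square_plus_one_ge[OF this]
    have z0: "(cmod z)^2 > 0" using \<open>cmod z \<ge> 2\<close> by auto
    have "cmod (f z / (z^2 + 1)) \<le> (C * cmod z powr d) / ((cmod z)^2 / 2)"
      unfolding norm_divide using C(2)[OF z] s z0 by (intro frac_le) (auto intro: order_trans[OF norm_ge_zero])
    also have "\<dots> = 2 * C * cmod z powr (d - 2)"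
      using z0 by (simp add: powr_diff)
    finally show ?thesis .
  qed
  then show ?thesis using C(1) by (auto simp: power_growth_def)
qed

text \<open>Each step of the recursion lowers the exponent by 4: two for the derivatives, two for
  the division by z^2 + 1.\<close>

lemma G_bar_growth: "power_growth (G_bar R s) (real R - 2 - 4 * real s)"
proof (induction s)
  case 0
  have "power_growth (\<lambda>z. - (z^R)) (real R)"
    unfolding power_growth_def
    by (rule exI[of _ 1], rule exI[of _ 2]) (auto simp: norm_power intro!: powr_realpow[symmetric, THEN eq_refl])
  from power_growth_divide_square[OF this] show ?case by simp
next
  case (Suc s)
  have h: "deriv (G_bar R s) holomorphic_on {z. z^2 + 1 \<noteq> 0}"
    using G_bar_holomorphic open_not_pm_i by (intro holomorphic_deriv)
  from power_growth_divide_square[OF power_growth_deriv[OF h power_growth_deriv[OF G_bar_holomorphic Suc]]]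
  show ?case by (simp add: algebra_simps)
qed

section \<open>Primitives that vanish at infinity along a ray\<close>

lemma norm_diff_le_exp:
  fixes f :: "real \<Rightarrow> complex"
  assumes "a \<le> b" "\<And>s. a \<le> s \<Longrightarrow> s \<le> b \<Longrightarrow> (f has_vector_derivative f' s) (at s)"
    and "\<And>s. a \<le> s \<Longrightarrow> s \<le> b \<Longrightarrow> cmod (f' s) \<le> B * exp (- s)"
  shows "cmod (f b - f a) \<le> B * exp (- a) - B * exp (- b)"
proof (cases "a = b")
  case False
  have "norm (f b - f a) \<le> (\<lambda>s. - (B * exp (- s))) b - (\<lambda>s. - (B * exp (- s))) a"
  proof (rule differentiable_bound_general[where f'=f' and \<phi>'="\<lambda>s. B * exp (- s)"])
    show "a < b" using assms False by simp
    show "continuous_on {a..b} f"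
      by (intro continuous_at_imp_continuous_on ballI has_vector_derivative_continuous[OF assms(2)]) auto
    show "continuous_on {a..b} (\<lambda>s. - (B * exp (- s)))" by (intro continuous_intros)
    fix x assume x: "a < x" "x < b"
    show "(f has_vector_derivative f' x) (at x)" using assms(2) x by simp
    show "((\<lambda>s. - (B * exp (- s))) has_vector_derivative B * exp (- x)) (at x)"
      unfolding has_real_derivative_iff_has_vector_derivative[symmetric] by (auto intro!: derivative_eq_intros)
    show "norm (f' x) \<le> B * exp (- x)" using assms(3) x by simp
  qed
  then show ?thesis by simp
qed simp

text \<open>A primitive on the whole plane is Cauchy along the ray by the exponential bound;
  subtracting its limit normalizes it. Convergence is obtained along the integers and extended to
  all radii by the tail estimate.\<close>

lemma primitive_from_infinity:
  fixes f :: "complex \<Rightarrow> complex"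
  assumes f: "f holomorphic_on UNIV"
    and bd: "\<And>r. r \<ge> 0 \<Longrightarrow> cmod (f (of_real r * cis \<theta>)) \<le> B * exp (- r)"
  shows "\<exists>J. (\<forall>z. (J has_field_derivative f z) (at z)) \<and> ((\<lambda>r. J (of_real r * cis \<theta>)) \<longlongrightarrow> 0) at_top"
proof -
  obtain g where g: "\<And>z. (g has_field_derivative f z) (at z)"
    using holomorphic_convex_primitive'[of UNIV f] f by auto
  define p where "p = (\<lambda>r. g (of_real r * cis \<theta>))"
  have dp: "(p has_vector_derivative cis \<theta> * f (of_real r * cis \<theta>)) (at r)" for r
  proof -
    have "((\<lambda>r. of_real r * cis \<theta>) has_vector_derivative 1 * cis \<theta>) (at r)"
      by (auto intro!: derivative_eq_intros)
    from field_vector_diff_chain_at[OF this g] show ?thesis by (simp add: p_def o_def)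
  qed
  have B: "B \<ge> 0" using order_trans[OF norm_ge_zero bd[of 0]] by simp
  have diff: "cmod (p b - p a) \<le> B * exp (- a)" if "0 \<le> a" "a \<le> b" for a b
  proof -
    have "cmod (p b - p a) \<le> B * exp (- a) - B * exp (- b)"
      using that bd by (intro norm_diff_le_exp[OF _ dp]) (auto simp: norm_mult)
    moreover have "B * exp (- b) \<ge> 0" using B by simp
    ultimately show ?thesis by linarith
  qed
  have to0: "((\<lambda>r. B * exp (- r)) \<longlongrightarrow> 0) at_top"
    by (intro tendsto_mult_right_zero filterlim_compose[OF exp_at_bot] filterlim_uminus_at_bot_at_top)
  have "Cauchy (\<lambda>n. p (real n))"
  proof (rule CauchyI')
    fix e :: real assume "e > 0"
    then have "\<forall>\<^sub>F r in at_top. B * exp (- r) < e" using to0 by (rule order_tendstoD(2)[rotated])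
    then obtain M where M: "\<And>r. r \<ge> M \<Longrightarrow> B * exp (- r) < e" by (auto simp: eventually_at_top_linorder)
    show "\<exists>M. \<forall>m\<ge>M. \<forall>n>m. dist (p (real m)) (p (real n)) < e"
    proof (intro exI allI impI)
      fix m n assume "m \<ge> nat \<lceil>M\<rceil>" "n > m"
      then have "real m \<ge> M" by linarith
      then show "dist (p (real m)) (p (real n)) < e"
        using diff[of "real m" "real n"] M[of "real m"] \<open>n > m\<close> by (simp add: dist_norm norm_minus_commute)
    qed
  qed
  then obtain l where l: "(\<lambda>n. p (real n)) \<longlonglongrightarrow> l" by (auto simp: Cauchy_convergent_iff convergent_def)
  have pl: "cmod (p r - l) \<le> B * exp (- r)" if "r \<ge> 0" for r
  proof (rule tendsto_upperbound)
    show "(\<lambda>n. cmod (p r - p (real n))) \<longlonglongrightarrow> cmod (p r - l)" by (intro tendsto_intros l)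
    have "\<forall>\<^sub>F n in sequentially. real n \<ge> r"
      using eventually_ge_at_top[of "nat \<lceil>r\<rceil>"] by eventually_elim linarith
    then show "\<forall>\<^sub>F n in sequentially. cmod (p r - p (real n)) \<le> B * exp (- r)"
      by eventually_elim (use diff that in \<open>simp add: norm_minus_commute\<close>)
  qed auto
  have "((\<lambda>r. p r - l) \<longlongrightarrow> 0) at_top"
    by (rule Lim_null_comparison[OF _ to0]) (rule eventually_mono[OF eventually_ge_at_top[of 0] pl])
  moreover have "((\<lambda>z. g z - l) has_field_derivative f z) (at z)" for z
    using g[of z] by (auto intro!: derivative_eq_intros)
  ultimately show ?thesis by (intro exI[of _ "\<lambda>z. g z - l"]) (simp add: p_def)
qed

lemma integral_from_inf_eq:
  assumes J: "\<And>z. (J has_field_derivative f z) (at z)"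
    and lim: "((\<lambda>r. J (of_real r * cis \<theta>)) \<longlongrightarrow> 0) at_top"
  shows "integral_from_inf \<theta> f z = J z"
proof -
  have "contour_integral (linepath a z) f = J z - J a" for a
  proof -
    have "(f has_contour_integral (J (pathfinish (linepath a z)) - J (pathstart (linepath a z)))) (linepath a z)"
      by (rule contour_integral_primitive[where S=UNIV]) (use J in auto)
    then show ?thesis by (simp add: contour_integral_unique)
  qed
  then have "((\<lambda>r. contour_integral (linepath (of_real r * cis \<theta>) z) f) \<longlongrightarrow> J z - 0) at_top"
    by (simp only:) (intro tendsto_intros lim)
  then show ?thesis unfolding integral_from_inf_def by (intro tendsto_Lim) auto
qed

text \<open>Its half angle arctan 2 lies strictly between pi/4 and pi/2: both end directions are
  interior, the points i and -i are outside, and the bounds of \<open>weber_W_scaled\<close> hold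
  throughout.\<close>

abbreviation (input) weber_cone :: "complex set" where
  "weber_cone \<equiv> {z. \<bar>Im z\<bar> \<le> 2 * Re z}"

lemma weber_cone_properties:
  shows "convex weber_cone" "closed weber_cone" "z \<in> weber_cone \<Longrightarrow> z^2 + 1 \<noteq> 0"
    "z \<in> weber_cone \<Longrightarrow> w \<in> weber_cone \<Longrightarrow> z + w \<in> weber_cone"
    "z \<in> weber_cone \<Longrightarrow> t \<ge> 0 \<Longrightarrow> of_real t * z \<in> weber_cone"
proof -
  show "closed weber_cone" by (intro closed_Collect_le continuous_intros)
  show add: "z \<in> weber_cone \<Longrightarrow> w \<in> weber_cone \<Longrightarrow> z + w \<in> weber_cone" for z w :: complex by auto
  show mul: "z \<in> weber_cone \<Longrightarrow> t \<ge> 0 \<Longrightarrow> of_real t * z \<in> weber_cone" for z t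
  proof -
    assume "z \<in> weber_cone" "t \<ge> 0"
    then have "t * \<bar>Im z\<bar> \<le> t * (2 * Re z)" by (intro mult_left_mono) auto
    then show ?thesis using \<open>t \<ge> 0\<close> by (simp add: abs_mult)
  qed
  show "convex weber_cone"
  proof (rule convexI)
    fix x y :: complex and a b :: real
    assume "x \<in> weber_cone" "y \<in> weber_cone" "0 \<le> a" "0 \<le> b"
    then show "a *\<^sub>R x + b *\<^sub>R y \<in> weber_cone"
      unfolding scaleR_conv_of_real by (intro add mul)
  qed
  assume z: "z \<in> weber_cone"
  show "z^2 + 1 \<noteq> 0"
  proof
    assume "z^2 + 1 = 0"
    from arg_cong[OF this, of Im] arg_cong[OF this, of Re]
    have "2 * (Re z * Im z) = 0" "(Re z)^2 - (Im z)^2 + 1 = 0" by (simp_all add: Im_power2 Re_power2)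
    then have "Re z * Im z = 0" by simp
    moreover have "Re z \<noteq> 0" using z \<open>(Re z)^2 - (Im z)^2 + 1 = 0\<close> by auto
    ultimately have "Im z = 0" by simp
    then have "(Re z)^2 + 1 = 0" using \<open>(Re z)^2 - (Im z)^2 + 1 = 0\<close> by simp
    then show False by (smt (verit) zero_le_power2)
  qed
qed

text \<open>The bounds of \<open>K\<close>, a primitive of \<open>f w\<close> vanishing at the end where \<open>w\<close> is recessive, near the two
  ends: near its own end along rays to infinity, near the other one along the segment from the
  origin.\<close>

locale recessive_primitive =
  fixes u \<sigma> C A :: real and f w K :: "complex \<Rightarrow> complex"
  assumes u: "u > 0" and \<sigma>: "\<sigma> = 1 \<or> \<sigma> = - 1"
    and w: "\<And>z. z \<in> weber_cone \<Longrightarrow> cmod (w z) \<le> C * exp (- (u * (\<sigma> * Im (z^2)) / 2))"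
    and f: "\<And>z. z \<in> weber_cone \<Longrightarrow> cmod (f z) \<le> A" "\<And>z. z \<in> weber_cone \<Longrightarrow> (cmod z)^2 * cmod (f z) \<le> A"
    and K: "\<And>z. z \<in> weber_cone \<Longrightarrow> (K has_field_derivative f z * w z) (at z)"
    and lim: "((\<lambda>r. K (of_real r * cis (\<sigma> * pi / 4))) \<longlongrightarrow> 0) at_top"
begin

lemma C_nonneg: "C \<ge> 0" using w[of 0] by (auto intro: order_trans[OF norm_ge_zero])
lemma A_nonneg: "A \<ge> 0" using f(1)[of 0] by (auto intro: order_trans[OF norm_ge_zero])

lemma segment_bound:
  assumes "a \<in> weber_cone" "b \<in> weber_cone"
    and "\<And>z. z \<in> closed_segment a b \<Longrightarrow> cmod (f z) \<le> A'"
    and "\<And>z. z \<in> closed_segment a b \<Longrightarrow> \<sigma> * Im (z^2) \<ge> M"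
  shows "cmod (K b - K a) \<le> A' * (C * exp (- (u * M / 2))) * cmod (b - a)"
proof (rule field_differentiable_bound[where S="closed_segment a b" and f'="\<lambda>z. f z * w z"])
  have sub: "closed_segment a b \<subseteq> weber_cone"
    by (rule closed_segment_subset[OF assms(1,2) weber_cone_properties(1)])
  fix z assume z: "z \<in> closed_segment a b"
  then have zc: "z \<in> weber_cone" using sub by blast
  show "(K has_field_derivative f z * w z) (at z within closed_segment a b)"
    by (rule has_field_derivative_at_within[OF K[OF zc]])
  have "exp (- (u * (\<sigma> * Im (z^2)) / 2)) \<le> exp (- (u * M / 2))"
    using assms(4)[OF z] u by simp
  then have "C * exp (- (u * (\<sigma> * Im (z^2)) / 2)) \<le> C * exp (- (u * M / 2))" using C_nonneg by (rule mult_left_mono)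
  then have "cmod (w z) \<le> C * exp (- (u * M / 2))" using w[OF zc] by linarith
  then show "cmod (f z * w z) \<le> A' * (C * exp (- (u * M / 2)))"
    unfolding norm_mult using assms(3)[OF z] by (intro mult_mono) (auto intro: order_trans[OF norm_ge_zero])
qed auto

abbreviation c where "c \<equiv> cis (\<sigma> * pi / 4)"

lemma c_cone: "c \<in> weber_cone" "Re c = sqrt 2 / 2" "Im c = \<sigma> * (sqrt 2 / 2)"
  using \<sigma> by (auto simp: cos_45 sin_45)

text \<open>As c^2 = \<sigma> i and the mixed term is nonnegative on this half of the cone, moving
  in direction c increases \<sigma> Im (z^2) at least by r^2, and |z| does not decrease.\<close>

lemma ray_square:
  assumes z: "z \<in> weber_cone" "\<sigma> * Im z \<ge> 0" and r: "r \<ge> 0"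
  shows "\<sigma> * Im ((z + of_real r * c)^2) \<ge> \<sigma> * Im (z^2) + r^2" "cmod (z + of_real r * c) \<ge> cmod z"
proof -
  have s2: "(sqrt 2 / 2) * (sqrt 2 / 2) = (1/2::real)" by simp
  have p: "r * (sqrt 2 / 2) * (Re z + \<sigma> * Im z) \<ge> 0" using z r by (intro mult_nonneg_nonneg) auto
  have RI: "Re (z + of_real r * c) = Re z + r * Re c" "Im (z + of_real r * c) = Im z + r * Im c" by simp_all
  have "\<sigma> * (2 * (x + r * s) * (y + r * (\<sigma> * s))) = \<sigma> * (2 * x * y) + 2 * (r * s * (x + \<sigma> * y)) + 2 * r^2 * (s * s)"
    for x y s using \<sigma> by (auto simp: power2_eq_square algebra_simps)
  then have "\<sigma> * Im ((z + of_real r * c)^2) = \<sigma> * Im (z^2) + 2 * (r * (sqrt 2 / 2) * (Re z + \<sigma> * Im z)) + 2 * r^2 * ((sqrt 2 / 2) * (sqrt 2 / 2))"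
    unfolding Im_power2 RI c_cone(2,3) .
  then show "\<sigma> * Im ((z + of_real r * c)^2) \<ge> \<sigma> * Im (z^2) + r^2" using p unfolding s2 by simp
  have "(x + r * s)^2 + (y + r * (\<sigma> * s))^2 = (x^2 + y^2) + 2 * (r * s * (x + \<sigma> * y)) + 2 * r^2 * (s * s)"
    for x y s using \<sigma> by (auto simp: power2_eq_square algebra_simps)
  then have "(cmod (z + of_real r * c))^2 = (cmod z)^2 + 2 * (r * (sqrt 2 / 2) * (Re z + \<sigma> * Im z)) + 2 * r^2 * ((sqrt 2 / 2) * (sqrt 2 / 2))"
    unfolding cmod_power2 RI c_cone(2,3) .
  then have "(cmod z)^2 \<le> (cmod (z + of_real r * c))^2" using p unfolding s2 by simp
  then show "cmod (z + of_real r * c) \<ge> cmod z" by (rule power2_le_imp_le) auto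
qed

lemma Im_square_nonneg:
  assumes z: "z \<in> weber_cone" "\<sigma> * Im z \<ge> 0"
  shows "\<sigma> * Im (z^2) \<ge> 0"
proof -
  have "Re z \<ge> 0" using z(1) by auto
  then have "2 * Re z * (\<sigma> * Im z) \<ge> 0" using z(2) by simp
  then show ?thesis by (simp add: Im_power2 mult_ac)
qed

text \<open>The normalization at infinity is known on the central ray only. The segment that joins r
  c to z + r c has fixed length, and on it the integrand is at most of size exp(-u r^2/2).\<close>

lemma ray_tendsto:
  assumes z: "z \<in> weber_cone" "\<sigma> * Im z \<ge> 0"
  shows "((\<lambda>r. K (z + of_real r * c)) \<longlongrightarrow> 0) at_top"
proof -
  have "((\<lambda>r. K (z + of_real r * c) - K (of_real r * c)) \<longlongrightarrow> 0) at_top"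
  proof (rule Lim_null_comparison)
    show "\<forall>\<^sub>F r in at_top. cmod (K (z + of_real r * c) - K (of_real r * c)) \<le> A * (C * exp (- (u * r^2 / 2))) * cmod z"
      using eventually_ge_at_top[of 0]
    proof eventually_elim
      case (elim r)
      have rc: "of_real r * c \<in> weber_cone" using elim by (intro weber_cone_properties(5) c_cone)
      have zrc: "z + of_real r * c \<in> weber_cone" by (rule weber_cone_properties(4)[OF z(1) rc])
      have "cmod (K (z + of_real r * c) - K (of_real r * c)) \<le> A * (C * exp (- (u * r^2 / 2))) * cmod (z + of_real r * c - of_real r * c)"
      proof (rule segment_bound[OF rc zrc])
        fix y assume y: "y \<in> closed_segment (of_real r * c) (z + of_real r * c)"
        then have "y \<in> weber_cone" using closed_segment_subset[OF rc zrc weber_cone_properties(1)] by blast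
        then show "cmod (f y) \<le> A" by (rule f)
        obtain t where t: "0 \<le> t" "t \<le> 1" "y = (1 - t) *\<^sub>R (of_real r * c) + t *\<^sub>R (z + of_real r * c)"
          using y by (auto simp: in_segment)
        then have yt: "y = of_real t * z + of_real r * c" by (simp add: scaleR_conv_of_real algebra_simps)
        have tz: "of_real t * z \<in> weber_cone" using t z by (intro weber_cone_properties(5))
        have "\<sigma> * Im (of_real t * z) = t * (\<sigma> * Im z)" by simp
        moreover have "t * (\<sigma> * Im z) \<ge> 0" using t(1) z(2) by (rule mult_nonneg_nonneg)
        ultimately have tz2: "\<sigma> * Im (of_real t * z) \<ge> 0" by (simp only:)
        from ray_square(1)[OF tz tz2 elim] Im_square_nonneg[OF tz tz2]
        show "\<sigma> * Im (y^2) \<ge> r^2" unfolding yt by linarith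
      qed
      then show ?case by simp
    qed
    have "((\<lambda>r. A * C * cmod z * exp (- (u * r^2 / 2))) \<longlongrightarrow> 0) at_top"
    proof (intro tendsto_mult_right_zero)
      show "((\<lambda>r. exp (- (u * r^2 / 2))) \<longlongrightarrow> 0) at_top" using u by real_asymp
    qed
    then show "((\<lambda>r. A * (C * exp (- (u * r^2 / 2))) * cmod z) \<longlongrightarrow> 0) at_top" by (simp add: mult_ac)
  qed
  from tendsto_add[OF this lim] show ?thesis by simp
qed

text \<open>The primitive is integrated in from infinity along z + r c. There |z + r c| >= |z|
  supplies the factor |z|^(-2) from \<open>f\<close>, and \<open>ray_square\<close> supplies the
  exponential at z together with a Gaussian in r.\<close>

lemma near_end_bound:
  assumes z: "z \<in> weber_cone" "\<sigma> * Im z \<ge> 0" "cmod z \<ge> 1"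
  shows "cmod (K z) \<le> A * C * exp (1 / (2 * u)) / (cmod z)^2 * exp (- (u * (\<sigma> * Im (z^2)) / 2))"
proof -
  define M where "M = A * C * exp (1 / (2 * u)) / (cmod z)^2 * exp (- (u * (\<sigma> * Im (z^2)) / 2))"
  have M: "M \<ge> 0" using A_nonneg C_nonneg by (simp add: M_def)
  have z2: "(cmod z)^2 > 0" using z(3) by auto
  define p where "p = (\<lambda>r. K (z + of_real r * c))"
  have cone: "z + of_real r * c \<in> weber_cone" if "r \<ge> 0" for r
    using that z c_cone(1) by (intro weber_cone_properties(4,5))
  have dp: "(p has_vector_derivative c * (f (z + of_real r * c) * w (z + of_real r * c))) (at r)" if "r \<ge> 0" for r
  proof -
    have "((\<lambda>r. z + of_real r * c) has_vector_derivative 0 + 1 * c) (at r)"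
      by (intro has_vector_derivative_add has_vector_derivative_const has_vector_derivative_mult_left) (auto intro!: derivative_eq_intros)
    from field_vector_diff_chain_at[OF this K[OF cone[OF that]]] show ?thesis by (simp add: p_def o_def)
  qed
  have bd: "cmod (c * (f (z + of_real r * c) * w (z + of_real r * c))) \<le> M * exp (- r)" if r: "r \<ge> 0" for r
  proof -
    let ?y = "z + of_real r * c"
    note s = ray_square[OF z(1,2) r]
    have "(cmod z)^2 * cmod (f ?y) \<le> (cmod ?y)^2 * cmod (f ?y)"
      using s(2) by (intro mult_right_mono power_mono) auto
    also have "\<dots> \<le> A" by (rule f(2)[OF cone[OF r]])
    finally have fy: "cmod (f ?y) \<le> A / (cmod z)^2" using z2 by (simp add: pos_le_divide_eq mult.commute)
    \<comment> \<open>Completing the square trades the Gaussian for exp(-r), at the cost of the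
      constant exp(1/(2u)).\<close>
    have "(u * r - 1)^2 / (2 * u) \<ge> 0" using u by simp
    also have "(u * r - 1)^2 / (2 * u) = u * r^2 / 2 - r + 1 / (2 * u)" using u by (simp add: field_simps power2_eq_square)
    finally have q: "- (u * r^2 / 2) \<le> 1 / (2 * u) - r" by simp
    have "u * (\<sigma> * Im (?y^2)) \<ge> u * (\<sigma> * Im (z^2) + r^2)" using s(1) u by (intro mult_left_mono) auto
    then have "- (u * (\<sigma> * Im (?y^2)) / 2) \<le> 1 / (2 * u) + - r + - (u * (\<sigma> * Im (z^2)) / 2)" using q by (simp add: distrib_left)
    then have "exp (- (u * (\<sigma> * Im (?y^2)) / 2)) \<le> exp (1 / (2 * u) + - r + - (u * (\<sigma> * Im (z^2)) / 2))" by (simp only: exp_le_cancel_iff)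
    also have "\<dots> = exp (1 / (2 * u)) * exp (- r) * exp (- (u * (\<sigma> * Im (z^2)) / 2))" by (simp only: exp_add)
    finally have "C * exp (- (u * (\<sigma> * Im (?y^2)) / 2)) \<le> C * (exp (1 / (2 * u)) * exp (- r) * exp (- (u * (\<sigma> * Im (z^2)) / 2)))"
      using C_nonneg by (rule mult_left_mono)
    then have wy: "cmod (w ?y) \<le> C * (exp (1 / (2 * u)) * exp (- r) * exp (- (u * (\<sigma> * Im (z^2)) / 2)))"
      using w[OF cone[OF r]] by linarith
    have "cmod (c * (f ?y * w ?y)) = cmod (f ?y) * cmod (w ?y)" by (simp add: norm_mult)
    also have "\<dots> \<le> (A / (cmod z)^2) * (C * (exp (1 / (2 * u)) * exp (- r) * exp (- (u * (\<sigma> * Im (z^2)) / 2))))"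
      using fy wy A_nonneg by (intro mult_mono) auto
    also have "\<dots> = M * exp (- r)" by (simp add: M_def)
    finally show ?thesis .
  qed
  have "cmod (p 0) \<le> cmod (p r) + M" if "r \<ge> 0" for r
  proof -
    have "cmod (p r - p 0) \<le> M * exp (- 0) - M * exp (- r)"
      by (rule norm_diff_le_exp[OF that dp bd]) auto
    moreover have "M * exp (- r) \<ge> 0" using M by simp
    ultimately have "cmod (p r - p 0) \<le> M" by simp
    then show ?thesis using norm_triangle_sub[of "p 0" "p r"] by (simp add: norm_minus_commute)
  qed
  note le = this
  have "cmod (p 0) \<le> 0 + M"
  proof (rule tendsto_lowerbound)
    have "((\<lambda>r. p r) \<longlongrightarrow> 0) at_top" unfolding p_def by (rule ray_tendsto[OF z(1,2)])
    from tendsto_norm[OF this] show "((\<lambda>r. cmod (p r) + M) \<longlongrightarrow> 0 + M) at_top" by (intro tendsto_intros) simp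
    show "\<forall>\<^sub>F r in at_top. cmod (p 0) \<le> cmod (p r) + M"
      by (rule eventually_mono[OF eventually_ge_at_top[of 0] le])
  qed auto
  then show ?thesis by (simp add: p_def M_def)
qed

text \<open>On the segment from 0 to z the integrand grows. The half next to 0 contributes at most
  exp(u y/8) instead of exp(u y/2), with y = -\<sigma> Im (z^2), and is negligible; on the outer
  half \<open>f\<close> is O(|z|^(-2)) and the length is |z|/2, which leaves a factor 1/|z|.\<close>

lemma far_end_bound:
  assumes z: "z \<in> weber_cone" "\<sigma> * Im (z^2) \<le> - ((cmod z)^2 / 2)" "cmod z \<ge> 2"
  shows "cmod (K z) \<le> ((cmod (K 0) + A * C) * 16 / (3 * u) + 2 * A * C) / cmod z * exp (- (u * (\<sigma> * Im (z^2)) / 2))"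
proof -
  define m where "m = cmod z"
  define y where "y = - (\<sigma> * Im (z^2))"
  have m: "m \<ge> 2" using z by (simp add: m_def)
  have y: "y \<ge> m^2 / 2" using z by (simp add: m_def y_def)
  then have y0: "y > 0" using m by (smt (verit) zero_less_power half_gt_zero)
  have h: "of_real (1/2) * z \<in> weber_cone" using z by (intro weber_cone_properties(5)) auto
  let ?h = "of_real (1/2) * z"
  have Im_t: "\<sigma> * Im ((of_real t * z)^2) = - (t^2 * y)" for t
    by (simp add: y_def power_mult_distrib Im_power2 power2_eq_square)
  have 1: "cmod (K ?h - K 0) \<le> A * (C * exp (- (u * (- (y / 4)) / 2))) * cmod (?h - 0)"
  proof (rule segment_bound[OF _ h])
    fix x assume "x \<in> closed_segment 0 ?h"
    then obtain t where t: "0 \<le> t" "t \<le> 1" "x = of_real (t / 2) * z"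
      by (auto simp: in_segment scaleR_conv_of_real)
    have xc: "x \<in> weber_cone" unfolding t(3) using t z by (intro weber_cone_properties(5)) auto
    show "cmod (f x) \<le> A" by (rule f(1)[OF xc])
    have "(t / 2)^2 \<le> (1/2)^2" using t by (intro power_mono) auto
    then have "(t / 2)^2 * y \<le> (1/2)^2 * y" using y0 by (intro mult_right_mono) auto
    then show "- (y / 4) \<le> \<sigma> * Im (x^2)" unfolding t(3) Im_t by (simp add: power2_eq_square)
  qed auto
  have 2: "cmod (K z - K ?h) \<le> (4 * A / m^2) * (C * exp (- (u * (- y) / 2))) * cmod (z - ?h)"
  proof (rule segment_bound[OF h z(1)])
    fix x assume x: "x \<in> closed_segment ?h z"
    then obtain s where s: "0 \<le> s" "s \<le> 1" "x = (1 - s) *\<^sub>R ?h + s *\<^sub>R z" by (auto simp: in_segment)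
    define t where "t = (1 + s) / 2"
    have "(1 - s) *\<^sub>R ?h + s *\<^sub>R z = of_real t * z"
      by (simp add: t_def scaleR_conv_of_real field_simps)
    then have t: "1/2 \<le> t" "t \<le> 1" "x = of_real t * z" using s by (auto simp: t_def)
    have xc: "x \<in> weber_cone" unfolding t(3) using t z by (intro weber_cone_properties(5)) auto
    have "(m / 2)^2 * cmod (f x) \<le> (cmod x)^2 * cmod (f x)"
    proof (intro mult_right_mono power_mono)
      have "1/2 * m \<le> t * m" using t m by (intro mult_right_mono) auto
      then show "m / 2 \<le> cmod x" using t by (simp add: norm_mult m_def)
    qed (use m in auto)
    also have "\<dots> \<le> A" by (rule f(2)[OF xc])
    finally show "cmod (f x) \<le> 4 * A / m^2" using m by (simp add: pos_le_divide_eq power_divide field_simps)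
    have "t^2 \<le> 1" using t by (simp add: power_le_one)
    then have "t^2 * y \<le> 1 * y" using y0 by (intro mult_right_mono) auto
    then show "- y \<le> \<sigma> * Im (x^2)" unfolding t(3) Im_t by simp
  qed
  have half: "cmod (?h - 0) = m / 2" "cmod (z - ?h) = m / 2"
  proof -
    have "z - ?h = of_real (1/2) * z" by simp
    then show "cmod (?h - 0) = m / 2" "cmod (z - ?h) = m / 2" unfolding diff_0_right by (simp_all add: norm_mult m_def)
  qed
  define E where "E = exp (u * y / 2)"
  have E: "E > 0" by (simp add: E_def)
  \<comment> \<open>The spare factor is exp(3 u y/8) >= 3 u y/8 >= 3 u m^2/16; dividing m by the
    last quantity gives 16/(3 u)/m.\<close>
  have small: "exp (u * y / 8) * m \<le> 16 / (3 * u) / m * E"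
  proof -
    have "3 * u * y / 8 \<le> exp (3 * u * y / 8)" using exp_ge_add_one_self[of "3 * u * y / 8"] by linarith
    moreover have "3 * u * (m^2 / 2) / 8 \<le> 3 * u * y / 8" using y u by (intro divide_right_mono mult_left_mono) auto
    ultimately have "3 * u * m^2 / 16 \<le> exp (3 * u * y / 8)" by simp
    then have "exp (u * y / 8) * (3 * u * m^2 / 16) \<le> exp (u * y / 8) * exp (3 * u * y / 8)" by (intro mult_left_mono) auto
    also have "\<dots> = E" by (simp add: E_def flip: exp_add)
    finally show ?thesis using u m by (simp add: field_simps power2_eq_square)
  qed
  have e8: "exp (u * y / 8) \<ge> 1" using u y0 by simp
  have "cmod (K z) \<le> cmod (K 0) + cmod (K ?h - K 0) + cmod (K z - K ?h)"
    using norm_triangle_sub[of "K z" "K ?h"] norm_triangle_sub[of "K ?h" "K 0"] by linarith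
  also have "\<dots> \<le> cmod (K 0) * (exp (u * y / 8) * m) + A * C * (exp (u * y / 8) * m) + 2 * A * C / m * E"
  proof (intro add_mono)
    have "1 * 1 \<le> exp (u * y / 8) * m" using e8 m by (intro mult_mono) auto
    then show "cmod (K 0) \<le> cmod (K 0) * (exp (u * y / 8) * m)" using mult_left_mono[of 1 _ "cmod (K 0)"] by simp
    have "cmod (K ?h - K 0) \<le> A * C * (exp (u * y / 8) * m) / 2" using 1 unfolding half by (simp add: mult_ac)
    also have "\<dots> \<le> A * C * (exp (u * y / 8) * m)" using A_nonneg C_nonneg m by simp
    finally show "cmod (K ?h - K 0) \<le> A * C * (exp (u * y / 8) * m)" .
    have "(4 * A / m^2) * (C * exp (- (u * (- y) / 2))) * (m / 2) = 2 * A * C / m * E"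
      using m by (simp add: E_def field_simps power2_eq_square)
    then show "cmod (K z - K ?h) \<le> 2 * A * C / m * E" using 2 unfolding half by simp
  qed
  also have "\<dots> = (cmod (K 0) + A * C) * (exp (u * y / 8) * m) + 2 * A * C / m * E" by (simp add: distrib_right)
  also have "\<dots> \<le> (cmod (K 0) + A * C) * (16 / (3 * u) / m * E) + 2 * A * C / m * E"
    using small A_nonneg C_nonneg by (intro add_right_mono mult_left_mono) auto
  also have "\<dots> = ((cmod (K 0) + A * C) * 16 / (3 * u) + 2 * A * C) / m * E"
    by (simp add: add_divide_distrib distrib_right)
  finally show ?thesis by (simp add: m_def E_def y_def)
qed

end

section \<open>The partial sums of the formal solution and integration by parts against them\<close>

definition partial_sum :: "real \<Rightarrow> nat \<Rightarrow> nat \<Rightarrow> complex \<Rightarrow> complex" where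
  "partial_sum u R n z = (\<Sum>s<n. (- 1)^(s + 1) / of_real (u^(2 * s + 2)) * G_bar R s z)"

lemma partial_sum_holomorphic: "partial_sum u R n holomorphic_on {z. z^2 + 1 \<noteq> 0}"
  unfolding partial_sum_def by (intro holomorphic_intros G_bar_holomorphic)

lemma deriv_DERIV:
  fixes f :: "complex \<Rightarrow> complex"
  assumes "f holomorphic_on {z. z^2 + 1 \<noteq> 0}" "z^2 + 1 \<noteq> 0"
  shows "(f has_field_derivative deriv f z) (at z)"
  using assms open_not_pm_i by (auto intro: holomorphic_derivI)

lemma deriv_holomorphic_pm_i:
  fixes f :: "complex \<Rightarrow> complex"
  shows "f holomorphic_on {z. z^2 + 1 \<noteq> 0} \<Longrightarrow> deriv f holomorphic_on {z. z^2 + 1 \<noteq> 0}"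
  using open_not_pm_i by (intro holomorphic_deriv)

lemma partial_sum_growth: "power_growth (partial_sum u R n) (real R)"
  unfolding partial_sum_def
  by (intro power_growth_sum power_growth_cmult power_growth_mono[OF G_bar_growth]) auto

text \<open>The sum telescopes because \<open>G_bar (s + 1) (z\<^sup>2 + 1) = G_bar s''\<close>.\<close>

lemma partial_sum_ODE:
  assumes u: "u > 0" and z: "z^2 + 1 \<noteq> 0"
  shows "deriv (deriv (partial_sum u R n)) z + of_real (u^2) * (z^2 + 1) * partial_sum u R n z
    = z^R + (- 1)^n / of_real (u^(2 * n)) * (z^2 + 1) * G_bar R n z"
proof (induction n)
  case 0
  have "deriv (deriv (partial_sum u R 0)) z = 0" by (simp add: partial_sum_def[abs_def])
  then show ?case using z by (simp add: partial_sum_def)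
next
  case (Suc n)
  define b where "b = (- 1)^(n + 1) / complex_of_real (u^(2 * n + 2))"
  let ?S = "partial_sum u R n" and ?G = "G_bar R n"
  have Suc_eq: "partial_sum u R (Suc n) = (\<lambda>z. ?S z + b * ?G z)" by (simp add: partial_sum_def fun_eq_iff b_def)
  have d1: "deriv (partial_sum u R (Suc n)) w = deriv ?S w + b * deriv ?G w" if "w^2 + 1 \<noteq> 0" for w
    unfolding Suc_eq using that
    by (intro DERIV_imp_deriv DERIV_add DERIV_cmult deriv_DERIV partial_sum_holomorphic G_bar_holomorphic)
  have "((\<lambda>w. deriv ?S w + b * deriv ?G w) has_field_derivative deriv (deriv ?S) z + b * deriv (deriv ?G) z) (at z)"
    using z by (intro DERIV_add DERIV_cmult deriv_DERIV deriv_holomorphic_pm_i partial_sum_holomorphic G_bar_holomorphic)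
  then have "(deriv (partial_sum u R (Suc n)) has_field_derivative deriv (deriv ?S) z + b * deriv (deriv ?G) z) (at z)"
    by (rule has_field_derivative_transform_within_open[OF _ open_not_pm_i]) (use z d1 in auto)
  then have d2: "deriv (deriv (partial_sum u R (Suc n))) z = deriv (deriv ?S) z + b * deriv (deriv ?G) z"
    by (rule DERIV_imp_deriv)
  have G: "deriv (deriv ?G) z = (z^2 + 1) * G_bar R (Suc n) z" using z by simp
  have bu: "b * of_real (u^2) = - ((- 1)^n / complex_of_real (u^(2 * n)))" "b = (- 1)^(Suc n) / complex_of_real (u^(2 * Suc n))"
    using u by (simp_all add: b_def power_add power2_eq_square)
  have "deriv (deriv (partial_sum u R (Suc n))) z + of_real (u^2) * (z^2 + 1) * partial_sum u R (Suc n) z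
      = (deriv (deriv ?S) z + of_real (u^2) * (z^2 + 1) * ?S z) + (b * of_real (u^2)) * ((z^2 + 1) * ?G z) + b * ((z^2 + 1) * G_bar R (Suc n) z)"
    unfolding d2 G unfolding Suc_eq by (simp only: distrib_left mult_ac add_ac)
  also have "\<dots> = z^R + b * ((z^2 + 1) * G_bar R (Suc n) z)"
    unfolding Suc.IH bu(1) by (simp add: mult.assoc)
  finally show ?case unfolding bu(2) by (simp only: mult.assoc)
qed

lemma cone_bound:
  assumes "power_growth f (- 2)" "f holomorphic_on {z. z^2 + 1 \<noteq> 0}"
  shows "\<exists>A. \<forall>z\<in>weber_cone. cmod (f z) \<le> A \<and> (cmod z)^2 * cmod (f z) \<le> A"
proof -
  obtain C \<rho> where C: "\<rho> \<ge> 2" "\<And>z. cmod z \<ge> \<rho> \<Longrightarrow> cmod (f z) \<le> C * cmod z powr (- 2)"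
    using assms by (auto simp: power_growth_def)
  have "continuous_on (weber_cone \<inter> cball 0 \<rho>) f"
    using holomorphic_on_imp_continuous_on[OF assms(2)] by (rule continuous_on_subset) (use weber_cone_properties(3) in auto)
  then have "bounded (f ` (weber_cone \<inter> cball 0 \<rho>))"
    by (intro compact_imp_bounded compact_continuous_image closed_Int_compact weber_cone_properties(2)) auto
  then obtain M where M: "\<And>z. z \<in> weber_cone \<Longrightarrow> cmod z \<le> \<rho> \<Longrightarrow> cmod (f z) \<le> M"
    by (force simp: bounded_iff)
  define A where "A = max (\<bar>C\<bar>) (\<bar>M\<bar> * \<rho>^2)"
  have "cmod (f z) \<le> A \<and> (cmod z)^2 * cmod (f z) \<le> A" if z: "z \<in> weber_cone" for z
  proof (cases "cmod z \<le> \<rho>")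
    case True
    have le: "(cmod z)^2 \<le> \<rho>^2" "1 \<le> \<rho>^2" using True C(1) by (auto intro!: power_mono simp: one_le_power)
    have "cmod (f z) \<le> \<bar>M\<bar>" using M[OF z True] by simp
    then have "(cmod z)^2 * cmod (f z) \<le> \<rho>^2 * \<bar>M\<bar>" "1 * cmod (f z) \<le> \<rho>^2 * \<bar>M\<bar>"
      by (rule mult_mono[OF le(1)]; simp) (rule mult_mono[OF le(2) \<open>cmod (f z) \<le> \<bar>M\<bar>\<close>]; simp)
    then show ?thesis by (auto simp: A_def mult.commute)
  next
    case False
    then have z2: "(cmod z)^2 \<ge> 1" using C(1) by (simp add: one_le_power)
    have "cmod (f z) \<le> C * cmod z powr (- 2)" using C(2) False by auto
    also have "cmod z powr (- 2) = 1 / (cmod z)^2" using False C(1) by (simp add: powr_minus_divide)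
    finally have "(cmod z)^2 * cmod (f z) \<le> (cmod z)^2 * (C * (1 / (cmod z)^2))" by (intro mult_left_mono) auto
    also have "\<dots> = C" using z2 by auto
    finally have "(cmod z)^2 * cmod (f z) \<le> C" .
    moreover have "1 * cmod (f z) \<le> (cmod z)^2 * cmod (f z)" using z2 by (intro mult_right_mono) auto
    ultimately show ?thesis by (auto simp: A_def)
  qed
  then show ?thesis by blast
qed

text \<open>The derivative is controlled by Cauchy's inequality on unit discs around points of the
  ray; for r >= 5 these discs remain in the cone.\<close>

lemma recessive_ray_decay:
  fixes u \<sigma> C :: real
  assumes u: "u > 0" and \<sigma>: "\<sigma> = 1 \<or> \<sigma> = - 1" and hol: "w holomorphic_on UNIV"
    and w: "\<And>z. z \<in> weber_cone \<Longrightarrow> cmod (w z) \<le> C * exp (- (u * (\<sigma> * Im (z^2)) / 2))"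
    and r: "r \<ge> 5"
  shows "cmod (w (of_real r * cis (\<sigma> * pi / 4))) \<le> C * exp (u / 2 + u * r - u * r^2 / 4)"
    and "cmod (deriv w (of_real r * cis (\<sigma> * pi / 4))) \<le> C * exp (u / 2 + u * r - u * r^2 / 4)"
proof -
  let ?p = "of_real r * cis (\<sigma> * pi / 4)"
  have C: "C \<ge> 0" using w[of 0] by (auto intro: order_trans[OF norm_ge_zero])
  have s2: "sqrt 2 / 2 > (0.7::real)"
  proof -
    have "7/5 < sqrt 2" by (rule real_less_rsqrt) (simp add: power2_eq_square)
    then show ?thesis by simp
  qed
  have p: "Re ?p = r * (sqrt 2 / 2)" "\<sigma> * Im ?p = r * (sqrt 2 / 2)" using \<sigma> by (auto simp: cos_45 sin_45)
  have bd: "cmod (w z) \<le> C * exp (u / 2 + u * r - u * r^2 / 4)" if z: "z \<in> cball ?p 1" for z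
  proof -
    define h where "h = z - ?p"
    have h: "cmod h \<le> 1" "z = ?p + h" using z by (auto simp: h_def dist_norm norm_minus_commute)
    have ab: "\<bar>Re h\<bar> \<le> 1" "\<bar>Im h\<bar> \<le> 1" using h abs_Re_le_cmod[of h] abs_Im_le_cmod[of h] by auto
    have big: "r * (sqrt 2 / 2) \<ge> 5 * 0.7" using r s2 by (intro mult_mono) auto
    define X where "X = Re ?p"
    define Y where "Y = Im ?p"
    have "X = r * (sqrt 2 / 2)" "\<sigma> * Y = r * (sqrt 2 / 2)" using p by (simp_all only: X_def Y_def)
    then have "\<bar>Y\<bar> = X" "X \<ge> 3.5" using \<sigma> big by auto
    moreover have "Re z = X + Re h" "Im z = Y + Im h" by (simp_all add: X_def Y_def h(2))
    ultimately have "\<bar>Im z\<bar> \<le> 2 * Re z" using ab by linarith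
    then have "z \<in> weber_cone" by simp
    then have "cmod (w z) \<le> C * exp (- (u * (\<sigma> * Im (z^2)) / 2))" by (rule w)
    also have "\<dots> \<le> C * exp (u / 2 + u * r - u * r^2 / 4)"
    proof -
      \<comment> \<open>Moving by at most 1 changes the square by at most 2 r + 1. This produces u/2
        + u r in the exponent, and half of the quadratic term is given away to reach u
        r^2/4.\<close>
      have "z^2 = ?p^2 + (2 * ?p * h + h^2)" by (simp add: h(2) power2_eq_square algebra_simps)
      moreover have "\<sigma> * Im (?p^2) = r^2"
      proof -
        have "\<sigma> * Im (?p^2) = 2 * Re ?p * (\<sigma> * Im ?p)" unfolding Im_power2 by (simp only: mult_ac)
        also have "\<dots> = r^2 * (2 * ((sqrt 2 / 2) * (sqrt 2 / 2)))" unfolding p by (simp only: power2_eq_square mult_ac)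
        also have "2 * ((sqrt 2 / 2) * (sqrt 2 / 2)) = (1::real)" by simp
        finally show ?thesis by simp
      qed
      moreover have "\<sigma> * Im (2 * ?p * h + h^2) \<ge> - (2 * r + 1)"
      proof -
        have "\<bar>\<sigma> * Im (2 * ?p * h + h^2)\<bar> \<le> cmod (2 * ?p * h + h^2)"
          using abs_Im_le_cmod[of "2 * ?p * h + h^2"] \<sigma> by auto
        also have "\<dots> \<le> cmod (2 * ?p * h) + cmod (h^2)" by (rule norm_triangle_ineq)
        also have "\<dots> = 2 * r * cmod h + (cmod h)^2" using r by (simp add: norm_mult norm_power)
        also have "\<dots> \<le> 2 * r * 1 + 1^2" using h r by (intro add_mono mult_left_mono power_mono) auto
        finally show ?thesis by simp
      qed
      ultimately have "\<sigma> * Im (z^2) \<ge> r^2 - 2 * r - 1" by (simp add: distrib_left)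
      then have "u * (r^2 - 2 * r - 1) \<le> u * (\<sigma> * Im (z^2))" using u by (intro mult_left_mono) auto
      moreover have "u * r^2 \<ge> 0" using u by simp
      ultimately have "- (u * (\<sigma> * Im (z^2)) / 2) \<le> u / 2 + u * r - u * r^2 / 4" by (simp add: right_diff_distrib) 
      then show ?thesis using C by (intro mult_left_mono) auto
    qed
    finally show ?thesis .
  qed
  show "cmod (w ?p) \<le> C * exp (u / 2 + u * r - u * r^2 / 4)" by (rule bd) simp
  have "cmod ((deriv ^^ 1) w ?p) \<le> fact 1 * (C * exp (u / 2 + u * r - u * r^2 / 4)) / 1 ^ 1"
  proof (rule Cauchy_inequality)
    show "w holomorphic_on ball ?p 1" using hol by (rule holomorphic_on_subset) auto
    show "continuous_on (cball ?p 1) w" using holomorphic_on_imp_continuous_on[OF hol] by (rule continuous_on_subset) auto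
    fix x assume "cmod (?p - x) = 1"
    then show "cmod (w x) \<le> C * exp (u / 2 + u * r - u * r^2 / 4)" by (intro bd) (simp add: dist_norm)
  qed auto
  then show "cmod (deriv w ?p) \<le> C * exp (u / 2 + u * r - u * r^2 / 4)" by simp
qed

lemma growth_times_decay:
  fixes u :: real
  assumes u: "u > 0" and f: "power_growth f (real R)"
    and g: "\<And>r. r \<ge> 5 \<Longrightarrow> cmod (g (of_real r * cis \<theta>)) \<le> C * exp (u / 2 + u * r - u * r^2 / 4)"
  shows "((\<lambda>r. f (of_real r * cis \<theta>) * g (of_real r * cis \<theta>)) \<longlongrightarrow> 0) at_top"
proof -
  obtain D \<rho> where D: "\<rho> \<ge> 2" "\<And>z. cmod z \<ge> \<rho> \<Longrightarrow> cmod (f z) \<le> D * cmod z powr real R"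
    using f by (auto simp: power_growth_def)
  show ?thesis
  proof (rule Lim_null_comparison)
    show "\<forall>\<^sub>F r in at_top. cmod (f (of_real r * cis \<theta>) * g (of_real r * cis \<theta>)) \<le> D * C * (exp (u / 2 + u * r - u * r^2 / 4) * r ^ R)"
      using eventually_ge_at_top[of "max 5 \<rho>"]
    proof eventually_elim
      case (elim r)
      then have "cmod (f (of_real r * cis \<theta>)) \<le> D * r ^ R"
        using D(2)[of "of_real r * cis \<theta>"] by (simp add: norm_mult powr_realpow)
      moreover have "cmod (g (of_real r * cis \<theta>)) \<le> C * exp (u / 2 + u * r - u * r^2 / 4)" using g elim by auto
      ultimately have "cmod (f (of_real r * cis \<theta>)) * cmod (g (of_real r * cis \<theta>)) \<le> (D * r ^ R) * (C * exp (u / 2 + u * r - u * r^2 / 4))"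
        by (intro mult_mono) (auto intro: order_trans[OF norm_ge_zero])
      then show ?case by (simp add: norm_mult mult_ac)
    qed
    show "((\<lambda>r. D * C * (exp (u / 2 + u * r - u * r^2 / 4) * r ^ R)) \<longlongrightarrow> 0) at_top"
      by (intro tendsto_mult_right_zero tendsto_dir_bound u)
  qed
qed

text \<open>Integrating by parts against the partial sum replaces \<open>z\<^sup>R\<close> by the residual of the partial
  sum.\<close>

lemma recessive_primitive_residual:
  fixes u \<sigma> C :: real and w J :: "complex \<Rightarrow> complex"
  assumes u: "u > 0" and \<sigma>: "\<sigma> = 1 \<or> \<sigma> = - 1" and hol: "w holomorphic_on UNIV"
    and ode: "\<And>z. deriv (deriv w) z = - (of_real (u^2) * (z^2 + 1) * w z)"
    and w: "\<And>z. z \<in> weber_cone \<Longrightarrow> cmod (w z) \<le> C * exp (- (u * (\<sigma> * Im (z^2)) / 2))"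
    and J: "\<And>z. (J has_field_derivative z^R * w z) (at z)"
    and lim: "((\<lambda>r. J (of_real r * cis (\<sigma> * pi / 4))) \<longlongrightarrow> 0) at_top"
    and N: "real R - 4 * real N \<le> - 2"
  defines "S \<equiv> partial_sum u R N"
  defines "f \<equiv> \<lambda>z. - ((- 1)^N / of_real (u^(2 * N)) * ((z^2 + 1) * G_bar R N z))"
  defines "K \<equiv> \<lambda>z. J z - (deriv S z * w z - S z * deriv w z)"
  shows "\<exists>A. recessive_primitive u \<sigma> C A f w K"
proof -
  have "power_growth f (real R - 2 - 4 * real N + 2)"
    unfolding f_def minus_mult_left by (intro power_growth_cmult power_growth_times_square G_bar_growth)
  then have "power_growth f (- 2)" by (rule power_growth_mono) (use N in simp)
  moreover have "f holomorphic_on {z. z^2 + 1 \<noteq> 0}" unfolding f_def by (intro holomorphic_intros G_bar_holomorphic)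
  ultimately obtain A where A: "\<And>z. z \<in> weber_cone \<Longrightarrow> cmod (f z) \<le> A" "\<And>z. z \<in> weber_cone \<Longrightarrow> (cmod z)^2 * cmod (f z) \<le> A"
    using cone_bound[of f] by blast
  have Sh: "S holomorphic_on {z. z^2 + 1 \<noteq> 0}" unfolding S_def by (rule partial_sum_holomorphic)
  have dw: "(w has_field_derivative deriv w z) (at z)" "(deriv w has_field_derivative deriv (deriv w) z) (at z)" for z
    using hol by (auto intro!: holomorphic_derivI holomorphic_deriv)
  have "recessive_primitive u \<sigma> C A f w K"
  proof
    fix z :: complex assume "z \<in> weber_cone"
    then have z: "z^2 + 1 \<noteq> 0" by (rule weber_cone_properties(3))
    have "(K has_field_derivative z^R * w z - ((deriv (deriv S) z * w z + deriv w z * deriv S z) - (deriv S z * deriv w z + deriv (deriv w) z * S z))) (at z)"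
      unfolding K_def by (intro DERIV_diff DERIV_mult J dw deriv_DERIV Sh deriv_holomorphic_pm_i z)
    note dK = this
    \<comment> \<open>With S'' = z^R - f - u^2 (z^2 + 1) S and w'' = -u^2 (z^2 + 1) w, the
      derivative of S' w - S w' is (z^R - f) w, so only f w remains in the derivative of
      \<open>K\<close>.\<close>
    have dd: "deriv (deriv S) z = z^R - f z - of_real (u^2) * (z^2 + 1) * S z"
      using partial_sum_ODE[OF u z, of R N] by (simp add: f_def S_def eq_diff_eq add.commute mult.assoc)
    have "z^R * w z - ((deriv (deriv S) z * w z + deriv w z * deriv S z) - (deriv S z * deriv w z + deriv (deriv w) z * S z)) = f z * w z"
      unfolding ode dd by (simp add: algebra_simps)
    with dK show "(K has_field_derivative f z * w z) (at z)" by (simp only:)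
  next
    let ?p = "\<lambda>r. of_real r * cis (\<sigma> * pi / 4)"
    note dec = recessive_ray_decay[OF u \<sigma> hol w]
    have gS: "power_growth S (real R)" unfolding S_def by (rule partial_sum_growth)
    have gS': "power_growth (deriv S) (real R)" by (rule power_growth_mono[OF power_growth_deriv[OF Sh gS]]) simp
    have "((\<lambda>r. deriv S (?p r) * w (?p r)) \<longlongrightarrow> 0) at_top" by (rule growth_times_decay[OF u gS' dec(1)])
    moreover have "((\<lambda>r. S (?p r) * deriv w (?p r)) \<longlongrightarrow> 0) at_top" by (rule growth_times_decay[OF u gS dec(2)])
    ultimately have "((\<lambda>r. J (?p r) - (deriv S (?p r) * w (?p r) - S (?p r) * deriv w (?p r))) \<longlongrightarrow> 0 - (0 - 0)) at_top"
      by (intro tendsto_diff lim)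
    then show "((\<lambda>r. K (?p r)) \<longlongrightarrow> 0) at_top" by (simp add: K_def)
  qed (use u \<sigma> w A in auto)
  then show ?thesis ..
qed

section \<open>The real axis\<close>

lemma csinh_of_real: "sinh (complex_of_real x) = of_real (sinh x)"
  by (simp add: sinh_field_def flip: exp_of_real of_real_minus)

lemma Re_ccosh: "Re (cosh w) = cosh (Re w) * cos (Im w)"
  by (simp add: cosh_field_def Re_exp field_simps)

lemma Im_ccosh: "Im (cosh w) = sinh (Re w) * sin (Im w)"
  by (simp add: cosh_field_def sinh_field_def Im_exp field_simps)

text \<open>This is the sign condition for the derivative of Im \<open>xi_bar\<close> on the path
  below, with y = exp(2 Re w) and s the parameter. Only y < 1 is delicate: there s^2 < y^2 gives (1
  - y^2)(1 + s^2) <= 1 - s^4 <= 1, and the positive summand wins.\<close>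

lemma strip_monotone_ineq:
  fixes y s :: real
  assumes "s^2 < y^2" "y > 0"
  shows "(y + 1/y) / 2 / (1 + s^2) + (y - 1/y) / 2 * s^2 / y^2 \<ge> 0"
proof -
  have s1: "1 + s^2 > 0" by (smt (verit) zero_le_power2)
  have "(y^2 + 1) * y^2 + (y^2 - 1) * s^2 * (1 + s^2) \<ge> 0"
  proof (cases "y^2 \<ge> 1")
    case True
    then have "(y^2 - 1) * s^2 * (1 + s^2) \<ge> 0" using s1 by (intro mult_nonneg_nonneg) auto
    then show ?thesis by (smt (verit) mult_nonneg_nonneg zero_le_power2)
  next
    case False
    have "(1 - y^2) * s^2 * (1 + s^2) = s^2 * ((1 - y^2) * (1 + s^2))" by simp
    also have "\<dots> \<le> s^2 * ((1 - s^2) * (1 + s^2))"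
      using assms s1 by (intro mult_left_mono mult_right_mono) auto
    also have "(1 - s^2) * (1 + s^2) = 1 - (s^2)^2" by (simp add: algebra_simps power2_eq_square)
    also have "s^2 * (1 - (s^2)^2) \<le> s^2 * 1" by (intro mult_left_mono) auto
    also have "s^2 * 1 \<le> (y^2 + 1) * y^2" 
    proof -
      have "y^2 * y^2 \<ge> 0" by simp
      then show ?thesis using assms unfolding distrib_right mult_1_left mult_1_right by linarith
    qed
    finally show ?thesis by (simp add: algebra_simps)
  qed
  moreover have "(y + 1/y) / 2 / (1 + s^2) + (y - 1/y) / 2 * s^2 / y^2
     = ((y^2 + 1) * y^2 + (y^2 - 1) * s^2 * (1 + s^2)) / (2 * y * y^2 * (1 + s^2))"
  proof -
    have "(y + 1/y) / 2 / d + (y - 1/y) / 2 * t / y^2 = ((y^2 + 1) * y^2 + (y^2 - 1) * t * d) / (2 * y * y^2 * d)"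
      if "d > 0" for d t :: real
      using assms that by (simp add: field_simps power2_eq_square)
    from this[OF s1] show ?thesis .
  qed
  ultimately show ?thesis using assms s1 by simp
qed

text \<open>In the coordinate \<open>w\<close> with \<open>z = sinh w\<close>, \<open>\<bar>Im w\<bar> < \<pi>/2\<close>, the function \<open>xi_bar\<close> becomes
  \<open>w/2 + sinh (2w)/4\<close>. The path is chosen so that \<open>tan (2 Im w)\<close> is the (negated) parameter and
  \<open>exp (4 Re w) = E + tan\<^sup>2 (2 Im w)\<close>; this moves so slowly to the right while \<open>Re w < 0\<close> that
  \<open>Im xi_bar\<close> stays monotonic.\<close>

lemma real_in_Z03: "of_real x \<in> Z03"
proof -
  \<comment> \<open>Chosen so that the parameter 0 gives w = arsinh x, that is, the point x. Its
    positivity yields s^2 < exp(4 Re w).\<close>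
  define E where "E = exp (4 * arsinh x)"
  have E: "E > 0" by (simp add: E_def)
  define P where "P = (\<lambda>s. ln (E + s^2) / 4)"
  define q where "q = (\<lambda>s::real. - arctan s / 2)"
  define w where "w = (\<lambda>s. complex_of_real (P s) + \<i> * of_real (q s))"
  define w1 where "w1 = (\<lambda>s. complex_of_real (s / (2 * (E + s^2))) + \<i> * of_real (- 1 / (2 * (1 + s^2))))"
  define w2 where "w2 = (\<lambda>s. complex_of_real ((2 * E - 2 * s^2) / (2 * (E + s^2))^2) + \<i> * of_real (4 * s / (2 * (1 + s^2))^2))"
  have Es: "E + s^2 > 0" "1 + s^2 > 0" for s :: real using E by (smt (verit) zero_le_power2)+
  have nz: "E + s^2 \<noteq> 0" "1 + s^2 \<noteq> 0" for s using Es[of s] by auto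
  have dw: "(w has_vector_derivative w1 s) (at s)" for s
  proof -
    have "(P has_real_derivative s / (2 * (E + s^2))) (at s)"
      unfolding P_def using Es[of s] by (auto intro!: derivative_eq_intros simp: field_simps)
    moreover have "(q has_real_derivative - 1 / (2 * (1 + s^2))) (at s)"
      unfolding q_def using Es[of s] by (auto intro!: derivative_eq_intros simp: field_simps)
    ultimately show ?thesis unfolding w_def w1_def
      by (intro has_vector_derivative_add has_vector_derivative_mult_right has_vector_derivative_of_real)
  qed
  have dw1: "(w1 has_vector_derivative w2 s) (at s)" for s
  proof -
    have "((\<lambda>s. s / (2 * (E + s^2))) has_real_derivative (2 * E - 2 * s^2) / (2 * (E + s^2))^2) (at s)"
      using Es[of s] by (auto intro!: derivative_eq_intros simp: power2_eq_square algebra_simps)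
    moreover have "((\<lambda>s. - 1 / (2 * (1 + s^2))) has_real_derivative 4 * s / (2 * (1 + s^2))^2) (at s)"
      using Es[of s] by (auto intro!: derivative_eq_intros simp: power2_eq_square)
    ultimately show ?thesis unfolding w1_def w2_def
      by (intro has_vector_derivative_add has_vector_derivative_mult_right has_vector_derivative_of_real)
  qed
  have w1_nz: "w1 s \<noteq> 0" for s
  proof -
    have "Im (w1 s) \<noteq> 0" using Es[of s] by (simp add: w1_def)
    then show ?thesis by auto
  qed
  have q: "- pi / 4 < q s" "q s < pi / 4" for s
    using arctan_bounded[of s] by (auto simp: q_def)
  have Rw: "Re (w s) = P s" "Im (w s) = q s" for s by (auto simp: w_def)
  \<comment> \<open>Because |Im w| < pi/4, cosh w is the principal root of z^2 + 1 and the path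
    avoids the cuts. Hence \<open>xi_bar\<close> itself is the continuation along the path.\<close>
  have cosh_pos: "Re (cosh (w s)) > 0" for s
    using q[of s] unfolding Re_ccosh Rw by (intro mult_pos_pos cos_gt_zero_pi cosh_real_pos) auto
  then have cosh_nz: "cosh (w s) \<noteq> 0" for s by (metis less_irrefl zero_complex.simps(1))
  have dsc: "(sinh has_field_derivative cosh z) (at z)" "(cosh has_field_derivative sinh z) (at z)" for z :: complex
    by (auto intro!: derivative_eq_intros)
  define \<gamma> where "\<gamma> = (\<lambda>s. sinh (w s))"
  have d\<gamma>: "(\<gamma> has_vector_derivative w1 s * cosh (w s)) (at s)" for s
    using field_vector_diff_chain_at[OF dw[of s] dsc(1)] unfolding \<gamma>_def o_def .
  have vd: "vector_derivative \<gamma> (at s) = w1 s * cosh (w s)" for s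
    using d\<gamma> by (rule vector_derivative_at)
  have g2: "(\<gamma> s)^2 + 1 = (cosh (w s))^2" for s by (simp add: \<gamma>_def cosh_square_eq)
  have csq: "csqrt ((\<gamma> s)^2 + 1) = cosh (w s)" for s
    unfolding g2 using cosh_pos by (intro csqrt_square) auto
  have nonneg: "(\<gamma> s)^2 + 1 \<notin> \<real>\<^sub>\<le>\<^sub>0" for s
  proof
    assume "(\<gamma> s)^2 + 1 \<in> \<real>\<^sub>\<le>\<^sub>0"
    then have "csqrt ((\<gamma> s)^2 + 1) = \<i> * of_real (sqrt \<bar>Re ((\<gamma> s)^2 + 1)\<bar>)"
      by (subst csqrt_of_real_nonpos[symmetric]) (auto simp: complex_nonpos_Reals_iff complex_eq_iff)
    then show False using cosh_pos[of s] unfolding csq by simp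
  qed
  have cw: "continuous_on UNIV w" "continuous_on UNIV w1"
    using dw dw1 by (auto intro!: continuous_at_imp_continuous_on has_vector_derivative_continuous)
  have "R2_path \<gamma>" unfolding R2_path_def
  proof (intro exI conjI allI)
    show "(\<gamma> has_vector_derivative w1 s * cosh (w s)) (at s)" for s by (rule d\<gamma>)
    have dc: "((\<lambda>s. cosh (w s)) has_vector_derivative w1 s * sinh (w s)) (at s)" for s
      using field_vector_diff_chain_at[OF dw[of s] dsc(2)] unfolding o_def .
    show "((\<lambda>s. w1 s * cosh (w s)) has_vector_derivative w1 s * (w1 s * sinh (w s)) + w2 s * cosh (w s)) (at s)" for s
      by (rule has_vector_derivative_mult[OF dw1 dc])
    have "continuous_on UNIV w2" unfolding w2_def
      using nz by (intro continuous_intros) (simp_all del: distrib_left_numeral)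
    then show "continuous_on UNIV (\<lambda>s. w1 s * (w1 s * sinh (w s)) + w2 s * cosh (w s))"
      using cw by (intro continuous_intros)
    show "w1 s * cosh (w s) \<noteq> 0" for s using w1_nz cosh_nz by simp
  qed
  moreover have dir: "tends_to_inf_dir \<theta> \<gamma> F" 
    if F: "filterlim P at_top F" and qF: "(q \<longlongrightarrow> \<theta>) F" for F \<theta>
  proof -
    \<comment> \<open>sinh w = (1/2) exp(w) (1 - exp(-2w)), so when Re w tends to infinity the
      direction of the path is governed by Im w alone.\<close>
    define v where "v = (\<lambda>s. 1 - exp (- 2 * w s))"
    have ge: "\<gamma> s = of_real (exp (P s) / 2) * cis (q s) * v s" for s
    proof -
      have "exp (w s) = of_real (exp (P s)) * cis (q s)"
        by (simp add: w_def exp_add cis_conv_exp flip: exp_of_real)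
      moreover have "\<gamma> s = exp (w s) / 2 * v s"
        by (simp add: \<gamma>_def v_def sinh_field_def right_diff_distrib exp_add[symmetric] diff_divide_distrib)
      ultimately show ?thesis by simp
    qed
    have v1: "(v \<longlongrightarrow> 1) F"
    proof -
      have "((\<lambda>s. exp (- 2 * w s)) \<longlongrightarrow> 0) F"
      proof (rule tendsto_norm_zero_cancel)
        have "filterlim (\<lambda>s. - 2 * P s) at_bot F"
          using F by (intro filterlim_tendsto_neg_mult_at_bot[OF tendsto_const]) auto
        then have "((\<lambda>s. exp (- 2 * P s)) \<longlongrightarrow> 0) F" by (rule filterlim_compose[OF exp_at_bot])
        then show "((\<lambda>s. cmod (exp (- 2 * w s))) \<longlongrightarrow> 0) F" by (simp add: Rw)
      qed
      from tendsto_diff[OF tendsto_const[of 1] this] show ?thesis by (simp add: v_def)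
    qed
    have "filterlim (\<lambda>s. cmod (v s) / 2 * exp (P s)) at_top F"
    proof (rule filterlim_tendsto_pos_mult_at_top)
      show "((\<lambda>s. cmod (v s) / 2) \<longlongrightarrow> cmod 1 / 2) F" by (intro tendsto_intros v1) auto
      show "filterlim (\<lambda>s. exp (P s)) at_top F" using F by (rule filterlim_compose[OF exp_at_top])
    qed simp
    moreover have "(\<lambda>s. cmod (\<gamma> s)) = (\<lambda>s. cmod (v s) / 2 * exp (P s))"
      by (simp add: ge norm_mult fun_eq_iff)
    ultimately have "filterlim \<gamma> at_infinity F"
      by (intro filterlim_norm_at_top_imp_at_infinity) (simp only:)
    moreover have "((\<lambda>s. sgn (\<gamma> s)) \<longlongrightarrow> cis \<theta>) F"
    proof -
      have "sgn (\<gamma> s) = cis (q s) * sgn (v s)" for s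
      proof -
        have "sgn (complex_of_real (exp (P s) / 2)) = 1" by (simp only: sgn_of_real) simp
        moreover have "sgn (cis (q s)) = cis (q s)" by (simp add: sgn_div_norm)
        ultimately show ?thesis unfolding ge sgn_mult by simp
      qed
      moreover have "((\<lambda>s. cis (q s) * sgn (v s)) \<longlongrightarrow> cis \<theta> * sgn 1) F"
        unfolding cis_conv_exp by (intro tendsto_intros qF v1) auto
      ultimately show ?thesis by simp
    qed
    ultimately show ?thesis by (simp add: tends_to_inf_dir_def)
  qed
  moreover have "tends_to_inf_dir (pi / 4) \<gamma> at_bot"
  proof (rule dir)
    show "filterlim P at_top at_bot" unfolding P_def by real_asymp
    have "((\<lambda>s. - arctan s / 2) \<longlongrightarrow> - (- (pi/2)) / 2) at_bot" by (intro tendsto_intros tendsto_arctan_at_bot) auto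
    then show "(q \<longlongrightarrow> pi / 4) at_bot" by (simp add: q_def)
  qed
  moreover have "tends_to_inf_dir (- pi / 4) \<gamma> at_top"
  proof (rule dir)
    show "filterlim P at_top at_top" unfolding P_def by real_asymp
    have "((\<lambda>s. - arctan s / 2) \<longlongrightarrow> - (pi/2) / 2) at_top" by (intro tendsto_intros tendsto_arctan_at_top) auto
    then show "(q \<longlongrightarrow> - pi / 4) at_top" by (simp add: q_def)
  qed
  moreover have "\<i> \<notin> range \<gamma>" "- \<i> \<notin> range \<gamma>"
  proof -
    have "(\<gamma> s)^2 + 1 \<noteq> 0" for s using cosh_nz by (simp add: g2)
    then have ne: "\<gamma> s \<noteq> z" if "z^2 + 1 = 0" for s z using that by metis
    have "\<gamma> s \<noteq> \<i>" "\<gamma> s \<noteq> - \<i>" for s using ne[of \<i> s] ne[of "- \<i>" s] by simp_all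
    then show "\<i> \<notin> range \<gamma>" "- \<i> \<notin> range \<gamma>" by (metis rangeE)+
  qed
  moreover have "\<exists>X. xi_bar_along \<gamma> X \<and> (mono (\<lambda>s. Im (X s)) \<or> antimono (\<lambda>s. Im (X s)))"
  proof (intro exI conjI disjI2)
    let ?X = "\<lambda>s. xi_bar (\<gamma> s)"
    have dX: "(?X has_vector_derivative cosh (w s) * (w1 s * cosh (w s))) (at s)" for s
      using field_vector_diff_chain_at[OF d\<gamma>[of s] xi_bar_DERIV[OF nonneg[of s]]] by (simp add: csq o_def mult_ac)
    show "xi_bar_along \<gamma> ?X"
      unfolding xi_bar_along_def vd
      using cw dX by (auto intro!: exI[of _ "\<lambda>s. cosh (w s)"] continuous_intros simp: g2)
    \<comment> \<open>Since cosh^2 w = (cosh 2w + 1)/2, the summand 1 contributes -1/(4 (1 + s^2)),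
      and the rest is a negative multiple of the expression in
      \<open>strip_monotone_ineq\<close>.\<close>
    have neg: "Im (cosh (w s) * (w1 s * cosh (w s))) \<le> 0" for s
    proof -
      define y where "y = exp (2 * P s)"
      have y: "y > 0" "y^2 = E + s^2"
      proof -
        have "y^2 = exp (4 * P s)" by (simp add: y_def power2_eq_square flip: exp_add)
        then show "y^2 = E + s^2" using Es[of s] by (simp add: P_def)
      qed (simp add: y_def)
      define C where "C = 1 / sqrt (1 + s^2)"
      have C: "C > 0" using Es[of s] by (simp add: C_def)
      have cs: "cos (2 * q s) = C" "sin (2 * q s) = - s * C"
        by (auto simp: q_def C_def cos_arctan sin_arctan)
      have "Im (cosh (w s) * (w1 s * cosh (w s))) = Im ((cosh (w s))^2 * w1 s)"
        by (simp add: power2_eq_square mult_ac)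
      also have "(cosh (w s))^2 = (cosh (2 * w s) + 1) / 2"
        by (simp add: cosh_double sinh_square_eq)
      also have "Im ((cosh (2 * w s) + 1) / 2 * w1 s) = 
         (cosh (2 * P s) * C + 1) / 2 * (- 1 / (2 * (1 + s^2))) + sinh (2 * P s) * (- s * C) / 2 * (s / (2 * (E + s^2)))"
      proof -
        have "Re ((cosh (2 * w s) + 1) / 2) = (cosh (2 * P s) * C + 1) / 2"
          "Im ((cosh (2 * w s) + 1) / 2) = sinh (2 * P s) * (- s * C) / 2"
          by (simp_all add: Re_ccosh Im_ccosh Rw cs)
        moreover have "Re (w1 s) = s / (2 * (E + s^2))" "Im (w1 s) = - 1 / (2 * (1 + s^2))"
          by (simp_all add: w1_def)
        ultimately show ?thesis by (simp only: times_complex.sel)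
      qed
      also have "\<dots> = - (1 / (4 * (1 + s^2)) + C / 4 * ((y + 1/y) / 2 / (1 + s^2) + (y - 1/y) / 2 * s^2 / y^2))"
      proof -
        have "exp (- (2 * P s)) = 1 / y" by (simp add: y_def exp_minus inverse_eq_divide)
        then have "cosh (2 * P s) = (y + 1/y) / 2" "sinh (2 * P s) = (y - 1/y) / 2"
          unfolding cosh_field_def sinh_field_def y_def by (simp_all only:)
        moreover have "h * (- s * C) / 2 * (s / (2 * Y)) = - (C / 4 * (h * s^2 / Y))" for h Y :: real
          by (simp add: power2_eq_square)
        moreover have "(c * C + 1) / 2 * (- 1 / (2 * d)) = - (1 / (4 * d) + C / 4 * (c / d))" for c d :: real
          by (cases "d = 0") (simp_all add: divide_simps)
        ultimately show ?thesis unfolding y(2) by (simp only: distrib_left[of "C / 4"] minus_add_distrib add.assoc)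
      qed
      also have "\<dots> \<le> 0"
      proof -
        have "C / 4 * ((y + 1/y) / 2 / (1 + s^2) + (y - 1/y) / 2 * s^2 / y^2) \<ge> 0"
          by (rule mult_nonneg_nonneg[OF _ strip_monotone_ineq]) (use y E C in auto)
        moreover have "1 / (4 * (1 + s^2)) \<ge> 0" using Es[of s] by simp
        ultimately show ?thesis by linarith
      qed
      finally show ?thesis .
    qed
    have dI: "((\<lambda>s. Im (?X s)) has_real_derivative Im (cosh (w s) * (w1 s * cosh (w s)))) (at s)" for s
      using bounded_linear.has_vector_derivative[OF bounded_linear_Im dX[of s]]
      unfolding has_real_derivative_iff_has_vector_derivative .
    show "antimono (\<lambda>s. Im (?X s))"
    proof (rule antimonoI)
      fix a b :: real assume "a \<le> b"
      then show "Im (?X b) \<le> Im (?X a)"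
        using DERIV_nonpos_imp_nonincreasing[of a b "\<lambda>s. Im (?X s)"] dI neg by meson
    qed
  qed
  ultimately have "admissible_path \<gamma>" by (auto simp: admissible_path_def)
  moreover have "\<gamma> 0 = of_real x"
    by (simp add: \<gamma>_def w_def P_def q_def E_def csinh_of_real)
  ultimately show ?thesis unfolding Z03_def by (intro CollectI exI[of _ \<gamma>]) (metis rangeI)
qed

section \<open>The expansion\<close>

lemma power_le_fact_exp:
  fixes r :: real
  assumes "r \<ge> 0"
  shows "r ^ n \<le> fact n * exp r"
proof -
  have "(\<Sum>k\<in>{n}. inverse (fact k) * r ^ k) \<le> (\<Sum>k. inverse (fact k) * r ^ k)"
    by (rule sum_le_suminf) (use assms summable_exp[of r] in auto)
  then have "inverse (fact n) * r ^ n \<le> exp r" by (simp add: exp_def divide_inverse mult.commute)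
  then have "fact n * (inverse (fact n) * r ^ n) \<le> fact n * exp r" by (intro mult_left_mono) auto
  then show ?thesis by (simp add: mult.assoc[symmetric])
qed

lemma recessive_ray_primitive:
  fixes u \<sigma> C :: real and w :: "complex \<Rightarrow> complex"
  assumes u: "u > 0" and \<sigma>: "\<sigma> = 1 \<or> \<sigma> = - 1" and hol: "w holomorphic_on UNIV"
    and w: "\<And>z. z \<in> weber_cone \<Longrightarrow> cmod (w z) \<le> C * exp (- (u * (\<sigma> * Im (z^2)) / 2))"
  shows "\<exists>J. (\<forall>z. (J has_field_derivative z^R * w z) (at z)) \<and> ((\<lambda>r. J (of_real r * cis (\<sigma> * pi / 4))) \<longlongrightarrow> 0) at_top"
proof (rule primitive_from_infinity)
  show "(\<lambda>z. z^R * w z) holomorphic_on UNIV" by (intro holomorphic_intros hol)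
  fix r :: real assume r: "r \<ge> 0"
  let ?p = "of_real r * cis (\<sigma> * pi / 4)"
  have C: "C \<ge> 0" using w[of 0] by (auto intro: order_trans[OF norm_ge_zero])
  have p: "Re ?p = r * (sqrt 2 / 2)" "\<sigma> * Im ?p = r * (sqrt 2 / 2)" using \<sigma> by (auto simp: cos_45 sin_45)
  have r0: "r * (sqrt 2 / 2) \<ge> 0" using r by simp
  define X where "X = Re ?p"
  define Y where "Y = Im ?p"
  have "X = r * (sqrt 2 / 2)" "\<sigma> * Y = r * (sqrt 2 / 2)" using p by (simp_all only: X_def Y_def)
  then have "\<bar>Y\<bar> \<le> 2 * X" using \<sigma> r0 by auto
  then have pc: "?p \<in> weber_cone" by (simp only: X_def Y_def mem_Collect_eq)
  have "\<sigma> * Im (?p^2) = r^2"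
  proof -
    have "\<sigma> * Im (?p^2) = 2 * Re ?p * (\<sigma> * Im ?p)" unfolding Im_power2 by (simp only: mult_ac)
    also have "\<dots> = r^2 * (2 * ((sqrt 2 / 2) * (sqrt 2 / 2)))" unfolding p by (simp only: power2_eq_square mult_ac)
    also have "2 * ((sqrt 2 / 2) * (sqrt 2 / 2)) = (1::real)" by simp
    finally show ?thesis by simp
  qed
  then have wp: "cmod (w ?p) \<le> C * exp (- (u * r^2 / 2))" using w[OF pc] by simp
  \<comment> \<open>The square is completed with 2 instead of 1: one factor exp(r) is spent on the
    bound for r^R, and exp(-r) has to remain.\<close>
  have "(u * r - 2)^2 / (2 * u) \<ge> 0" using u by simp
  also have "(u * r - 2)^2 / (2 * u) = u * r^2 / 2 - 2 * r + 2 / u" using u by (simp add: field_simps power2_eq_square)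
  finally have "r + - (u * r^2 / 2) \<le> 2 / u + - r" by simp
  then have e: "exp (r + - (u * r^2 / 2)) \<le> exp (2 / u + - r)" by (simp only: exp_le_cancel_iff)
  have "cmod (?p^R * w ?p) = r ^ R * cmod (w ?p)" using r by (simp add: norm_mult norm_power)
  also have "\<dots> \<le> (fact R * exp r) * (C * exp (- (u * r^2 / 2)))"
    using power_le_fact_exp[OF r] wp r C by (intro mult_mono) auto
  also have "\<dots> = fact R * C * exp (r + - (u * r^2 / 2))" unfolding exp_add by (simp only: mult_ac)
  also have "\<dots> \<le> fact R * C * exp (2 / u + - r)" using e C by (intro mult_left_mono) auto
  also have "\<dots> = (fact R * C * exp (2 / u)) * exp (- r)" unfolding exp_add by (simp only: mult_ac)
  finally show "cmod (?p^R * w ?p) \<le> (fact R * C * exp (2 / u)) * exp (- r)" .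
qed

text \<open>A dominant solution times a primitive of the recessive one: the exponentials cancel and
  only the algebraic factor remains.\<close>

lemma mult_exp_cancel_le:
  fixes x y C a d t :: real
  assumes "x \<le> C * exp t" "y \<le> a / d * exp (- t)" "x \<ge> 0" "y \<ge> 0"
  shows "x * y \<le> C * a / d"
proof -
  have "x * y \<le> (C * exp t) * (a / d * exp (- t))" using assms by (intro mult_mono) auto
  also have "\<dots> = C * (a / d) * (exp t * exp (- t))" by (simp only: mult_ac)
  also have "exp t * exp (- t) = 1" by (simp flip: exp_add)
  finally show ?thesis by simp
qed

text \<open>This supplies the hypotheses of \<open>admissible_path_error_bound\<close>. The growth
  part compares with the sum of \<open>N\<close> terms and returns to \<open>n\<close> terms
  afterwards, because the remainder after \<open>N\<close> terms has a residual that decays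
  quadratically.\<close>

theorem weber_WR03_remainder:
  fixes R n :: nat and u :: real
  assumes u: "u > 0" and n: "real n > real R / 4 - 3 / 8"
  defines "eps \<equiv> \<lambda>z. weber_WR03 R (- u / 2) (of_real (sqrt (2 * u)) * z) / of_real ((2 * u) powr (real R / 2 + 1))
     - partial_sum u R n z"
  shows "\<exists>eps1 eps2 \<rho> C. (\<forall>z. z^2 + 1 \<noteq> 0 \<longrightarrow>
      (eps has_field_derivative eps1 z) (at z) \<and> (eps1 has_field_derivative eps2 z) (at z) \<and>
      eps2 z + of_real (u^2) * (z^2 + 1) * eps z = (- 1)^(n + 1) / of_real (u^(2 * n)) * (z^2 + 1) * G_bar R n z) \<and>
    (\<forall>z. cmod z \<ge> \<rho> \<longrightarrow> Re z > 0 \<longrightarrow> Re z \<le> 3/2 * \<bar>Im z\<bar> \<longrightarrow> \<bar>Im z\<bar> \<le> 3/2 * Re z \<longrightarrow>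
       sqrt (cmod z) * cmod (eps z) \<le> C \<and> cmod (eps1 z) \<le> C)"
proof -
  define k where "k = sqrt (2 * u)"
  define w0 where "w0 = (\<lambda>z. weber_W 0 (of_real (- u / 2)) (of_real k * z))"
  define w3 where "w3 = (\<lambda>z. weber_W 3 (of_real (- u / 2)) (of_real k * z))"
  have ws: "w0 holomorphic_on UNIV" "w3 holomorphic_on UNIV"
    "deriv (deriv w0) z = - (of_real (u^2) * (z^2 + 1) * w0 z)"
    "deriv (deriv w3) z = - (of_real (u^2) * (z^2 + 1) * w3 z)"
    "w0 z * deriv w3 z - deriv w0 z * w3 z = - \<i> * of_real k * of_real (exp (pi * u / 4))"
    "\<exists>C. \<forall>z. \<bar>Im z\<bar> \<le> 2 * Re z \<longrightarrow> cmod (w0 z) \<le> C * exp (- (u * Im (z^2) / 2)) \<and> cmod (w3 z) \<le> C * exp (u * Im (z^2) / 2)"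
    for z
    unfolding w0_def w3_def k_def by (rule weber_W_scaled[OF u])+
  have k: "k > 0" using u by (simp add: k_def)
  from ws(6) obtain C where Cb: "\<forall>z. \<bar>Im z\<bar> \<le> 2 * Re z \<longrightarrow>
      cmod (w0 z) \<le> C * exp (- (u * Im (z^2) / 2)) \<and> cmod (w3 z) \<le> C * exp (u * Im (z^2) / 2)" ..
  have C: "cmod (w0 z) \<le> C * exp (- (u * Im (z^2) / 2))" "cmod (w3 z) \<le> C * exp (u * Im (z^2) / 2)"
    if "\<bar>Im z\<bar> \<le> 2 * Re z" for z
    using conjunct1[OF Cb[rule_format, OF that]] conjunct2[OF Cb[rule_format, OF that]] .
  have C0: "C \<ge> 0" using C(1)[of 0] by (auto intro: order_trans[OF norm_ge_zero])
  have w0: "cmod (w0 z) \<le> C * exp (- (u * (1 * Im (z^2)) / 2))" if "z \<in> weber_cone" for z using C(1) that by simp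
  have w3: "cmod (w3 z) \<le> C * exp (- (u * (- 1 * Im (z^2)) / 2))" if "z \<in> weber_cone" for z using C(2) that by simp
  from recessive_ray_primitive[OF u disjI1[OF refl] ws(1) w0, of R] obtain J0 where
    "(\<forall>z. (J0 has_field_derivative z^R * w0 z) (at z)) \<and> ((\<lambda>r. J0 (of_real r * cis (1 * pi / 4))) \<longlongrightarrow> 0) at_top" ..
  note J = this
  have J0: "(J0 has_field_derivative z^R * w0 z) (at z)" "((\<lambda>r. J0 (of_real r * cis (1 * pi / 4))) \<longlongrightarrow> 0) at_top" for z
    using J[THEN conjunct1, rule_format] J[THEN conjunct2] .
  from recessive_ray_primitive[OF u disjI2[OF refl] ws(2) w3, of R] obtain J3 where
    "(\<forall>z. (J3 has_field_derivative z^R * w3 z) (at z)) \<and> ((\<lambda>r. J3 (of_real r * cis (- 1 * pi / 4))) \<longlongrightarrow> 0) at_top" ..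
  note J = this
  have J3: "(J3 has_field_derivative z^R * w3 z) (at z)" "((\<lambda>r. J3 (of_real r * cis (- 1 * pi / 4))) \<longlongrightarrow> 0) at_top" for z
    using J[THEN conjunct1, rule_format] J[THEN conjunct2] .
  define \<omega> where "\<omega> = - \<i> * of_real k * of_real (exp (pi * u / 4))"
  have \<omega>: "\<omega> \<noteq> 0" using k by (simp add: \<omega>_def)
  have wr: "w0 z * deriv w3 z - deriv w0 z * w3 z = \<omega>" for z using ws(5) by (simp add: \<omega>_def)
  define Wt where "Wt = (\<lambda>z. (w3 z * J0 z - w0 z * J3 z) / \<omega>)"
  have WR: "weber_WR03 R (- u / 2) (of_real k * z) / of_real ((2 * u) powr (real R / 2 + 1)) = Wt z" for z
  proof -
    have int: "integral_from_inf \<theta> (\<lambda>t. t^R * W t) (of_real k * z) = of_real (k^(R + 1)) * J z"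
      if J: "\<And>z. (J has_field_derivative z^R * W (of_real k * z)) (at z)"
        and lim: "((\<lambda>r. J (of_real r * cis \<theta>)) \<longlongrightarrow> 0) at_top" for \<theta> W J
    proof -
      have "integral_from_inf \<theta> (\<lambda>t. t^R * W t) (of_real k * z) = of_real (k^(R + 1)) * J (of_real k * z / of_real k)"
      proof (rule integral_from_inf_eq)
        fix t
        have "((\<lambda>t. t / complex_of_real k) has_field_derivative 1 / complex_of_real k) (at t)"
          by (rule DERIV_cdivide[OF DERIV_ident])
        from DERIV_cmult[OF DERIV_chain2[where f=J, OF J this], of "of_real (k^(R + 1))"]
        show "((\<lambda>t. of_real (k^(R + 1)) * J (t / of_real k)) has_field_derivative t^R * W t) (at t)"
          using k by (simp add: power_divide)
      next
        have "filterlim (\<lambda>r. r * (1 / k)) at_top at_top"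
          using k by (intro filterlim_at_top_mult_tendsto_pos[OF tendsto_const] filterlim_ident) auto
        from tendsto_mult_right_zero[OF filterlim_compose[OF lim this], of "of_real (k^(R + 1))"]
        show "((\<lambda>r. of_real (k^(R + 1)) * J (of_real r * cis \<theta> / of_real k)) \<longlongrightarrow> 0) at_top"
          by simp
      qed
      then show ?thesis using k by simp
    qed
    have I0: "integral_from_inf (pi / 4) (\<lambda>t. t^R * weber_W 0 (of_real (- u / 2)) t) (of_real k * z) = of_real (k^(R + 1)) * J0 z"
      by (rule int) (use J0 in \<open>simp_all add: w0_def\<close>)
    have I3: "integral_from_inf (- pi / 4) (\<lambda>t. t^R * weber_W 3 (of_real (- u / 2)) t) (of_real k * z) = of_real (k^(R + 1)) * J3 z"
      by (rule int) (use J3 in \<open>simp_all add: w3_def\<close>)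
    \<comment> \<open>One factor k comes from the Wronskian and R + 1 factors from substituting t =
      k t' in the integrals.\<close>
    have p: "(2 * u) powr (real R / 2 + 1) = k * k^(R + 1)"
    proof -
      have "k^(R + 2) = ((2 * u) powr (1/2))^(R + 2)" using u by (simp add: k_def powr_half_sqrt)
      also have "\<dots> = (2 * u) powr (real (R + 2) * (1/2))" using u by (subst powr_power) auto
      also have "real (R + 2) * (1/2) = real R / 2 + 1" by simp
      finally show ?thesis by simp
    qed
    \<comment> \<open>The prefactor of \<open>weber_WR03\<close> is k times the reciprocal of this
      Wronskian, which makes the coefficient of z^R in the scaled equation exactly 1.\<close>
    have e: "1 / \<omega> = \<i> * of_real (exp (pi * (- u / 2) / 2)) / of_real k"
    proof -
      have "exp (pi * (- u / 2) / 2) = 1 / exp (pi * u / 4)" by (simp add: exp_minus inverse_eq_divide)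
      then have "(\<i> * of_real (exp (pi * (- u / 2) / 2)) / of_real k) * \<omega> = 1" using k by (simp add: \<omega>_def)
      then show ?thesis using nonzero_eq_divide_eq[OF \<omega>] by metis
    qed
    have "weber_WR03 R (- u / 2) (of_real k * z) = \<i> * of_real (exp (pi * (- u / 2) / 2)) *
       (w3 z * (of_real (k^(R + 1)) * J0 z) - w0 z * (of_real (k^(R + 1)) * J3 z))"
      unfolding weber_WR03_def I0 I3 w0_def w3_def exp_of_real ..
    also have "\<dots> / of_real ((2 * u) powr (real R / 2 + 1))
       = (\<i> * of_real (exp (pi * (- u / 2) / 2)) / of_real k) * (w3 z * J0 z - w0 z * J3 z)"
      unfolding p using k by (simp add: field_simps)
    finally show ?thesis unfolding e[symmetric] by (simp add: Wt_def)
  qed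
  have eps: "eps = (\<lambda>z. Wt z - partial_sum u R n z)" unfolding eps_def using WR by (simp add: k_def fun_eq_iff)
  let ?S = "partial_sum u R n"
  define Wt1 where "Wt1 = (\<lambda>z. (deriv w3 z * J0 z - deriv w0 z * J3 z) / \<omega>)"
  define eps1 where "eps1 = (\<lambda>z. Wt1 z - deriv ?S z)"
  define eps2 where "eps2 = (\<lambda>z. (z^R - of_real (u^2) * (z^2 + 1) * Wt z) - deriv (deriv ?S) z)"
  have dw: "(w0 has_field_derivative deriv w0 z) (at z)" "(deriv w0 has_field_derivative deriv (deriv w0) z) (at z)"
    "(w3 has_field_derivative deriv w3 z) (at z)" "(deriv w3 has_field_derivative deriv (deriv w3) z) (at z)" for z
    using ws(1,2) by (auto intro!: holomorphic_derivI holomorphic_deriv)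
  have dWt: "(Wt has_field_derivative Wt1 z) (at z)" for z
  proof -
    have "(Wt has_field_derivative ((deriv w3 z * J0 z + z^R * w0 z * w3 z) - (deriv w0 z * J3 z + z^R * w3 z * w0 z)) / \<omega>) (at z)"
      unfolding Wt_def by (intro DERIV_cdivide DERIV_diff DERIV_mult dw J0(1) J3(1))
    then show ?thesis by (simp add: Wt1_def mult_ac)
  qed
  have dWt1: "(Wt1 has_field_derivative z^R - of_real (u^2) * (z^2 + 1) * Wt z) (at z)" for z
  proof -
    have "(Wt1 has_field_derivative ((deriv (deriv w3) z * J0 z + z^R * w0 z * deriv w3 z)
        - (deriv (deriv w0) z * J3 z + z^R * w3 z * deriv w0 z)) / \<omega>) (at z)"
      unfolding Wt1_def by (intro DERIV_cdivide DERIV_diff DERIV_mult dw J0(1) J3(1))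
    moreover have "((deriv (deriv w3) z * J0 z + z^R * w0 z * deriv w3 z)
        - (deriv (deriv w0) z * J3 z + z^R * w3 z * deriv w0 z))
       = z^R * (w0 z * deriv w3 z - deriv w0 z * w3 z) - of_real (u^2) * (z^2 + 1) * (w3 z * J0 z - w0 z * J3 z)"
      unfolding ws(3,4) by (simp add: algebra_simps)
    moreover have "\<dots> / \<omega> = z^R - of_real (u^2) * (z^2 + 1) * Wt z"
    proof -
      have "(a * \<omega> - b * x) / \<omega> = a - b * (x / \<omega>)" for a b x using \<omega> by (simp add: diff_divide_distrib)
      then show ?thesis unfolding wr Wt_def .
    qed
    ultimately show ?thesis by simp
  qed
  have d1: "(eps has_field_derivative eps1 z) (at z)" and d2: "(eps1 has_field_derivative eps2 z) (at z)"
    and ode: "eps2 z + of_real (u^2) * (z^2 + 1) * eps z = (- 1)^(n + 1) / of_real (u^(2 * n)) * (z^2 + 1) * G_bar R n z"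
    if z: "z^2 + 1 \<noteq> 0" for z
  proof -
    show "(eps has_field_derivative eps1 z) (at z)" unfolding eps eps1_def
      by (intro DERIV_diff dWt deriv_DERIV partial_sum_holomorphic z)
    show "(eps1 has_field_derivative eps2 z) (at z)" unfolding eps1_def eps2_def
      by (intro DERIV_diff dWt1 deriv_DERIV deriv_holomorphic_pm_i partial_sum_holomorphic z)
    have "eps2 z + of_real (u^2) * (z^2 + 1) * eps z
       = z^R - (deriv (deriv ?S) z + of_real (u^2) * (z^2 + 1) * ?S z)"
      unfolding eps2_def eps by (simp add: algebra_simps)
    then show "eps2 z + of_real (u^2) * (z^2 + 1) * eps z = (- 1)^(n + 1) / of_real (u^(2 * n)) * (z^2 + 1) * G_bar R n z"
      unfolding partial_sum_ODE[OF u z] by simp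
  qed
  \<comment> \<open>Large enough for the residual to be O(|z|^(-2)), as R - 4 N <= -4, and not
    smaller than \<open>n\<close>.\<close>
  define N where "N = R + n + 1"
  have N: "real R - 4 * real N \<le> - 2" by (simp add: N_def)
  define SN where "SN = partial_sum u R N"
  define f where "f = (\<lambda>z. - ((- 1)^N / of_real (u^(2 * N)) * ((z^2 + 1) * G_bar R N z)))"
  define K0 where "K0 = (\<lambda>z. J0 z - (deriv SN z * w0 z - SN z * deriv w0 z))"
  define K3 where "K3 = (\<lambda>z. J3 z - (deriv SN z * w3 z - SN z * deriv w3 z))"
  obtain A0 where "recessive_primitive u 1 C A0 f w0 K0"
    using recessive_primitive_residual[OF u disjI1[OF refl] ws(1) ws(3) w0 J0 N]
    unfolding f_def K0_def SN_def by blast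
  then interpret rp0: recessive_primitive u 1 C A0 f w0 K0 .
  obtain A3 where "recessive_primitive u (- 1) C A3 f w3 K3"
    using recessive_primitive_residual[OF u disjI2[OF refl] ws(2) ws(4) w3 J3 N]
    unfolding f_def K3_def SN_def by blast
  then interpret rp3: recessive_primitive u "- 1" C A3 f w3 K3 .
  \<comment> \<open>Passing from \<open>J0\<close>, \<open>J3\<close> to \<open>K0\<close>,
    \<open>K3\<close> cancels the terms with the derivative of \<open>SN\<close>; those with
    \<open>SN\<close> combine to \<open>SN\<close> times the Wronskian.\<close>
  have WS: "Wt z - SN z = (w3 z * K0 z - w0 z * K3 z) / \<omega>" for z
  proof -
    have "w3 z * K0 z - w0 z * K3 z = (w3 z * J0 z - w0 z * J3 z) - SN z * (w0 z * deriv w3 z - deriv w0 z * w3 z)"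
      by (simp add: K0_def K3_def algebra_simps)
    then show ?thesis unfolding wr using \<omega> by (simp add: Wt_def diff_divide_distrib)
  qed
  define a0 where "a0 = A0 * C * exp (1 / (2 * u))"
  define a3 where "a3 = A3 * C * exp (1 / (2 * u))"
  define b0 where "b0 = (cmod (K0 0) + A0 * C) * 16 / (3 * u) + 2 * A0 * C"
  define b3 where "b3 = (cmod (K3 0) + A3 * C) * 16 / (3 * u) + 2 * A3 * C"
  define D where "D = (C * (a0 + a3) + C * (b0 + b3)) / cmod \<omega>"
  have nonneg: "a0 \<ge> 0" "a3 \<ge> 0" "b0 \<ge> 0" "b3 \<ge> 0"
    using rp0.A_nonneg rp3.A_nonneg C0 u by (auto simp: a0_def a3_def b0_def b3_def)
  \<comment> \<open>Two sectors around the arguments pi/4 and -pi/4. On each, |Im (z^2)| >= |z|^2/2,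
    so one primitive is at its near end and the other at its far end.\<close>
  define E where "E = {z::complex. \<bar>Im z\<bar> \<le> 2 * Re z \<and> Re z \<le> 2 * \<bar>Im z\<bar>}"
  have main: "cmod (Wt z - SN z) \<le> D / cmod z" if z: "z \<in> E" "cmod z \<ge> 2" for z
  proof -
    have zc: "z \<in> weber_cone" using z by (auto simp: E_def)
    have Re0: "Re z \<ge> 0" using zc by auto
    have big: "2 * Re z * \<bar>Im z\<bar> \<ge> (cmod z)^2 / 2"
    proof -
      have "Re z \<le> 2 * \<bar>Im z\<bar>" "\<bar>Im z\<bar> \<le> 2 * Re z" using z by (auto simp: E_def)
      from mult_left_mono[OF this(1) Re0] mult_left_mono[OF this(2) abs_ge_zero]
      have "Re z * Re z \<le> Re z * (2 * \<bar>Im z\<bar>)" "\<bar>Im z\<bar> * \<bar>Im z\<bar> \<le> \<bar>Im z\<bar> * (2 * Re z)" .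
      moreover have "(cmod z)^2 = Re z * Re z + \<bar>Im z\<bar> * \<bar>Im z\<bar>" unfolding cmod_power2 by (simp add: power2_eq_square)
      ultimately show ?thesis by (simp add: algebra_simps)
    qed
    define m where "m = cmod z"
    have m: "m \<ge> 2" using z by (simp add: m_def)
    have sq: "x / m^2 \<le> x / m" if "x \<ge> 0" for x
      using that m by (intro divide_left_mono) (auto simp: power2_eq_square)
    have mono: "x / m \<le> y / m" if "x \<le> y" for x y using that m by (simp add: divide_right_mono)
    have "cmod (w3 z) * cmod (K0 z) + cmod (w0 z) * cmod (K3 z) \<le> (C * (a0 + a3) + C * (b0 + b3)) / m"
    proof (cases "Im z \<ge> 0")
      case True
      have I: "Im (z^2) \<ge> m^2 / 2" using big True by (simp add: Im_power2 m_def)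
      have "cmod (K0 z) \<le> a0 / m^2 * exp (- (u * (1 * Im (z^2)) / 2))"
        unfolding a0_def m_def by (rule rp0.near_end_bound[OF zc]) (use True m in \<open>auto simp: m_def\<close>)
      then have "cmod (w3 z) * cmod (K0 z) \<le> C * a0 / m^2"
        by (intro mult_exp_cancel_le[where t="u * Im (z^2) / 2"]) (use C(2) zc in auto)
      also have "\<dots> \<le> C * a0 / m" using C0 nonneg by (intro sq) auto
      finally have 1: "cmod (w3 z) * cmod (K0 z) \<le> C * a0 / m" .
      have "cmod (K3 z) \<le> b3 / m * exp (- (u * (- 1 * Im (z^2)) / 2))"
        unfolding b3_def m_def by (rule rp3.far_end_bound[OF zc]) (use I m in \<open>auto simp: m_def\<close>)
      then have "cmod (w0 z) * cmod (K3 z) \<le> C * b3 / m"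
        by (intro mult_exp_cancel_le[where t="- (u * Im (z^2) / 2)"]) (use C(1) zc in auto)
      with 1 have "cmod (w3 z) * cmod (K0 z) + cmod (w0 z) * cmod (K3 z) \<le> (C * a0 + C * b3) / m"
        by (simp add: add_divide_distrib)
      also have "\<dots> \<le> (C * (a0 + a3) + C * (b0 + b3)) / m"
        using nonneg C0 by (intro mono add_mono mult_left_mono) auto
      finally show ?thesis .
    next
      case False
      have I: "- Im (z^2) \<ge> m^2 / 2" using big False by (simp add: Im_power2 m_def)
      have "cmod (K3 z) \<le> a3 / m^2 * exp (- (u * (- 1 * Im (z^2)) / 2))"
        unfolding a3_def m_def by (rule rp3.near_end_bound[OF zc]) (use False m in \<open>auto simp: m_def\<close>)
      then have "cmod (w0 z) * cmod (K3 z) \<le> C * a3 / m^2"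
        by (intro mult_exp_cancel_le[where t="- (u * Im (z^2) / 2)"]) (use C(1) zc in auto)
      also have "\<dots> \<le> C * a3 / m" using C0 nonneg by (intro sq) auto
      finally have 1: "cmod (w0 z) * cmod (K3 z) \<le> C * a3 / m" .
      have "cmod (K0 z) \<le> b0 / m * exp (- (u * (1 * Im (z^2)) / 2))"
        unfolding b0_def m_def by (rule rp0.far_end_bound[OF zc]) (use I m in \<open>auto simp: m_def\<close>)
      then have "cmod (w3 z) * cmod (K0 z) \<le> C * b0 / m"
        by (intro mult_exp_cancel_le[where t="u * Im (z^2) / 2"]) (use C(2) zc in auto)
      with 1 have "cmod (w3 z) * cmod (K0 z) + cmod (w0 z) * cmod (K3 z) \<le> (C * a3 + C * b0) / m"
        by (simp add: add_divide_distrib)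
      also have "\<dots> \<le> (C * (a0 + a3) + C * (b0 + b3)) / m"
        using nonneg C0 by (intro mono add_mono mult_left_mono) auto
      finally show ?thesis .
    qed
    note le = this
    have "cmod (Wt z - SN z) = cmod (w3 z * K0 z - w0 z * K3 z) / cmod \<omega>" unfolding WS by (rule norm_divide)
    also have "\<dots> \<le> (cmod (w3 z) * cmod (K0 z) + cmod (w0 z) * cmod (K3 z)) / cmod \<omega>"
      using norm_triangle_ineq4[of "w3 z * K0 z" "w0 z * K3 z"] by (intro divide_right_mono) (auto simp: norm_mult)
    also have "\<dots> \<le> (C * (a0 + a3) + C * (b0 + b3)) / m / cmod \<omega>" using le by (intro divide_right_mono) auto
    finally show ?thesis by (simp add: D_def m_def mult.commute)
  qed
  have D: "D \<ge> 0" using nonneg C0 by (simp add: D_def)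
  have "power_growth (\<lambda>z. \<Sum>s\<in>{n..<N}. (- 1)^(s + 1) / of_real (u^(2 * s + 2)) * G_bar R s z) (- 1/2)"
  proof (intro power_growth_sum power_growth_cmult power_growth_mono[OF G_bar_growth])
    fix s assume "s \<in> {n..<N}"
    then have "real n \<le> real s" by simp
    then show "real R - 2 - 4 * real s \<le> - 1/2" using n by linarith
  qed auto
  moreover have SNS: "SN z - ?S z = (\<Sum>s\<in>{n..<N}. (- 1)^(s + 1) / of_real (u^(2 * s + 2)) * G_bar R s z)" for z
  proof -
    have "{..<N} = {..<n} \<union> {n..<N}" by (auto simp: N_def)
    then show ?thesis unfolding SN_def partial_sum_def by (simp add: sum.union_disjoint ivl_disj_int)
  qed
  ultimately obtain C1 \<rho> where C1: "\<rho> \<ge> 2" "\<And>z. cmod z \<ge> \<rho> \<Longrightarrow> cmod (SN z - ?S z) \<le> C1 * cmod z powr (- 1/2)"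
    unfolding power_growth_def by (metis (no_types, lifting))
  define B where "B = D + \<bar>C1\<bar>"
  have wide: "sqrt (cmod z) * cmod (eps z) \<le> B" "cmod (eps z) \<le> B" if z: "z \<in> E" "cmod z \<ge> \<rho>" for z
  proof -
    define m where "m = cmod z"
    have m: "m \<ge> 2" using z C1(1) by (simp add: m_def)
    have s1: "sqrt m \<ge> 1" using m by simp
    have sm: "sqrt m * m powr (- 1/2) = 1"
      using m by (simp add: powr_half_sqrt[symmetric] flip: powr_add)
    have "eps z = (Wt z - SN z) + (SN z - ?S z)" by (simp add: eps)
    then have "cmod (eps z) \<le> cmod (Wt z - SN z) + cmod (SN z - ?S z)" by (metis norm_triangle_ineq)
    also have "\<dots> \<le> D / m + \<bar>C1\<bar> * m powr (- 1/2)"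
    proof (intro add_mono)
      show "cmod (Wt z - SN z) \<le> D / m" unfolding m_def by (rule main) (use z m in \<open>auto simp: m_def\<close>)
      have "C1 * m powr (- 1/2) \<le> \<bar>C1\<bar> * m powr (- 1/2)" by (intro mult_right_mono) auto
      then show "cmod (SN z - ?S z) \<le> \<bar>C1\<bar> * m powr (- 1/2)" using C1(2)[OF z(2)] by (simp add: m_def)
    qed
    finally have "sqrt m * cmod (eps z) \<le> sqrt m * (D / m + \<bar>C1\<bar> * m powr (- 1/2))" using m by (intro mult_left_mono) auto
    also have "\<dots> = D * (sqrt m / m) + \<bar>C1\<bar> * (sqrt m * m powr (- 1/2))" by (simp add: algebra_simps)
    also have "\<dots> \<le> D * 1 + \<bar>C1\<bar> * 1"
    proof (intro add_mono mult_left_mono)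
      have "sqrt m * 1 \<le> sqrt m * sqrt m" using s1 by (intro mult_left_mono) auto
      then show "sqrt m / m \<le> 1" using m by simp
    qed (use D sm in auto)
    finally show 1: "sqrt (cmod z) * cmod (eps z) \<le> B" by (simp add: B_def m_def)
    have "1 * cmod (eps z) \<le> sqrt m * cmod (eps z)" using s1 by (intro mult_right_mono) auto
    then show "cmod (eps z) \<le> B" using 1 by (simp add: m_def)
  qed
  have "cmod (eps1 z) \<le> B" "z \<in> E" "cmod z \<ge> \<rho>"
    if z: "cmod z \<ge> \<rho> + 15" "Re z > 0" "Re z \<le> 3/2 * \<bar>Im z\<bar>" "\<bar>Im z\<bar> \<le> 3/2 * Re z" for z
  proof -
    \<comment> \<open>Both coordinates have modulus at least 6, and (3/2) x + 1 <= 2 (x - 1) holds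
      exactly for x >= 6. So the unit disc around a point of the sectors with ratio 3/2 stays in
      those with ratio 2, where \<open>eps\<close> is already bounded.\<close>
    have "cmod z \<le> \<bar>Re z\<bar> + \<bar>Im z\<bar>" by (rule cmod_le)
    then have l: "Re z \<ge> 6" "\<bar>Im z\<bar> \<ge> 6" using z C1(1) by linarith+
    have ball: "x \<in> E \<and> cmod x \<ge> \<rho>" if "x \<in> cball z 1" for x
    proof -
      have d: "cmod (z - x) \<le> 1" using that by (simp add: dist_norm)
      have "\<bar>Re z - Re x\<bar> \<le> 1" "\<bar>Im z - Im x\<bar> \<le> 1"
        using d abs_Re_le_cmod[of "z - x"] abs_Im_le_cmod[of "z - x"] by auto
      moreover have "cmod z \<le> cmod x + cmod (z - x)" by (rule norm_triangle_sub)
      ultimately show ?thesis using l z d unfolding E_def by auto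
    qed
    then show "z \<in> E" "cmod z \<ge> \<rho>" by auto
    have sub: "cball z 1 \<subseteq> {z. z^2 + 1 \<noteq> 0}"
    proof
      fix x assume "x \<in> cball z 1"
      then have "cmod x \<ge> 2" using ball[of x] C1(1) by linarith
      then show "x \<in> {z. z^2 + 1 \<noteq> 0}" using norm_square_plus_one_ge(2) by simp
    qed
    have hol: "eps holomorphic_on cball z 1"
      unfolding holomorphic_on_def field_differentiable_def
      using d1 sub has_field_derivative_at_within by blast
    have "cmod ((deriv ^^ 1) eps z) \<le> fact 1 * B / 1 ^ 1"
    proof (rule Cauchy_inequality)
      show "eps holomorphic_on ball z 1" using hol by (rule holomorphic_on_subset) auto
      show "continuous_on (cball z 1) eps" using hol by (rule holomorphic_on_imp_continuous_on)
      fix x assume "cmod (z - x) = 1"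
      then show "cmod (eps x) \<le> B" using ball[of x] by (intro wide) (auto simp: dist_norm)
    qed auto
    moreover have "z \<in> cball z 1" by simp
    then have "z^2 + 1 \<noteq> 0" using sub by blast
    then have "deriv eps z = eps1 z" by (intro DERIV_imp_deriv d1)
    ultimately show "cmod (eps1 z) \<le> B" by simp
  qed
  note narrow = this
  show ?thesis
  proof (rule exI[of _ eps1], rule exI[of _ eps2], rule exI[of _ "\<rho> + 15"], rule exI[of _ B],
      intro conjI allI impI)
    fix z assume z: "cmod z \<ge> \<rho> + 15" "Re z > 0" "Re z \<le> 3/2 * \<bar>Im z\<bar>" "\<bar>Im z\<bar> \<le> 3/2 * Re z"
    show "cmod (eps1 z) \<le> B" by (rule narrow(1)[OF z])
    show "sqrt (cmod z) * cmod (eps z) \<le> B" by (rule wide(1)[OF narrow(2,3)[OF z]])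
  qed (use d1 d2 ode in auto)
qed

theorem mainTheorem14:
  fixes R n :: nat
  assumes "n \<ge> 1" and "real n > real R / 4 - 3 / 8"
  shows "(\<exists>err :: real \<Rightarrow> complex \<Rightarrow> complex.
            \<forall>u>0. \<forall>z\<in>Z03.
              weber_WR03 R (- u / 2) (of_real (sqrt (2 * u)) * z) =
                of_real ((2 * u) powr (real R / 2 + 1)) *
                  (1 / of_real (u^2) * (\<Sum>s<n. (-1)^(s+1) * G_bar R s z / of_real (u^(2 * s))) + err u z)
              \<and> (\<forall>\<gamma>. admissible_path \<gamma> \<and> z \<in> range \<gamma> \<and> brace u \<gamma> > 0 \<longrightarrow>
                     ennreal (cmod (err u z)) \<le> error_bound n R u z \<gamma>))
         \<and> (\<forall>x::real. of_real x \<in> Z03)"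
proof (intro conjI allI real_in_Z03)
  \<comment> \<open>Taking the error as the difference makes the expansion an identity; the content
    is the bound.\<close>
  define err where "err = (\<lambda>u z. weber_WR03 R (- u / 2) (of_real (sqrt (2 * u)) * z) / of_real ((2 * u) powr (real R / 2 + 1))
     - partial_sum u R n z)"
  show "\<exists>err :: real \<Rightarrow> complex \<Rightarrow> complex.
            \<forall>u>0. \<forall>z\<in>Z03.
              weber_WR03 R (- u / 2) (of_real (sqrt (2 * u)) * z) =
                of_real ((2 * u) powr (real R / 2 + 1)) *
                  (1 / of_real (u^2) * (\<Sum>s<n. (-1)^(s+1) * G_bar R s z / of_real (u^(2 * s))) + err u z)
              \<and> (\<forall>\<gamma>. admissible_path \<gamma> \<and> z \<in> range \<gamma> \<and> brace u \<gamma> > 0 \<longrightarrow>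
                     ennreal (cmod (err u z)) \<le> error_bound n R u z \<gamma>)"
  proof (intro exI[of _ err] allI impI ballI conjI)
    fix u :: real and z assume u: "u > 0"
    have "1 / of_real (u^2) * (\<Sum>s<n. (-1)^(s+1) * G_bar R s z / of_real (u^(2 * s))) = partial_sum u R n z"
      unfolding partial_sum_def sum_distrib_left by (intro sum.cong) (simp_all add: power_add power2_eq_square)
    then show "weber_WR03 R (- u / 2) (of_real (sqrt (2 * u)) * z) =
        of_real ((2 * u) powr (real R / 2 + 1)) *
          (1 / of_real (u^2) * (\<Sum>s<n. (-1)^(s+1) * G_bar R s z / of_real (u^(2 * s))) + err u z)"
      using u by (simp add: err_def)
    fix \<gamma> assume \<gamma>: "admissible_path \<gamma> \<and> z \<in> range \<gamma> \<and> brace u \<gamma> > 0"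
    obtain eps1 eps2 \<rho> C where e: "\<And>z. z^2 + 1 \<noteq> 0 \<Longrightarrow> (err u has_field_derivative eps1 z) (at z)"
      "\<And>z. z^2 + 1 \<noteq> 0 \<Longrightarrow> (eps1 has_field_derivative eps2 z) (at z)"
      "\<And>z. z^2 + 1 \<noteq> 0 \<Longrightarrow> eps2 z + of_real (u^2) * (z^2 + 1) * err u z = (- 1)^(n + 1) / of_real (u^(2 * n)) * (z^2 + 1) * G_bar R n z"
      "\<And>z. cmod z \<ge> \<rho> \<Longrightarrow> Re z > 0 \<Longrightarrow> Re z \<le> 3/2 * \<bar>Im z\<bar> \<Longrightarrow> \<bar>Im z\<bar> \<le> 3/2 * Re z \<Longrightarrow>
       sqrt (cmod z) * cmod (err u z) \<le> C \<and> cmod (eps1 z) \<le> C"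
      using weber_WR03_remainder[OF u assms(2)] unfolding err_def by blast
    show "ennreal (cmod (err u z)) \<le> error_bound n R u z \<gamma>"
      by (rule admissible_path_error_bound[OF u e(1,2,3), where N=0 and \<rho>=\<rho> and C=C]) (use e(4) \<gamma> in auto)
  qed
qed

end
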